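(* Let $X$ be a good topological space, i.e. every open subset $U$ of $X$ has an open covering $U=\bigcup_iU_i$ such that every $U_i$ and every nonempty intersection $U_i\cap U_j$ and $U_i\cap U_j\cap U_k$ is simply connected. Let $P:\mathfrak{Off}(X)\to\mathsf{Grp}$ be the constant functor $U\mapsto\mathbf{1}$, where $\mathbf{1}$ is the groupoid with one object and one morphism. Then $P$ has an associated costack, namely the fundamental groupoid functor $U\mapsto\Pi_1(U)$ (i.e. $\hat P(U)=\Pi_1(U)$). Consequently the costack $U\mapsto\Pi_1(U)$ is a 2-terminal object in the 2-category of all costacks on $X$.
   Context: $\mathfrak{Off}(X)$ is the poset of open subsets of $X$; $\mathsf{Grp}$ is the 2-category of small groupoids, functors and natural transformations; $\Pi_1(U)$ is the fundamental groupoid of $U$ (objects: points of $U$; morphisms: homotopy classes of paths). A functor $\mathcal{G}:\mathfrak{Off}(X)\to\mathsf{Grp}$ is a costack if for every groupoid $\mathsf{D}$, every open $U$ and every open covering $U=\bigcup_iU_i$, the canonical functor from $\mathrm{Hom}_{\mathsf{Grp}}(\mathcal{G}(U),\mathsf{D})$ to the descent groupoid is an equivalence; the descent groupoid has objects $(f_i,\phi_{ij})$ with $f_i:\mathcal{G}(U_i)\to\mathsf{D}$ and natural isomorphisms $\phi_{ij}:f_i|_{U_i\cap U_j}\Rightarrow f_j|_{U_i\cap U_j}$ satisfying the cocycle condition $\phi_{jk}\circ\phi_{ij}=\phi_{ik}$ on triple intersections, and morphisms compatible families of natural transformations $\theta_i:f_i\Rightarrow g_i$; the canonical functor sends $f$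 to $(f|_{U_i},\mathrm{id})$ (restriction means precomposition with the functor induced by inclusion). Equivalently $\mathcal{G}(U)$ is the 2-colimit of $\coprod_{i,j,k}\mathcal{G}(U_i\cap U_j\cap U_k)\to\coprod_{i,j}\mathcal{G}(U_i\cap U_j)\rightrightarrows\coprod_i\mathcal{G}(U_i)$. An associated costack of a functor $\mathcal{F}:\mathfrak{Off}(X)\to\mathsf{Grp}$ is a costack $\hat{\mathcal{F}}$ with a morphism $\hat{\mathcal{F}}\to\mathcal{F}$ that is universal among morphisms from costacks to $\mathcal{F}$ in the 2-categorical sense (every morphism from a costack $Q$ to $\mathcal{F}$ factors through $\hat{\mathcal{F}}$, essentially uniquely, i.e. uniquely up to unique invertible 2-cell). An object $t$ of a 2-category is 2-terminal if for every object $x$ the category $\mathrm{Hom}(x,t)$ is equivalent to $\mathbf{1}$. *)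

theory Defs
  imports "HOL-Analysis.Analysis"
begin

text \<open>A (small) category presented by its object set, hom-sets, composition
  (Comp g f = g after f) and identities.  Morphisms are indexed by their
  endpoints; hom-sets of different pairs of objects are allowed to overlap.\<close>

record ('o, 'm) cat =
  Ob   :: "'o set"
  Hom  :: "'o \<Rightarrow> 'o \<Rightarrow> 'm set"
  Comp :: "'m \<Rightarrow> 'm \<Rightarrow> 'm"
  Idm  :: "'o \<Rightarrow> 'm"

definition groupoid :: "('o, 'm) cat \<Rightarrow> bool" where
  "groupoid C \<longleftrightarrow>
     (\<forall>a b. Hom C a b \<noteq> {} \<longrightarrow> a \<in> Ob C \<and> b \<in> Ob C) \<and>
     (\<forall>a\<in>Ob C. Idm C a \<in> Hom C a a) \<and>
     (\<forall>a b c f g. f \<in> Hom C a b \<and> g \<in> Hom C b c \<longrightarrow> Comp C g f \<in> Hom C a c) \<and>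
     (\<forall>a b c d f g h. f \<in> Hom C a b \<and> g \<in> Hom C b c \<and> h \<in> Hom C c d \<longrightarrow>
        Comp C h (Comp C g f) = Comp C (Comp C h g) f) \<and>
     (\<forall>a b f. f \<in> Hom C a b \<longrightarrow> Comp C f (Idm C a) = f \<and> Comp C (Idm C b) f = f) \<and>
     (\<forall>a b f. f \<in> Hom C a b \<longrightarrow>
        (\<exists>g\<in>Hom C b a. Comp C g f = Idm C a \<and> Comp C f g = Idm C b))"

record ('o1, 'm1, 'o2, 'm2) ftr =
  FO :: "'o1 \<Rightarrow> 'o2"
  FM :: "'o1 \<Rightarrow> 'o1 \<Rightarrow> 'm1 \<Rightarrow> 'm2"

definition is_functor :: "('o1, 'm1) cat \<Rightarrow> ('o2, 'm2) cat \<Rightarrow> ('o1, 'm1, 'o2, 'm2) ftr \<Rightarrow> bool" where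
  "is_functor C D F \<longleftrightarrow>
     (\<forall>a\<in>Ob C. FO F a \<in> Ob D) \<and>
     (\<forall>a b f. f \<in> Hom C a b \<longrightarrow> FM F a b f \<in> Hom D (FO F a) (FO F b)) \<and>
     (\<forall>a\<in>Ob C. FM F a a (Idm C a) = Idm D (FO F a)) \<and>
     (\<forall>a b c f g. f \<in> Hom C a b \<and> g \<in> Hom C b c \<longrightarrow>
        FM F a c (Comp C g f) = Comp D (FM F b c g) (FM F a b f))"

definition ftr_comp :: "('o2, 'm2, 'o3, 'm3) ftr \<Rightarrow> ('o1, 'm1, 'o2, 'm2) ftr \<Rightarrow> ('o1, 'm1, 'o3, 'm3) ftr" where
  "ftr_comp G F = \<lparr>FO = (\<lambda>a. FO G (FO F a)),
                 FM = (\<lambda>a b f. FM G (FO F a) (FO F b) (FM F a b f))\<rparr>"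

definition nat_trans :: "('o1, 'm1) cat \<Rightarrow> ('o2, 'm2) cat \<Rightarrow> ('o1, 'm1, 'o2, 'm2) ftr \<Rightarrow>
                          ('o1, 'm1, 'o2, 'm2) ftr \<Rightarrow> ('o1 \<Rightarrow> 'm2) \<Rightarrow> bool" where
  "nat_trans C D F G \<eta> \<longleftrightarrow> is_functor C D F \<and> is_functor C D G \<and>
     (\<forall>a\<in>Ob C. \<eta> a \<in> Hom D (FO F a) (FO G a)) \<and>
     (\<forall>a b f. f \<in> Hom C a b \<longrightarrow> Comp D (\<eta> b) (FM F a b f) = Comp D (FM G a b f) (\<eta> a))"

definition off_functor :: "('a::topological_space set \<Rightarrow> ('o, 'm) cat) \<Rightarrow>
                            ('a set \<Rightarrow> 'a set \<Rightarrow> ('o, 'm, 'o, 'm) ftr) \<Rightarrow> bool" where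
  "off_functor Gr Ind \<longleftrightarrow>
     (\<forall>U. open U \<longrightarrow> groupoid (Gr U)) \<and>
     (\<forall>V U. open V \<and> open U \<and> V \<subseteq> U \<longrightarrow> is_functor (Gr V) (Gr U) (Ind V U)) \<and>
     (\<forall>U. open U \<longrightarrow> (\<forall>a\<in>Ob (Gr U). FO (Ind U U) a = a) \<and>
                      (\<forall>a b f. f \<in> Hom (Gr U) a b \<longrightarrow> FM (Ind U U) a b f = f)) \<and>
     (\<forall>W V U. open W \<and> open V \<and> open U \<and> W \<subseteq> V \<and> V \<subseteq> U \<longrightarrow>
        (\<forall>a\<in>Ob (Gr W). FO (Ind W U) a = FO (ftr_comp (Ind V U) (Ind W V)) a) \<and>
        (\<forall>a b f. f \<in> Hom (Gr W) a b \<longrightarrow> FM (Ind W U) a b f = FM (ftr_comp (Ind V U) (Ind W V)) a b f))"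

text \<open>Open coverings are given as sets of open sets, indexed by themselves.
  A descent datum (f_i, phi_ij) for the covering \<U> with values in D.\<close>

definition descent_datum ::
  "('a::topological_space set \<Rightarrow> ('o, 'm) cat) \<Rightarrow> ('a set \<Rightarrow> 'a set \<Rightarrow> ('o, 'm, 'o, 'm) ftr) \<Rightarrow>
   ('do, 'dm) cat \<Rightarrow> 'a set set \<Rightarrow>
   ('a set \<Rightarrow> ('o, 'm, 'do, 'dm) ftr) \<Rightarrow> ('a set \<Rightarrow> 'a set \<Rightarrow> 'o \<Rightarrow> 'dm) \<Rightarrow> bool" where
  "descent_datum Gr Ind D \<U> f \<phi> \<longleftrightarrow>
     (\<forall>Ui\<in>\<U>. is_functor (Gr Ui) D (f Ui)) \<and>
     (\<forall>Ui\<in>\<U>. \<forall>Uj\<in>\<U>. nat_trans (Gr (Ui \<inter> Uj)) D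
         (ftr_comp (f Ui) (Ind (Ui \<inter> Uj) Ui)) (ftr_comp (f Uj) (Ind (Ui \<inter> Uj) Uj)) (\<phi> Ui Uj)) \<and>
     (\<forall>Ui\<in>\<U>. \<forall>Uj\<in>\<U>. \<forall>Uk\<in>\<U>. \<forall>a\<in>Ob (Gr (Ui \<inter> Uj \<inter> Uk)).
         Comp D (\<phi> Uj Uk (FO (Ind (Ui \<inter> Uj \<inter> Uk) (Uj \<inter> Uk)) a))
                (\<phi> Ui Uj (FO (Ind (Ui \<inter> Uj \<inter> Uk) (Ui \<inter> Uj)) a))
         = \<phi> Ui Uk (FO (Ind (Ui \<inter> Uj \<inter> Uk) (Ui \<inter> Uk)) a))"

definition descent_mor ::
  "('a::topological_space set \<Rightarrow> ('o, 'm) cat) \<Rightarrow> ('a set \<Rightarrow> 'a set \<Rightarrow> ('o, 'm, 'o, 'm) ftr) \<Rightarrow>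
   ('do, 'dm) cat \<Rightarrow> 'a set set \<Rightarrow>
   ('a set \<Rightarrow> ('o, 'm, 'do, 'dm) ftr) \<Rightarrow> ('a set \<Rightarrow> 'a set \<Rightarrow> 'o \<Rightarrow> 'dm) \<Rightarrow>
   ('a set \<Rightarrow> ('o, 'm, 'do, 'dm) ftr) \<Rightarrow> ('a set \<Rightarrow> 'a set \<Rightarrow> 'o \<Rightarrow> 'dm) \<Rightarrow>
   ('a set \<Rightarrow> 'o \<Rightarrow> 'dm) \<Rightarrow> bool" where
  "descent_mor Gr Ind D \<U> f \<phi> g \<psi> \<theta> \<longleftrightarrow>
     (\<forall>Ui\<in>\<U>. nat_trans (Gr Ui) D (f Ui) (g Ui) (\<theta> Ui)) \<and>
     (\<forall>Ui\<in>\<U>. \<forall>Uj\<in>\<U>. \<forall>a\<in>Ob (Gr (Ui \<inter> Uj)).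
         Comp D (\<psi> Ui Uj a) (\<theta> Ui (FO (Ind (Ui \<inter> Uj) Ui) a))
         = Comp D (\<theta> Uj (FO (Ind (Ui \<inter> Uj) Uj) a)) (\<phi> Ui Uj a))"

definition canon_f :: "('a set \<Rightarrow> 'a set \<Rightarrow> ('o, 'm, 'o, 'm) ftr) \<Rightarrow> 'a set \<Rightarrow>
    ('o, 'm, 'do, 'dm) ftr \<Rightarrow> 'a set \<Rightarrow> ('o, 'm, 'do, 'dm) ftr" where
  "canon_f Ind U F = (\<lambda>Ui. ftr_comp F (Ind Ui U))"

definition canon_phi :: "('a set \<Rightarrow> 'a set \<Rightarrow> ('o, 'm, 'o, 'm) ftr) \<Rightarrow> ('do, 'dm) cat \<Rightarrow> 'a set \<Rightarrow>
    ('o, 'm, 'do, 'dm) ftr \<Rightarrow> 'a set \<Rightarrow> 'a set \<Rightarrow> 'o \<Rightarrow> 'dm" where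
  "canon_phi Ind D U F = (\<lambda>Ui Uj a. Idm D (FO (ftr_comp (ftr_comp F (Ind Ui U)) (Ind (Ui \<inter> Uj) Ui)) a))"

text \<open>The canonical functor Hom(Gr U, D) \<rightarrow> Desc is an equivalence of groupoids:
  fully faithful and essentially surjective (natural transformations are identified
  when their components agree on all objects).\<close>

definition descent_equiv ::
  "('a::topological_space set \<Rightarrow> ('o, 'm) cat) \<Rightarrow> ('a set \<Rightarrow> 'a set \<Rightarrow> ('o, 'm, 'o, 'm) ftr) \<Rightarrow>
   ('do, 'dm) cat \<Rightarrow> 'a set \<Rightarrow> 'a set set \<Rightarrow> bool" where
  "descent_equiv Gr Ind D U \<U> \<longleftrightarrow>
     \<comment> \<open>fully faithful\<close>
     (\<forall>F G \<theta>. is_functor (Gr U) D F \<and> is_functor (Gr U) D G \<and>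
        descent_mor Gr Ind D \<U> (canon_f Ind U F) (canon_phi Ind D U F)
                                (canon_f Ind U G) (canon_phi Ind D U G) \<theta> \<longrightarrow>
        (\<exists>\<eta>. nat_trans (Gr U) D F G \<eta> \<and>
             (\<forall>Ui\<in>\<U>. \<forall>a\<in>Ob (Gr Ui). \<theta> Ui a = \<eta> (FO (Ind Ui U) a)) \<and>
             (\<forall>\<eta>'. nat_trans (Gr U) D F G \<eta>' \<and>
                    (\<forall>Ui\<in>\<U>. \<forall>a\<in>Ob (Gr Ui). \<theta> Ui a = \<eta>' (FO (Ind Ui U) a))
                    \<longrightarrow> (\<forall>a\<in>Ob (Gr U). \<eta>' a = \<eta> a)))) \<and>
     \<comment> \<open>essentially surjective\<close>
     (\<forall>f \<phi>. descent_datum Gr Ind D \<U> f \<phi> \<longrightarrow>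
        (\<exists>F \<theta>. is_functor (Gr U) D F \<and>
               descent_mor Gr Ind D \<U> (canon_f Ind U F) (canon_phi Ind D U F) f \<phi> \<theta>))"

definition costack_wrt ::
  "('a::topological_space set \<Rightarrow> ('o, 'm) cat) \<Rightarrow> ('a set \<Rightarrow> 'a set \<Rightarrow> ('o, 'm, 'o, 'm) ftr) \<Rightarrow>
   ('do, 'dm) cat \<Rightarrow> bool" where
  "costack_wrt Gr Ind D \<longleftrightarrow>
     (\<forall>U \<U>. open U \<and> (\<forall>V\<in>\<U>. open V) \<and> \<Union>\<U> = U \<longrightarrow> descent_equiv Gr Ind D U \<U>)"

definition pseudo_nat ::
  "('a::topological_space set \<Rightarrow> ('qo, 'qm) cat) \<Rightarrow> ('a set \<Rightarrow> 'a set \<Rightarrow> ('qo, 'qm, 'qo, 'qm) ftr) \<Rightarrow>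
   ('a set \<Rightarrow> ('go, 'gm) cat) \<Rightarrow> ('a set \<Rightarrow> 'a set \<Rightarrow> ('go, 'gm, 'go, 'gm) ftr) \<Rightarrow>
   ('a set \<Rightarrow> ('qo, 'qm, 'go, 'gm) ftr) \<Rightarrow> ('a set \<Rightarrow> 'a set \<Rightarrow> 'qo \<Rightarrow> 'gm) \<Rightarrow> bool" where
  "pseudo_nat Q QI G GI A a \<longleftrightarrow>
     (\<forall>U. open U \<longrightarrow> is_functor (Q U) (G U) (A U)) \<and>
     (\<forall>V U. open V \<and> open U \<and> V \<subseteq> U \<longrightarrow>
        nat_trans (Q V) (G U) (ftr_comp (GI V U) (A V)) (ftr_comp (A U) (QI V U)) (a V U)) \<and>
     (\<forall>U. open U \<longrightarrow> (\<forall>x\<in>Ob (Q U). a U U x = Idm (G U) (FO (A U) x))) \<and>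
     (\<forall>W V U. open W \<and> open V \<and> open U \<and> W \<subseteq> V \<and> V \<subseteq> U \<longrightarrow>
        (\<forall>x\<in>Ob (Q W). a W U x =
            Comp (G U) (a V U (FO (QI W V) x))
                       (FM (GI V U) (FO (GI W V) (FO (A W) x)) (FO (A V) (FO (QI W V) x)) (a W V x))))"

definition modif ::
  "('a::topological_space set \<Rightarrow> ('qo, 'qm) cat) \<Rightarrow> ('a set \<Rightarrow> 'a set \<Rightarrow> ('qo, 'qm, 'qo, 'qm) ftr) \<Rightarrow>
   ('a set \<Rightarrow> ('go, 'gm) cat) \<Rightarrow> ('a set \<Rightarrow> 'a set \<Rightarrow> ('go, 'gm, 'go, 'gm) ftr) \<Rightarrow>
   ('a set \<Rightarrow> ('qo, 'qm, 'go, 'gm) ftr) \<Rightarrow> ('a set \<Rightarrow> 'a set \<Rightarrow> 'qo \<Rightarrow> 'gm) \<Rightarrow>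
   ('a set \<Rightarrow> ('qo, 'qm, 'go, 'gm) ftr) \<Rightarrow> ('a set \<Rightarrow> 'a set \<Rightarrow> 'qo \<Rightarrow> 'gm) \<Rightarrow>
   ('a set \<Rightarrow> 'qo \<Rightarrow> 'gm) \<Rightarrow> bool" where
  "modif Q QI G GI A a B b m \<longleftrightarrow>
     (\<forall>U. open U \<longrightarrow> nat_trans (Q U) (G U) (A U) (B U) (m U)) \<and>
     (\<forall>V U. open V \<and> open U \<and> V \<subseteq> U \<longrightarrow> (\<forall>x\<in>Ob (Q V).
        Comp (G U) (m U (FO (QI V U) x)) (a V U x)
        = Comp (G U) (b V U x) (FM (GI V U) (FO (A V) x) (FO (B V) x) (m V x))))"

definition modif_eq :: "('a::topological_space set \<Rightarrow> ('qo, 'qm) cat) \<Rightarrow>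
    ('a set \<Rightarrow> 'qo \<Rightarrow> 'gm) \<Rightarrow> ('a set \<Rightarrow> 'qo \<Rightarrow> 'gm) \<Rightarrow> bool" where
  "modif_eq Q m m' \<longleftrightarrow> (\<forall>U. open U \<longrightarrow> (\<forall>x\<in>Ob (Q U). m U x = m' U x))"

definition pn_comp_F :: "('a set \<Rightarrow> ('go, 'gm, 'po, 'pm) ftr) \<Rightarrow> ('a set \<Rightarrow> ('qo, 'qm, 'go, 'gm) ftr) \<Rightarrow>
    'a set \<Rightarrow> ('qo, 'qm, 'po, 'pm) ftr" where
  "pn_comp_F E A = (\<lambda>U. ftr_comp (E U) (A U))"

definition pn_comp_c :: "('a set \<Rightarrow> ('po, 'pm) cat) \<Rightarrow> ('a set \<Rightarrow> 'a set \<Rightarrow> ('go, 'gm, 'go, 'gm) ftr) \<Rightarrow>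
    ('a set \<Rightarrow> 'a set \<Rightarrow> ('qo, 'qm, 'qo, 'qm) ftr) \<Rightarrow>
    ('a set \<Rightarrow> ('go, 'gm, 'po, 'pm) ftr) \<Rightarrow> ('a set \<Rightarrow> 'a set \<Rightarrow> 'go \<Rightarrow> 'pm) \<Rightarrow>
    ('a set \<Rightarrow> ('qo, 'qm, 'go, 'gm) ftr) \<Rightarrow> ('a set \<Rightarrow> 'a set \<Rightarrow> 'qo \<Rightarrow> 'gm) \<Rightarrow>
    'a set \<Rightarrow> 'a set \<Rightarrow> 'qo \<Rightarrow> 'pm" where
  "pn_comp_c P GI QI E e A a = (\<lambda>V U x.
     Comp (P U) (FM (E U) (FO (GI V U) (FO (A V) x)) (FO (A U) (FO (QI V U) x)) (a V U x))
                (e V U (FO (A V) x)))"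

definition whisker :: "('a set \<Rightarrow> ('go, 'gm, 'po, 'pm) ftr) \<Rightarrow> ('a set \<Rightarrow> ('qo, 'qm, 'go, 'gm) ftr) \<Rightarrow>
    ('a set \<Rightarrow> ('qo, 'qm, 'go, 'gm) ftr) \<Rightarrow> ('a set \<Rightarrow> 'qo \<Rightarrow> 'gm) \<Rightarrow> 'a set \<Rightarrow> 'qo \<Rightarrow> 'pm" where
  "whisker E A B m = (\<lambda>U x. FM (E U) (FO (A U) x) (FO (B U) x) (m U x))"

definition good_space :: "'a::topological_space itself \<Rightarrow> bool" where
  "good_space _ \<longleftrightarrow> (\<forall>U::'a set. open U \<longrightarrow>
     (\<exists>\<U>. (\<forall>V\<in>\<U>. open V) \<and> \<Union>\<U> = U \<and>
          (\<forall>Ui\<in>\<U>. simply_connected Ui) \<and>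
          (\<forall>Ui\<in>\<U>. \<forall>Uj\<in>\<U>. Ui \<inter> Uj \<noteq> {} \<longrightarrow> simply_connected (Ui \<inter> Uj)) \<and>
          (\<forall>Ui\<in>\<U>. \<forall>Uj\<in>\<U>. \<forall>Uk\<in>\<U>. Ui \<inter> Uj \<inter> Uk \<noteq> {} \<longrightarrow> simply_connected (Ui \<inter> Uj \<inter> Uk))))"

definition pclass :: "'a::topological_space set \<Rightarrow> (real \<Rightarrow> 'a) \<Rightarrow> (real \<Rightarrow> 'a) set" where
  "pclass U p = {q. homotopic_paths U p q}"

definition Pi1 :: "'a::topological_space set \<Rightarrow> ('a, (real \<Rightarrow> 'a) set) cat" where
  "Pi1 U = \<lparr>Ob = U,
            Hom = (\<lambda>x y. {pclass U p | p. path p \<and> path_image p \<subseteq> U \<and>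
                                          pathstart p = x \<and> pathfinish p = y}),
            Comp = (\<lambda>G F. pclass U ((SOME p. p \<in> F) +++ (SOME q. q \<in> G))),
            Idm = (\<lambda>x. pclass U (\<lambda>t. x))\<rparr>"

definition Pi1_ind :: "'a::topological_space set \<Rightarrow> 'a set \<Rightarrow> ('a, (real \<Rightarrow> 'a) set, 'a, (real \<Rightarrow> 'a) set) ftr" where
  "Pi1_ind V U = \<lparr>FO = (\<lambda>x. x), FM = (\<lambda>x y F. pclass U (SOME p. p \<in> F))\<rparr>"

definition one_grpd :: "(unit, unit) cat" where
  "one_grpd = \<lparr>Ob = {()}, Hom = (\<lambda>_ _. {()}), Comp = (\<lambda>_ _. ()), Idm = (\<lambda>_. ())\<rparr>"

definition P_const :: "'a set \<Rightarrow> (unit, unit) cat" where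
  "P_const U = one_grpd"

definition P_ind :: "'a set \<Rightarrow> 'a set \<Rightarrow> (unit, unit, unit, unit) ftr" where
  "P_ind V U = \<lparr>FO = (\<lambda>_. ()), FM = (\<lambda>_ _ _. ())\<rparr>"

definition eps_F :: "'a set \<Rightarrow> ('b, 'c, unit, unit) ftr" where
  "eps_F U = \<lparr>FO = (\<lambda>_. ()), FM = (\<lambda>_ _ _. ())\<rparr>"

definition eps_c :: "'a set \<Rightarrow> 'a set \<Rightarrow> 'b \<Rightarrow> unit" where
  "eps_c V U x = ()"

end

theory Submission
  imports Defs
begin

text \<open>
  The groupoid \<open>\<Pi>\<^sub>1(U)\<close> satisfies descent for every open covering (van Kampen): a descent datum
  assigns to a path contained in one member of the covering a morphism of \<open>D\<close>, and compactness of
  the interval extends this assignment uniquely and multiplicatively to all paths; compactness of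
  the square makes the result invariant under homotopy.

  For the universal property, simply connected open sets form a basis, and on such a set \<open>W\<close> all
  points of \<open>\<Pi>\<^sub>1(W)\<close> are uniquely isomorphic.  Hence on the basis there is an essentially unique
  morphism \<open>Q \<Rightarrow> \<Pi>\<^sub>1\<close>, for example the constant one at a base point.  Descent for \<open>Q\<close> along the covering
  of \<open>U\<close> by all basic open subsets (a sieve on the basis, so that no condition on intersections is
  needed) propagates existence and uniqueness to all open sets.
\<close>

section \<open>Path classes in topological spaces\<close>

text \<open>A general space has no straight lines, so the elementary homotopies are made linearly in
  an interval or a rectangle and then pushed into the space. The constructions use choices that are
  not natural: a representative of a class, a covering set at a point, a base point of a basic set.
  They are therefore shown to be independent of the choice, or the 2-cells between them are pinned
  down by an equation with a unique solution, from which coherence follows. This matters because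
  morphisms of costacks are only pseudonatural, while their 2-cells must satisfy exact equations for
  composable inclusions. A further obstacle is that an object of \<open>Q U\<close>, unlike a point
  of \<open>U\<close>, need not come from a smaller open set; equations over \<open>Q U\<close>
  cannot be localised pointwise and are tested through full faithfulness of descent. Finally,
  \<open>P\<close> is constantly the terminal groupoid, so 2-cells into it exist freely and are all
  equal, and the universal property of the morphism to \<open>P\<close> amounts to
  2-terminality.\<close>

abbreviation path_in :: "'a::topological_space set \<Rightarrow> 'a \<Rightarrow> 'a \<Rightarrow> (real \<Rightarrow> 'a) \<Rightarrow> bool" where
  "path_in U x y p \<equiv> path p \<and> path_image p \<subseteq> U \<and> pathstart p = x \<and> pathfinish p = y"

text \<open>The source of the elementary homotopies below: the linear homotopy lives in the convex
  parameter domain \<open>K\<close>, and only its image under \<open>h\<close> lies in the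
  space.\<close>

lemma homotopic_paths_convex_image:
  fixes h :: "'b::real_normed_vector \<Rightarrow> 'a::topological_space"
  assumes "convex K" "continuous_on K h" "h ` K \<subseteq> U" "path p" "path q"
    "path_image p \<subseteq> K" "path_image q \<subseteq> K" "pathstart p = pathstart q" "pathfinish p = pathfinish q"
  shows "homotopic_paths U (h \<circ> p) (h \<circ> q)"
proof (rule homotopic_paths_continuous_image)
  show "homotopic_paths K p q"
  proof (rule homotopic_paths_linear)
    fix t :: real assume "t \<in> {0..1}"
    then have "p t \<in> K" "q t \<in> K"
      using assms by (auto simp: path_image_def)
    then show "closed_segment (p t) (q t) \<subseteq> K"
      using \<open>convex K\<close> convex_contains_segment by blast
  qed (use assms in auto)
qed (use assms in auto)

lemma homotopic_paths_reparam_image: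
  assumes "path p" "path_image p \<subseteq> U" "path f" "path g" "path_image f \<subseteq> {0..1}" "path_image g \<subseteq> {0..1}"
    "pathstart f = pathstart g" "pathfinish f = pathfinish g"
  shows "homotopic_paths U (p \<circ> f) (p \<circ> g)"
  using assms
  by (intro homotopic_paths_convex_image[of "{0..1}"]) (auto simp: path_def path_image_def)

lemma comp_linepath_0_1 [simp]: "p \<circ> linepath 0 (1::real) = p"
  by (simp add: linepath_def fun_eq_iff)

lemma comp_linepath_refl: "p \<circ> linepath a a = (\<lambda>_. p a)"
  by (simp add: linepath_def fun_eq_iff flip: scaleR_left_distrib)

lemma path_const [simp]: "path (\<lambda>_. x)"
  by (simp add: path_def)

lemma path_image_const [simp]: "path_image (\<lambda>_. x) = {x}"
  by (auto simp: path_image_def)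

lemma pathstart_const [simp]: "pathstart (\<lambda>_. x) = x" and pathfinish_const [simp]: "pathfinish (\<lambda>_. x) = x"
  by (simp_all add: pathstart_def pathfinish_def)

lemma path_in_join: "path_in U x y p \<Longrightarrow> path_in U y z q \<Longrightarrow> path_in U x z (p +++ q)"
  by (auto simp: path_image_join)

lemma path_in_const: "x \<in> U \<Longrightarrow> path_in U x x (\<lambda>_. x)"
  by (auto simp: pathstart_def pathfinish_def)

lemma path_in_endpoints: "path_in U x y p \<Longrightarrow> x \<in> U \<and> y \<in> U"
  by (auto simp: pathstart_def pathfinish_def path_image_def)

lemma path_in_0_1: "path p \<Longrightarrow> path_image p \<subseteq> V \<Longrightarrow> path_in V (p 0) (p 1) p"
  by (simp add: pathstart_def pathfinish_def)

lemma path_image_0_1: "path_image p \<subseteq> V \<Longrightarrow> p 0 \<in> V" "path_image p \<subseteq> V \<Longrightarrow> p 1 \<in> V"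
  by (auto simp: path_image_def)

text \<open>Here and in the next two lemmas both sides are \<open>p\<close> composed with paths in
  the unit interval that have the same ends, so the unit and inverse laws reduce to
  reparametrisation.\<close>

lemma homotopic_paths_join_const:
  assumes "path p" "path_image p \<subseteq> U"
  shows "homotopic_paths U (p +++ (\<lambda>_. pathfinish p)) p"
proof -
  have "homotopic_paths U (p \<circ> (linepath 0 1 +++ linepath 1 1)) (p \<circ> linepath 0 1)"
    using assms by (intro homotopic_paths_reparam_image) (auto simp: path_image_join closed_segment_eq_real_ivl)
  then show ?thesis
    by (simp add: path_compose_join comp_linepath_refl pathfinish_def)
qed

lemma homotopic_paths_const_join:
  assumes "path p" "path_image p \<subseteq> U"
  shows "homotopic_paths U ((\<lambda>_. pathstart p) +++ p) p"
proof -
  have "homotopic_paths U (p \<circ> (linepath 0 0 +++ linepath 0 1)) (p \<circ> linepath 0 1)"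
    using assms by (intro homotopic_paths_reparam_image) (auto simp: path_image_join closed_segment_eq_real_ivl)
  then show ?thesis
    by (simp add: path_compose_join comp_linepath_refl pathstart_def)
qed

lemma homotopic_paths_join_reversepath:
  assumes "path p" "path_image p \<subseteq> U"
  shows "homotopic_paths U (p +++ reversepath p) (\<lambda>_. pathstart p)"
proof -
  have "homotopic_paths U (p \<circ> (linepath 0 1 +++ reversepath (linepath 0 1))) (p \<circ> linepath 0 0)"
    using assms by (intro homotopic_paths_reparam_image) (auto simp: path_image_join closed_segment_eq_real_ivl)
  then show ?thesis
    by (simp add: path_compose_join comp_linepath_refl pathstart_def path_compose_reversepath del: reversepath_linepath)
qed

lemma path_compose_on:
  assumes "continuous_on K h" "path f" "path_image f \<subseteq> K"
  shows "path (h \<circ> f)"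
  using assms by (metis continuous_on_compose continuous_on_subset path_def path_image_def)

text \<open>\<open>simply_connected\<close> says that any two loops are freely homotopic. Applied to
  two constant loops, the track of the base point during the homotopy is the desired path.\<close>

lemma simply_connected_path_in:
  fixes W :: "'a::topological_space set"
  assumes "simply_connected W" "x \<in> W" "y \<in> W"
  obtains p where "path_in W x y p"
proof -
  have "homotopic_loops W (\<lambda>_. x) (\<lambda>_. y)"
    using assms unfolding simply_connected_def by (auto simp: pathstart_def pathfinish_def)
  then obtain h :: "real \<times> real \<Rightarrow> 'a" where h: "continuous_on ({0..1} \<times> {0..1}) h"
    "h \<in> ({0..1} \<times> {0..1}) \<rightarrow> W" "h (0,0) = x" "h (1,0) = y"
    by (auto simp: homotopic_loops)
  show ?thesis
  proof
    have "path_image (linepath (0::real,0::real) (1,0)) \<subseteq> {0..1} \<times> {0..1}"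
      by (auto simp: path_image_def linepath_def)
    then show "path_in W x y (h \<circ> linepath (0,0) (1,0))"
      using h by (auto simp: pathstart_compose pathfinish_compose path_image_compose intro!: path_compose_on)
  qed
qed

text \<open>The free homotopy from \<open>?r\<close> to a constant loop may move the base point; its
  track is the loop \<open>e\<close>. Going round the parameter square the other way shows that
  \<open>?r\<close> is homotopic, with fixed ends, to \<open>e\<close> followed by a constant and by
  the reverse of \<open>e\<close>, which is null-homotopic.\<close>

lemma simply_connected_homotopic_paths:
  fixes W :: "'a::topological_space set"
  assumes W: "simply_connected W" and p: "path_in W x y p" and q: "path_in W x y q"
  shows "homotopic_paths W p q"
proof -
  let ?K = "{0..1::real} \<times> {0..1::real}" and ?r = "p +++ reversepath q"
  have xW: "x \<in> W" using p by (auto simp: pathstart_def path_image_def)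
  have "path ?r" "path_image ?r \<subseteq> W" "pathstart ?r = x" "pathfinish ?r = x"
    using p q by (simp_all add: path_image_join)
  then have "homotopic_loops W ?r (\<lambda>_. x)"
    using W[unfolded simply_connected_def, rule_format, of ?r "\<lambda>_. x"] path_in_const[OF xW] by simp
  then obtain h :: "real \<times> real \<Rightarrow> 'a" where h: "continuous_on ?K h"
    "h \<in> ?K \<rightarrow> W" and h0: "\<And>t. t \<in> {0..1} \<Longrightarrow> h (0,t) = ?r t" and h1: "\<And>t. t \<in> {0..1} \<Longrightarrow> h (1,t) = x"
    and hl: "\<And>t. t \<in> {0..1} \<Longrightarrow> h (t,0) = h (t,1)"
    by (auto simp: homotopic_loops pathstart_def pathfinish_def)
  \<comment> \<open>the loop p q\<inverse> is the left edge of the square; the bottom and top edges agree and the right edge is constant\<close>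
  have conv: "convex ?K" by (intro convex_Times) auto
  have seg: "path_image (linepath a b) \<subseteq> ?K" if "a \<in> ?K" "b \<in> ?K" for a b
    unfolding path_image_linepath using that conv convex_contains_segment by blast
  have hseg: "path_in W (h a) (h b) (h \<circ> linepath a b)" if "a \<in> ?K" "b \<in> ?K" for a b
    using path_compose_on[OF h(1) path_linepath seg[OF that]] h(2) seg[OF that]
    by (auto simp: pathstart_compose pathfinish_compose path_image_compose simp del: path_image_linepath)
  define e where "e = h \<circ> linepath (0,0) (1,0)"
  have corners: "h (0,0) = x" "h (1,0) = x" "h (1,1) = x" "h (0,1) = x"
    using h0[of 0] h0[of 1] h1[of 0] h1[of 1] hl[of 0] p q
    by (auto simp: joinpaths_def pathstart_def reversepath_def)
  have e: "path_in W x x e"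
    using hseg[of "(0,0)" "(1,0)"] corners by (simp add: e_def)
  let ?t = "linepath (0,0) (1,0) +++ (linepath (1,0) (1,1) +++ linepath (1,1) (0,1 :: real)) :: real \<Rightarrow> real \<times> real"
  have "path_image ?t \<subseteq> ?K"
    by (intro subset_path_image_join seg) auto
  then have "homotopic_paths W (h \<circ> linepath (0,0) (0,1)) (h \<circ> ?t)"
    using seg[of "(0,0)" "(0,1)"] h(2) by (intro homotopic_paths_convex_image[OF conv h(1)]) auto
  moreover have "homotopic_paths W (h \<circ> linepath (0,0) (0,1)) ?r"
  proof (rule homotopic_paths_eq)
    show "(h \<circ> linepath (0,0) (0,1)) t = ?r t" if "t \<in> {0..1}" for t
      using h0[OF that] by (simp add: linepath_def)
  qed (use hseg[of "(0,0)" "(0,1)"] in simp_all)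
  moreover have "homotopic_paths W (h \<circ> ?t) (e +++ ((\<lambda>_. x) +++ reversepath e))"
    unfolding path_compose_join e_def[symmetric]
  proof (intro homotopic_paths_join)
    show "homotopic_paths W e e" using e by simp
    show "homotopic_paths W (h \<circ> linepath (1,0) (1,1)) (\<lambda>_. x)"
      using hseg[of "(1,0)" "(1,1)"] h1
      by (intro homotopic_paths_eq) (auto simp: linepath_def)
    show "homotopic_paths W (h \<circ> linepath (1,1) (0,1)) (reversepath e)"
      using hseg[of "(1,1)" "(0,1)"] hl
      by (intro homotopic_paths_eq) (auto simp: linepath_def reversepath_def e_def)
  qed (use corners e in \<open>auto simp: pathstart_compose pathfinish_compose\<close>)
  moreover have "homotopic_paths W (e +++ ((\<lambda>_. x) +++ reversepath e)) (e +++ reversepath e)"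
    using e homotopic_paths_const_join[of "reversepath e" W] by (intro homotopic_paths_join) auto
  moreover have "homotopic_paths W (e +++ reversepath e) (\<lambda>_. x)"
    using homotopic_paths_join_reversepath[of e W] e by simp
  ultimately have r: "homotopic_paths W ?r (\<lambda>_. x)"
    by (meson homotopic_paths_sym homotopic_paths_trans)
  \<comment> \<open>The null path \<open>reversepath q +++ q\<close> is inserted behind
    \<open>p\<close>; after reassociation the loop \<open>?r\<close> stands in front of
    \<open>q\<close> and contracts.\<close>
  have "homotopic_paths W p (p +++ (\<lambda>_. y))"
    using homotopic_paths_join_const[of p W] p by (auto intro: homotopic_paths_sym)
  also have "homotopic_paths W \<dots> (p +++ (reversepath q +++ q))"
    using homotopic_paths_join_reversepath[of "reversepath q" W] p q
    by (intro homotopic_paths_join) (auto intro: homotopic_paths_sym)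
  also have "homotopic_paths W \<dots> (?r +++ q)"
    using p q by (intro homotopic_paths_assoc) auto
  also have "homotopic_paths W \<dots> ((\<lambda>_. x) +++ q)"
    using r q by (intro homotopic_paths_join) auto
  also have "homotopic_paths W \<dots> q"
    using homotopic_paths_const_join[of q W] q by auto
  finally show ?thesis .
qed

section \<open>The fundamental groupoid\<close>

text \<open>The hypotheses put \<open>p\<close> into its own class; the class of a map that is not a
  path in \<open>U\<close> is empty.\<close>

lemma pclass_eq_iff:
  "path p \<Longrightarrow> path_image p \<subseteq> U \<Longrightarrow> pclass U p = pclass U q \<longleftrightarrow> homotopic_paths U p q"
  unfolding pclass_def
  using homotopic_paths_sym homotopic_paths_trans homotopic_paths_refl by blast

lemma homotopic_paths_SOME_pclass:
  "path p \<Longrightarrow> path_image p \<subseteq> U \<Longrightarrow> homotopic_paths U p (SOME q. q \<in> pclass U p)"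
  unfolding pclass_def by (rule someI2[of _ p]) auto

lemma Ob_Pi1 [simp]: "Ob (Pi1 U) = U"
  by (simp add: Pi1_def)

lemma Hom_Pi1_iff: "f \<in> Hom (Pi1 U) x y \<longleftrightarrow> (\<exists>p. path_in U x y p \<and> f = pclass U p)"
  by (auto simp: Pi1_def)

lemma pclass_in_Hom [intro]: "path_in U x y p \<Longrightarrow> pclass U p \<in> Hom (Pi1 U) x y"
  by (auto simp: Hom_Pi1_iff)

lemma Hom_Pi1E:
  assumes "f \<in> Hom (Pi1 U) x y"
  obtains p where "path_in U x y p" "f = pclass U p"
  using assms unfolding Hom_Pi1_iff by blast

lemma Idm_Pi1: "Idm (Pi1 U) x = pclass U (\<lambda>_. x)"
  by (simp add: Pi1_def)

text \<open>Composition is defined through chosen representatives; this frees it from the choice.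
  Concatenation runs \<open>p\<close> first, so its order is opposite to that of
  \<open>Comp\<close>.\<close>

lemma Comp_Pi1:
  assumes "path_in U x y p" "path_in U y z q"
  shows "Comp (Pi1 U) (pclass U q) (pclass U p) = pclass U (p +++ q)"
proof -
  let ?p = "SOME r. r \<in> pclass U p" and ?q = "SOME r. r \<in> pclass U q"
  have "homotopic_paths U (p +++ q) (?p +++ ?q)"
    using assms by (intro homotopic_paths_join homotopic_paths_SOME_pclass) auto
  then have "pclass U (p +++ q) = pclass U (?p +++ ?q)"
    using pclass_eq_iff[of "p +++ q" U] path_in_join[OF assms] by simp
  then show ?thesis by (simp add: Pi1_def)
qed

lemma FO_Pi1_ind [simp]: "FO (Pi1_ind V U) x = x"
  by (simp add: Pi1_ind_def)

lemma FM_Pi1_ind: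
  assumes "path p" "path_image p \<subseteq> V" "V \<subseteq> U"
  shows "FM (Pi1_ind V U) x y (pclass V p) = pclass U p"
proof -
  have "homotopic_paths U p (SOME q. q \<in> pclass V p)"
    using homotopic_paths_SOME_pclass assms homotopic_paths_subset by blast
  then have "pclass U p = pclass U (SOME q. q \<in> pclass V p)"
    using assms by (subst pclass_eq_iff) auto
  then show ?thesis by (simp add: Pi1_ind_def)
qed

lemma groupoid_Pi1: "groupoid (Pi1 U)"
  unfolding groupoid_def
proof (intro conjI allI impI ballI)
  show "\<And>a b. Hom (Pi1 U) a b \<noteq> {} \<Longrightarrow> a \<in> Ob (Pi1 U)" "\<And>a b. Hom (Pi1 U) a b \<noteq> {} \<Longrightarrow> b \<in> Ob (Pi1 U)"
    using path_in_endpoints by (fastforce simp: Hom_Pi1_iff)+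
  show "\<And>a. a \<in> Ob (Pi1 U) \<Longrightarrow> Idm (Pi1 U) a \<in> Hom (Pi1 U) a a"
    by (auto simp: Idm_Pi1 path_in_const)
  show "Comp (Pi1 U) g f \<in> Hom (Pi1 U) a c" if "f \<in> Hom (Pi1 U) a b \<and> g \<in> Hom (Pi1 U) b c" for a b c f g
    using that by (metis Hom_Pi1E Comp_Pi1 pclass_in_Hom path_in_join)
  show "Comp (Pi1 U) h (Comp (Pi1 U) g f) = Comp (Pi1 U) (Comp (Pi1 U) h g) f"
    if fgh: "f \<in> Hom (Pi1 U) a b \<and> g \<in> Hom (Pi1 U) b c \<and> h \<in> Hom (Pi1 U) c d" for a b c d f g h
  proof -
    obtain p q r where p: "path_in U a b p" "f = pclass U p" and q: "path_in U b c q" "g = pclass U q"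
      and r: "path_in U c d r" "h = pclass U r"
      using fgh unfolding Hom_Pi1_iff by blast
    have "pclass U ((p +++ q) +++ r) = pclass U (p +++ (q +++ r))"
      using p q r homotopic_paths_assoc[of p U q r]
      by (subst pclass_eq_iff) (auto simp: path_image_join intro: homotopic_paths_sym)
    then show ?thesis
      using Comp_Pi1[OF p(1) q(1)] Comp_Pi1[OF q(1) r(1)] Comp_Pi1[OF p(1) path_in_join[OF q(1) r(1)]]
        Comp_Pi1[OF path_in_join[OF p(1) q(1)] r(1)] p q r by simp
  qed
  fix a b f assume "f \<in> Hom (Pi1 U) a b"
  then obtain p where p: "path_in U a b p" "f = pclass U p" by (rule Hom_Pi1E)
  note ab = path_in_endpoints[OF p(1)]
  have "pclass U ((\<lambda>_. a) +++ p) = pclass U p" "pclass U (p +++ (\<lambda>_. b)) = pclass U p"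
    using homotopic_paths_const_join[of p U] homotopic_paths_join_const[of p U] p(1)
      pclass_eq_iff[of p U] homotopic_paths_sym by metis+
  then show "Comp (Pi1 U) f (Idm (Pi1 U) a) = f" "Comp (Pi1 U) (Idm (Pi1 U) b) f = f"
    using Comp_Pi1[OF p(1) path_in_const] Comp_Pi1[OF path_in_const p(1)] ab p by (simp_all add: Idm_Pi1)
  let ?q = "reversepath p"
  have q: "path_in U b a ?q" using p by auto
  have "pclass U (p +++ ?q) = pclass U (\<lambda>_. a)" "pclass U (?q +++ p) = pclass U (\<lambda>_. b)"
    using homotopic_paths_join_reversepath[of p U] homotopic_paths_join_reversepath[of ?q U] p q
    by (simp_all add: pclass_eq_iff path_image_join)
  then show "\<exists>g\<in>Hom (Pi1 U) b a. Comp (Pi1 U) g f = Idm (Pi1 U) a \<and> Comp (Pi1 U) f g = Idm (Pi1 U) b"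
    using Comp_Pi1[OF p(1) q] Comp_Pi1[OF q p(1)] p pclass_in_Hom[OF q] by (auto simp: Idm_Pi1)
qed

lemma is_functor_Pi1_ind: "V \<subseteq> U \<Longrightarrow> is_functor (Pi1 V) (Pi1 U) (Pi1_ind V U)"
  unfolding is_functor_def
proof (intro conjI allI impI ballI)
  assume VU: "V \<subseteq> U"
  show "\<And>a. a \<in> Ob (Pi1 V) \<Longrightarrow> FO (Pi1_ind V U) a \<in> Ob (Pi1 U)"
    using VU by auto
  show "FM (Pi1_ind V U) a b f \<in> Hom (Pi1 U) (FO (Pi1_ind V U) a) (FO (Pi1_ind V U) b)"
    if f: "f \<in> Hom (Pi1 V) a b" for a b f
  proof -
    obtain p where p: "path_in V a b p" "f = pclass V p" using f by (rule Hom_Pi1E)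
    have "path_in U a b p" using p VU by auto
    then show ?thesis using p VU by (auto simp: FM_Pi1_ind)
  qed
  show "FM (Pi1_ind V U) a a (Idm (Pi1 V) a) = Idm (Pi1 U) (FO (Pi1_ind V U) a)" if "a \<in> Ob (Pi1 V)" for a
    using that VU by (simp add: Idm_Pi1 FM_Pi1_ind)
  show "FM (Pi1_ind V U) a c (Comp (Pi1 V) g f)
      = Comp (Pi1 U) (FM (Pi1_ind V U) b c g) (FM (Pi1_ind V U) a b f)"
    if fg: "f \<in> Hom (Pi1 V) a b \<and> g \<in> Hom (Pi1 V) b c" for a b c f g
  proof -
    obtain p q where p: "path_in V a b p" "f = pclass V p" and q: "path_in V b c q" "g = pclass V q"
      using fg unfolding Hom_Pi1_iff by blast
    have pq: "path_in U a b p" "path_in U b c q" using p q VU by auto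
    show ?thesis
      using Comp_Pi1[OF p(1) q(1)] Comp_Pi1[OF pq] path_in_join[OF p(1) q(1)] p q VU
      by (simp add: FM_Pi1_ind)
  qed
qed

lemma off_functor_Pi1: "off_functor Pi1 Pi1_ind"
  unfolding off_functor_def
proof (intro conjI allI impI ballI)
  show "FM (Pi1_ind U U) a b f = f" if "f \<in> Hom (Pi1 U) a b" for U :: "'a set" and a b f
    using that by (auto simp: Hom_Pi1_iff FM_Pi1_ind)
  show "FM (Pi1_ind W U) a b f = FM (ftr_comp (Pi1_ind V U) (Pi1_ind W V)) a b f"
    if W: "open W \<and> open V \<and> open U \<and> W \<subseteq> V \<and> V \<subseteq> U" and f: "f \<in> Hom (Pi1 W) a b" for W V U :: "'a set" and a b f
  proof -
    obtain p where p: "path_in W a b p" "f = pclass W p" using f by (rule Hom_Pi1E)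
    have "path_image p \<subseteq> V" "W \<subseteq> U" "V \<subseteq> U" "W \<subseteq> V" using p W by auto
    then show ?thesis using p by (simp add: FM_Pi1_ind ftr_comp_def)
  qed
qed (auto simp: groupoid_Pi1 is_functor_Pi1_ind ftr_comp_def)

text \<open>Together with the next lemma this makes the groupoid of a simply connected set have
  exactly one arrow between any two points. All coherence conditions inside a basic open set are
  later settled by this uniqueness.\<close>

lemma Pi1_simply_connected_unique:
  "simply_connected W \<Longrightarrow> f \<in> Hom (Pi1 W) x y \<Longrightarrow> g \<in> Hom (Pi1 W) x y \<Longrightarrow> f = g"
  by (elim Hom_Pi1E) (simp add: pclass_eq_iff simply_connected_homotopic_paths)

lemma Pi1_simply_connected_ex:
  "simply_connected W \<Longrightarrow> x \<in> W \<Longrightarrow> y \<in> W \<Longrightarrow> Hom (Pi1 W) x y \<noteq> {}"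
  using simply_connected_path_in[of W x y] by blast

section \<open>Groupoid calculus\<close>

locale grpd =
  fixes D :: "('o, 'm) cat"
  assumes grpd: "groupoid D"
begin

abbreviation comp (infixr "\<odot>" 70) where "g \<odot> f \<equiv> Comp D g f"

lemmas grpd_conj = grpd[unfolded groupoid_def]

lemma Hom_Ob: "f \<in> Hom D a b \<Longrightarrow> a \<in> Ob D" "f \<in> Hom D a b \<Longrightarrow> b \<in> Ob D"
  using grpd_conj[THEN conjunct1] by auto

lemma Idm_Hom [intro]: "a \<in> Ob D \<Longrightarrow> Idm D a \<in> Hom D a a"
  using grpd_conj[THEN conjunct2, THEN conjunct1] by auto

lemma comp_Hom [intro]: "g \<in> Hom D b c \<Longrightarrow> f \<in> Hom D a b \<Longrightarrow> g \<odot> f \<in> Hom D a c"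
  using grpd_conj[THEN conjunct2, THEN conjunct2, THEN conjunct1] by blast

lemma assoc: "h \<in> Hom D c d \<Longrightarrow> g \<in> Hom D b c \<Longrightarrow> f \<in> Hom D a b \<Longrightarrow> (h \<odot> g) \<odot> f = h \<odot> g \<odot> f"
  using grpd_conj[THEN conjunct2, THEN conjunct2, THEN conjunct2, THEN conjunct1] by metis

lemma comp_Idm: "f \<in> Hom D a b \<Longrightarrow> f \<odot> Idm D a = f"
  and Idm_comp: "f \<in> Hom D a b \<Longrightarrow> Idm D b \<odot> f = f"
  using grpd_conj[THEN conjunct2, THEN conjunct2, THEN conjunct2, THEN conjunct2, THEN conjunct1] by metis+

lemma ex_inverse: "f \<in> Hom D a b \<Longrightarrow> \<exists>g. g \<in> Hom D b a \<and> g \<odot> f = Idm D a \<and> f \<odot> g = Idm D b"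
  using grpd_conj[THEN conjunct2, THEN conjunct2, THEN conjunct2, THEN conjunct2, THEN conjunct2] by blast

text \<open>Hom-sets may overlap, so an inverse depends on the chosen endpoints.\<close>

definition ginv :: "'o \<Rightarrow> 'o \<Rightarrow> 'm \<Rightarrow> 'm" where
  "ginv a b f = (SOME g. g \<in> Hom D b a \<and> g \<odot> f = Idm D a \<and> f \<odot> g = Idm D b)"

lemma
  assumes "f \<in> Hom D a b"
  shows ginv_Hom [intro]: "ginv a b f \<in> Hom D b a"
    and ginv_comp: "ginv a b f \<odot> f = Idm D a"
    and comp_ginv: "f \<odot> ginv a b f = Idm D b"
proof -
  from someI_ex[OF ex_inverse[OF assms]]
  show "ginv a b f \<in> Hom D b a" "ginv a b f \<odot> f = Idm D a" "f \<odot> ginv a b f = Idm D b"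
    by (auto simp: ginv_def)
qed

lemma left_cancel:
  assumes "h \<in> Hom D b c" "f \<in> Hom D a b" "g \<in> Hom D a b" "h \<odot> f = h \<odot> g"
  shows "f = g"
  using assoc[OF ginv_Hom[OF assms(1)] assms(1,2)] assoc[OF ginv_Hom[OF assms(1)] assms(1,3)] assms(4)
    ginv_comp[OF assms(1)] Idm_comp[OF assms(2)] Idm_comp[OF assms(3)] by simp

lemma right_cancel:
  assumes "h \<in> Hom D a b" "f \<in> Hom D b c" "g \<in> Hom D b c" "f \<odot> h = g \<odot> h"
  shows "f = g"
proof -
  have "f = (f \<odot> h) \<odot> ginv a b h"
    unfolding assoc[OF assms(2,1) ginv_Hom[OF assms(1)]] comp_ginv[OF assms(1)] comp_Idm[OF assms(2)] ..
  also have "\<dots> = g"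
    unfolding assms(4) assoc[OF assms(3,1) ginv_Hom[OF assms(1)]] comp_ginv[OF assms(1)] comp_Idm[OF assms(3)] ..
  finally show ?thesis .
qed

lemma comp_ginv_eq:
  assumes "h \<in> Hom D a b" "k \<in> Hom D a c"
  shows "(k \<odot> ginv a b h) \<odot> h = k"
  using assoc[OF assms(2) ginv_Hom[OF assms(1)] assms(1)] ginv_comp[OF assms(1)] comp_Idm[OF assms(2)] by simp

text \<open>The arrow between the ends of a span is unchanged when both legs are precomposed with
  \<open>g\<close>. In \<open>functor_glue\<close> this makes transition arrows insensitive to
  shrinking the basic set.\<close>

lemma comp_ginv_cancel:
  assumes "h \<in> Hom D a b" "k \<in> Hom D a c" "g \<in> Hom D z a"
  shows "(k \<odot> g) \<odot> ginv z b (h \<odot> g) = k \<odot> ginv a b h"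
proof (rule right_cancel[OF comp_Hom[OF assms(1,3)]])
  show "(k \<odot> g) \<odot> ginv z b (h \<odot> g) \<in> Hom D b c" "k \<odot> ginv a b h \<in> Hom D b c"
    using assms by blast+
  have "(k \<odot> ginv a b h) \<odot> h \<odot> g = ((k \<odot> ginv a b h) \<odot> h) \<odot> g"
    using assms by (intro assoc[symmetric]) blast+
  then show "((k \<odot> g) \<odot> ginv z b (h \<odot> g)) \<odot> h \<odot> g = (k \<odot> ginv a b h) \<odot> h \<odot> g"
    using comp_ginv_eq[OF assms(1,2)] comp_ginv_eq[OF comp_Hom[OF assms(1,3)] comp_Hom[OF assms(2,3)]] by simp
qed

text \<open>\<open>l0\<close>, \<open>l1\<close>, \<open>l2\<close> are parallel sides of two
  adjacent squares with common side \<open>l1\<close>; the \<open>b\<close> and the \<open>t\<close>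
  are the connecting edges.\<close>

lemma paste_squares:
  assumes "l1 \<odot> b1 = t1 \<odot> l0" "l2 \<odot> b2 = t2 \<odot> l1"
    and "l0 \<in> Hom D x0 y0" "l1 \<in> Hom D x1 y1" "l2 \<in> Hom D x2 y2"
    and "b1 \<in> Hom D x0 x1" "b2 \<in> Hom D x1 x2" "t1 \<in> Hom D y0 y1" "t2 \<in> Hom D y1 y2"
  shows "l2 \<odot> (b2 \<odot> b1) = (t2 \<odot> t1) \<odot> l0"
proof -
  have "l2 \<odot> (b2 \<odot> b1) = (l2 \<odot> b2) \<odot> b1" by (rule assoc[OF assms(5,7,6), symmetric])
  also have "\<dots> = t2 \<odot> (l1 \<odot> b1)" unfolding assms(2) by (rule assoc[OF assms(9,4,6)])
  also have "\<dots> = (t2 \<odot> t1) \<odot> l0" unfolding assms(1) by (rule assoc[OF assms(9,8,3), symmetric])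
  finally show ?thesis .
qed

end

lemma is_functor_comp: "is_functor A B F \<Longrightarrow> is_functor B C G \<Longrightarrow> is_functor A C (ftr_comp G F)"
  unfolding is_functor_def ftr_comp_def by simp

section \<open>Gluing functors on fundamental groupoids\<close>

lemma continuous_on_open_nbhd_real:
  fixes p :: "real \<Rightarrow> 'a::topological_space"
  assumes "continuous_on {a..b} p" "t \<in> {a..b}" "open V" "p t \<in> V"
  shows "\<exists>d>0. \<forall>s\<in>{a..b}. \<bar>s - t\<bar> < d \<longrightarrow> p s \<in> V"
proof -
  have "(p \<longlongrightarrow> p t) (at t within {a..b})"
    using assms by (auto simp: continuous_on_def)
  then have "eventually (\<lambda>s. p s \<in> V) (at t within {a..b})"
    using assms topological_tendstoD by blast
  then show ?thesis
    using assms by (auto simp: eventually_at dist_real_def)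
qed

lemma path_comp_linepath:
  fixes p :: "real \<Rightarrow> 'a::topological_space"
  assumes "continuous_on {a..b} p" "a \<le> b"
  shows "path (p \<circ> linepath a b)" "path_image (p \<circ> linepath a b) = p ` {a..b}"
  using assms by (auto simp: path_image_compose closed_segment_eq_real_ivl intro!: path_compose_on)

lemma comp_linepath_ends [simp]:
  "(p \<circ> linepath a b) 0 = p a" "(p \<circ> linepath a b) 1 = p b"
  "pathstart (p \<circ> linepath a b) = p a" "pathfinish (p \<circ> linepath a b) = p b"
  by (simp_all add: linepath_def pathstart_def pathfinish_def)

lemma homotopic_paths_join_linepath:
  fixes p :: "real \<Rightarrow> 'a::topological_space"
  assumes "continuous_on {a..c} p" "a \<le> b" "b \<le> c" "p ` {a..c} \<subseteq> U"
  shows "homotopic_paths U ((p \<circ> linepath a b) +++ (p \<circ> linepath b c)) (p \<circ> linepath a c)"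
proof -
  have "homotopic_paths U (p \<circ> (linepath a b +++ linepath b c)) (p \<circ> linepath a c)"
    using assms
    by (intro homotopic_paths_convex_image[of "{a..c}"])
      (auto simp: path_image_join closed_segment_eq_real_ivl)
  then show ?thesis by (simp add: path_compose_join)
qed

locale pi1_descent = grpd D for D :: "('o, 'm) cat" +
  fixes \<U> :: "'a::topological_space set set"
    and f :: "'a set \<Rightarrow> ('a, (real \<Rightarrow> 'a) set, 'o, 'm) ftr"
    and \<phi> :: "'a set \<Rightarrow> 'a set \<Rightarrow> 'a \<Rightarrow> 'm"
  assumes open_cover: "V \<in> \<U> \<Longrightarrow> open V"
    and datum: "descent_datum Pi1 Pi1_ind D \<U> f \<phi>"
begin

text \<open>The glued functor needs one object at each point although several covering sets contain
  it. The index is chosen arbitrarily, and \<open>\<phi>\<close> translates between it and any other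
  covering set.\<close>

definition idx :: "'a \<Rightarrow> 'a set" where
  "idx x = (SOME V. V \<in> \<U> \<and> x \<in> V)"

lemma idx: "x \<in> \<Union>\<U> \<Longrightarrow> idx x \<in> \<U> \<and> x \<in> idx x"
  unfolding idx_def by (rule someI_ex) blast

abbreviation glued_Ob :: "'a \<Rightarrow> 'o" where
  "glued_Ob x \<equiv> FO (f (idx x)) x"

definition fpath :: "'a set \<Rightarrow> (real \<Rightarrow> 'a) \<Rightarrow> 'm" where
  "fpath V p = FM (f V) (p 0) (p 1) (pclass V p)"

lemma f_functor: "V \<in> \<U> \<Longrightarrow> is_functor (Pi1 V) D (f V)"
  using datum unfolding descent_datum_def by blast

lemma phi_Hom: "V \<in> \<U> \<Longrightarrow> W \<in> \<U> \<Longrightarrow> x \<in> V \<Longrightarrow> x \<in> W \<Longrightarrow> \<phi> V W x \<in> Hom D (FO (f V) x) (FO (f W) x)"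
  using datum unfolding descent_datum_def nat_trans_def by (auto simp: ftr_comp_def)

lemma phi_cocycle:
  "V \<in> \<U> \<Longrightarrow> W \<in> \<U> \<Longrightarrow> Z \<in> \<U> \<Longrightarrow> x \<in> V \<Longrightarrow> x \<in> W \<Longrightarrow> x \<in> Z \<Longrightarrow> \<phi> W Z x \<odot> \<phi> V W x = \<phi> V Z x"
  using datum unfolding descent_datum_def by (auto simp: ftr_comp_def)

text \<open>The cocycle condition for \<open>V\<close>, \<open>V\<close>, \<open>V\<close> makes
  this arrow idempotent, and an idempotent in a groupoid is an identity.\<close>

lemma phi_refl:
  assumes "V \<in> \<U>" "x \<in> V"
  shows "\<phi> V V x = Idm D (FO (f V) x)"
proof -
  note h = phi_Hom[OF assms(1,1) assms(2,2)]
  show ?thesis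
    using left_cancel[OF h h Idm_Hom] phi_cocycle[of V V V x] comp_Idm[OF h] Hom_Ob[OF h] assms by auto
qed

lemma fpath_Hom:
  "V \<in> \<U> \<Longrightarrow> path p \<Longrightarrow> path_image p \<subseteq> V \<Longrightarrow> fpath V p \<in> Hom D (FO (f V) (p 0)) (FO (f V) (p 1))"
  using f_functor[of V] pclass_in_Hom[OF path_in_0_1[of p V]] unfolding is_functor_def fpath_def by blast

lemma fpath_join:
  assumes "V \<in> \<U>" "path p" "path_image p \<subseteq> V" "path q" "path_image q \<subseteq> V" "p 1 = q 0"
  shows "fpath V (p +++ q) = fpath V q \<odot> fpath V p"
proof -
  have p: "path_in V (p 0) (q 0) p" and q: "path_in V (q 0) (q 1) q"
    using path_in_0_1[of p V] path_in_0_1[of q V] assms by auto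
  have "FM (f V) (p 0) (q 1) (Comp (Pi1 V) (pclass V q) (pclass V p))
      = FM (f V) (q 0) (q 1) (pclass V q) \<odot> FM (f V) (p 0) (q 0) (pclass V p)"
    using f_functor[OF assms(1)] pclass_in_Hom[OF p] pclass_in_Hom[OF q] unfolding is_functor_def by blast
  moreover have "(p +++ q) 0 = p 0" "(p +++ q) 1 = q 1" by (auto simp: joinpaths_def)
  ultimately show ?thesis
    unfolding Comp_Pi1[OF p q] fpath_def using assms by simp
qed

lemma fpath_homotopic:
  assumes "homotopic_paths V p q"
  shows "fpath V p = fpath V q"
proof -
  have "p 0 = q 0" "p 1 = q 1"
    using homotopic_paths_imp_pathstart[OF assms] homotopic_paths_imp_pathfinish[OF assms]
    by (auto simp: pathstart_def pathfinish_def)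
  then show ?thesis
    unfolding fpath_def using pclass_eq_iff[of p V q] homotopic_paths_imp_path[OF assms]
      homotopic_paths_imp_subset[OF assms] assms by simp
qed

lemma fpath_const:
  assumes "V \<in> \<U>" "x \<in> V"
  shows "fpath V (\<lambda>_. x) = Idm D (FO (f V) x)"
  using f_functor[OF assms(1)] assms(2) unfolding is_functor_def fpath_def by (simp add: Idm_Pi1)

lemma phi_natural:
  assumes VW: "V \<in> \<U>" "W \<in> \<U>" and p: "path p" "path_image p \<subseteq> V" "path_image p \<subseteq> W"
  shows "\<phi> V W (p 1) \<odot> fpath V p = fpath W p \<odot> \<phi> V W (p 0)"
proof -
  have "path_in (V \<inter> W) (p 0) (p 1) p" using path_in_0_1 p by blast
  moreover have "nat_trans (Pi1 (V \<inter> W)) D (ftr_comp (f V) (Pi1_ind (V \<inter> W) V))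
      (ftr_comp (f W) (Pi1_ind (V \<inter> W) W)) (\<phi> V W)"
    using datum VW unfolding descent_datum_def by blast
  ultimately have "\<phi> V W (p 1) \<odot> FM (f V) (p 0) (p 1) (FM (Pi1_ind (V \<inter> W) V) (p 0) (p 1) (pclass (V \<inter> W) p))
      = FM (f W) (p 0) (p 1) (FM (Pi1_ind (V \<inter> W) W) (p 0) (p 1) (pclass (V \<inter> W) p)) \<odot> \<phi> V W (p 0)"
    unfolding nat_trans_def ftr_comp_def using pclass_in_Hom by fastforce
  then show ?thesis
    using p by (simp add: FM_Pi1_ind fpath_def)
qed

text \<open>The value of \<open>f V\<close> on \<open>p\<close>, conjugated by \<open>\<phi>\<close>
  so that it runs between the objects selected by \<open>idx\<close>. Only then can values from
  different covering sets be composed.\<close>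

definition loc :: "'a set \<Rightarrow> (real \<Rightarrow> 'a) \<Rightarrow> 'm" where
  "loc V p = \<phi> V (idx (p 1)) (p 1) \<odot> fpath V p \<odot> \<phi> (idx (p 0)) V (p 0)"

lemma
  assumes "V \<in> \<U>" "x \<in> V"
  shows phi_in_Hom: "\<phi> (idx x) V x \<in> Hom D (glued_Ob x) (FO (f V) x)"
    and phi_out_Hom: "\<phi> V (idx x) x \<in> Hom D (FO (f V) x) (glued_Ob x)"
    and phi_in_out: "\<phi> (idx x) V x \<odot> \<phi> V (idx x) x = Idm D (FO (f V) x)"
    and phi_out_in: "\<phi> V (idx x) x \<odot> \<phi> (idx x) V x = Idm D (glued_Ob x)"
  using phi_Hom phi_cocycle[of V "idx x" V x] phi_cocycle[of "idx x" V "idx x" x] phi_refl idx[of x] assms by auto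

lemma loc_Hom:
  "V \<in> \<U> \<Longrightarrow> path p \<Longrightarrow> path_image p \<subseteq> V \<Longrightarrow> loc V p \<in> Hom D (glued_Ob (p 0)) (glued_Ob (p 1))"
  unfolding loc_def using path_image_0_1
  by (intro comp_Hom[OF phi_out_Hom] comp_Hom[OF fpath_Hom] phi_in_Hom) auto

lemma loc_homotopic: "homotopic_paths V p q \<Longrightarrow> loc V p = loc V q"
  using homotopic_paths_imp_pathstart[of V p q] homotopic_paths_imp_pathfinish[of V p q] fpath_homotopic[of V p q]
  by (simp add: loc_def pathstart_def pathfinish_def)

lemma loc_const: "V \<in> \<U> \<Longrightarrow> x \<in> V \<Longrightarrow> loc V (\<lambda>_. x) = Idm D (glued_Ob x)"
  using phi_out_in Idm_comp[OF phi_in_Hom] by (simp add: loc_def fpath_const)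

lemma loc_join:
  assumes V: "V \<in> \<U>" and p: "path p" "path_image p \<subseteq> V" and q: "path q" "path_image q \<subseteq> V" and pq: "p 1 = q 0"
  shows "loc V (p +++ q) = loc V q \<odot> loc V p"
proof -
  have ends: "(p +++ q) 0 = p 0" "(p +++ q) 1 = q 1" by (auto simp: joinpaths_def)
  define k1 where "k1 = \<phi> V (idx (q 1)) (q 1)"
  define k2 where "k2 = \<phi> (idx (q 0)) V (q 0)"
  define k3 where "k3 = \<phi> V (idx (q 0)) (q 0)"
  define k4 where "k4 = \<phi> (idx (p 0)) V (p 0)"
  note V' = path_image_0_1[OF p(2)] path_image_0_1[OF q(2)]
  have k: "k1 \<in> Hom D (FO (f V) (q 1)) (glued_Ob (q 1))" "k2 \<in> Hom D (glued_Ob (q 0)) (FO (f V) (q 0))"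
    "k3 \<in> Hom D (FO (f V) (q 0)) (glued_Ob (q 0))" "k4 \<in> Hom D (glued_Ob (p 0)) (FO (f V) (p 0))"
    "k2 \<odot> k3 = Idm D (FO (f V) (q 0))"
    unfolding k1_def k2_def k3_def k4_def using V V'
    by (auto intro: phi_in_Hom phi_out_Hom simp: phi_in_out)
  have fp: "fpath V p \<in> Hom D (FO (f V) (p 0)) (FO (f V) (q 0))"
    and fq: "fpath V q \<in> Hom D (FO (f V) (q 0)) (FO (f V) (q 1))"
    using fpath_Hom[OF V p] fpath_Hom[OF V q] pq by auto
  note h = comp_Hom[OF fp k(4)] comp_Hom[OF fq k(2)] comp_Hom[OF k(3) comp_Hom[OF fp k(4)]]
  have "loc V q \<odot> loc V p = (k1 \<odot> fpath V q \<odot> k2) \<odot> (k3 \<odot> fpath V p \<odot> k4)"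
    by (simp add: loc_def pq k1_def k2_def k3_def k4_def)
  also have "\<dots> = k1 \<odot> (fpath V q \<odot> k2) \<odot> (k3 \<odot> fpath V p \<odot> k4)"
    using assoc[OF k(1) h(2,3)] .
  also have "\<dots> = k1 \<odot> fpath V q \<odot> k2 \<odot> (k3 \<odot> fpath V p \<odot> k4)"
    using assoc[OF fq k(2) h(3)] by simp
  also have "k2 \<odot> (k3 \<odot> fpath V p \<odot> k4) = fpath V p \<odot> k4"
    using assoc[OF k(2,3) h(1)] k(5) Idm_comp[OF h(1)] by simp
  also have "fpath V q \<odot> fpath V p \<odot> k4 = fpath V (p +++ q) \<odot> k4"
    using assoc[OF fq fp k(4)] fpath_join[OF V p q pq] by simp
  also have "k1 \<odot> fpath V (p +++ q) \<odot> k4 = loc V (p +++ q)"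
    by (simp add: loc_def ends k1_def k4_def)
  finally show ?thesis by simp
qed

text \<open>The full descent datum enters here: naturality moves \<open>\<phi> V W\<close> from the
  end of the path to its start, and the cocycle condition absorbs it into the conjugating arrows at
  both ends.\<close>

lemma loc_indep:
  assumes V: "V \<in> \<U>" and W: "W \<in> \<U>" and p: "path p" "path_image p \<subseteq> V" "path_image p \<subseteq> W"
  shows "loc V p = loc W p"
proof -
  define k1 where "k1 = \<phi> W (idx (p 1)) (p 1)"
  define k2 where "k2 = \<phi> V W (p 1)"
  define k3 where "k3 = \<phi> (idx (p 0)) V (p 0)"
  define k4 where "k4 = \<phi> V W (p 0)"
  note V' = path_image_0_1[OF p(2)] path_image_0_1[OF p(3)]
  note i = idx[OF UnionI[OF V V'(1)]] idx[OF UnionI[OF V V'(2)]]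
  have k: "k1 \<in> Hom D (FO (f W) (p 1)) (glued_Ob (p 1))" "k2 \<in> Hom D (FO (f V) (p 1)) (FO (f W) (p 1))"
    "k3 \<in> Hom D (glued_Ob (p 0)) (FO (f V) (p 0))" "k4 \<in> Hom D (FO (f V) (p 0)) (FO (f W) (p 0))"
    unfolding k1_def k2_def k3_def k4_def using V W V'
    by (auto intro: phi_in_Hom phi_out_Hom phi_Hom)
  note fV = fpath_Hom[OF V p(1,2)] and fW = fpath_Hom[OF W p(1,3)]
  have "loc V p = (k1 \<odot> k2) \<odot> fpath V p \<odot> k3"
    unfolding loc_def k1_def k2_def k3_def using V W V' i by (simp add: phi_cocycle)
  also have "\<dots> = k1 \<odot> k2 \<odot> fpath V p \<odot> k3"
    using assoc[OF k(1,2) comp_Hom[OF fV k(3)]] .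
  also have "k2 \<odot> fpath V p \<odot> k3 = (fpath W p \<odot> k4) \<odot> k3"
    using assoc[OF k(2) fV k(3)] phi_natural[OF V W p] by (simp add: k2_def k4_def)
  also have "\<dots> = fpath W p \<odot> k4 \<odot> k3"
    using assoc[OF fW k(4,3)] .
  also have "k4 \<odot> k3 = \<phi> (idx (p 0)) W (p 0)"
    unfolding k4_def k3_def using V W V' i by (intro phi_cocycle) auto
  finally show ?thesis by (simp add: loc_def k1_def)
qed

end

section \<open>Subdivision of intervals and rectangles\<close>

lemma interval_induct:
  fixes a b :: real
  assumes "a \<le> b"
    and trans: "\<And>x y z. a \<le> x \<Longrightarrow> x \<le> y \<Longrightarrow> y \<le> z \<Longrightarrow> z \<le> b \<Longrightarrow> P x y \<Longrightarrow> P y z \<Longrightarrow> P x z"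
    and loc: "\<And>t. a \<le> t \<Longrightarrow> t \<le> b \<Longrightarrow> \<exists>d>0. \<forall>x y. a \<le> x \<and> x \<le> t \<and> t \<le> y \<and> y \<le> b \<and> y - x < d \<longrightarrow> P x y"
  shows "P a b"
proof -
  \<comment> \<open>\<open>Bolzano\<close> asks for its hypotheses also on intervals that leave
    \<open>{a..b}\<close>; the bounds placed in the predicate make those cases vacuous.\<close>
  have "a \<le> a \<longrightarrow> b \<le> b \<longrightarrow> P a b"
    using \<open>a \<le> b\<close>
  proof (induct rule: Bolzano[where P = "\<lambda>x y. a \<le> x \<longrightarrow> y \<le> b \<longrightarrow> P x y"])
    case (trans x y z)
    then show ?case using assms(2)[of x y z] by linarith
  next
    case (local t)
    then show ?case using loc[of t] by meson
  qed
  then show ?thesis by simp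
qed

text \<open>Takes the place of a Lebesgue number: a property additive under concatenation has to be
  checked only on pieces that \<open>p\<close> maps into a single covering set.\<close>

lemma interval_cover_induct:
  fixes p :: "real \<Rightarrow> 'a::topological_space"
  assumes ab: "a \<le> b" and p: "continuous_on {a..b} p" "p ` {a..b} \<subseteq> \<Union>\<U>" and op: "\<And>V. V \<in> \<U> \<Longrightarrow> open V"
    and trans: "\<And>x y z. a \<le> x \<Longrightarrow> x \<le> y \<Longrightarrow> y \<le> z \<Longrightarrow> z \<le> b \<Longrightarrow> P x y \<Longrightarrow> P y z \<Longrightarrow> P x z"
    and loc: "\<And>V x y. V \<in> \<U> \<Longrightarrow> a \<le> x \<Longrightarrow> x \<le> y \<Longrightarrow> y \<le> b \<Longrightarrow> p ` {x..y} \<subseteq> V \<Longrightarrow> P x y"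
  shows "P a b"
  using ab trans
proof (rule interval_induct)
  fix t assume t: "a \<le> t" "t \<le> b"
  then have "p t \<in> \<Union>\<U>" using p(2) by (meson image_subset_iff atLeastAtMost_iff)
  then obtain V where V: "V \<in> \<U>" "p t \<in> V" by blast
  then obtain d where d: "d > 0" "\<And>s. s \<in> {a..b} \<Longrightarrow> \<bar>s - t\<bar> < d \<Longrightarrow> p s \<in> V"
    using continuous_on_open_nbhd_real[OF p(1), of t V] t op by auto
  show "\<exists>d>0. \<forall>x y. a \<le> x \<and> x \<le> t \<and> t \<le> y \<and> y \<le> b \<and> y - x < d \<longrightarrow> P x y"
  proof (intro exI[of _ d] conjI allI impI d(1))
    fix x y assume xy: "a \<le> x \<and> x \<le> t \<and> t \<le> y \<and> y \<le> b \<and> y - x < d"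
    then have "p ` {x..y} \<subseteq> V" using d(2) by force
    then show "P x y" using loc[OF V(1), of x y] xy by simp
  qed
qed

lemma restrict_subinterval:
  fixes p :: "real \<Rightarrow> 'a::topological_space"
  assumes "continuous_on {a..b} p" "p ` {a..b} \<subseteq> V" "a \<le> x" "y \<le> b"
  shows "continuous_on {x..y} p" "p ` {x..y} \<subseteq> V"
proof -
  have "{x..y} \<subseteq> {a..b}" using assms by auto
  then show "continuous_on {x..y} p" "p ` {x..y} \<subseteq> V"
    using assms by (blast intro: continuous_on_subset)+
qed

lemma ivl_Un: "(a::real) \<le> b \<Longrightarrow> b \<le> c \<Longrightarrow> {a..c} = {a..b} \<union> {b..c}"
  by auto

lemma slice_continuous:
  fixes h :: "real \<times> real \<Rightarrow> 'a::topological_space"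
  assumes "continuous_on ({a..b} \<times> {c..d}) h" "h ` ({a..b} \<times> {c..d}) \<subseteq> V"
  shows "s \<in> {a..b} \<Longrightarrow> c \<le> x \<Longrightarrow> y \<le> d \<Longrightarrow> continuous_on {x..y} (\<lambda>t. h (s, t))"
    and "s \<in> {a..b} \<Longrightarrow> c \<le> x \<Longrightarrow> y \<le> d \<Longrightarrow> (\<lambda>t. h (s, t)) ` {x..y} \<subseteq> V"
    and "t \<in> {c..d} \<Longrightarrow> a \<le> x \<Longrightarrow> y \<le> b \<Longrightarrow> continuous_on {x..y} (\<lambda>s. h (s, t))"
    and "t \<in> {c..d} \<Longrightarrow> a \<le> x \<Longrightarrow> y \<le> b \<Longrightarrow> (\<lambda>s. h (s, t)) ` {x..y} \<subseteq> V"
proof -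
  show "s \<in> {a..b} \<Longrightarrow> c \<le> x \<Longrightarrow> y \<le> d \<Longrightarrow> continuous_on {x..y} (\<lambda>t. h (s, t))"
    by (rule continuous_on_compose2[OF assms(1)]) (auto intro!: continuous_intros)
  show "t \<in> {c..d} \<Longrightarrow> a \<le> x \<Longrightarrow> y \<le> b \<Longrightarrow> continuous_on {x..y} (\<lambda>s. h (s, t))"
    by (rule continuous_on_compose2[OF assms(1)]) (auto intro!: continuous_intros)
  show "s \<in> {a..b} \<Longrightarrow> c \<le> x \<Longrightarrow> y \<le> d \<Longrightarrow> (\<lambda>t. h (s, t)) ` {x..y} \<subseteq> V"
    using assms(2) by (force simp: image_subset_iff)
  show "t \<in> {c..d} \<Longrightarrow> a \<le> x \<Longrightarrow> y \<le> b \<Longrightarrow> (\<lambda>s. h (s, t)) ` {x..y} \<subseteq> V"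
    using assms(2) by (force simp: image_subset_iff)
qed

lemma continuous_on_open_nbhd_box:
  fixes h :: "real \<times> real \<Rightarrow> 'a::topological_space"
  assumes h: "continuous_on K h" "(s, t) \<in> K" and V: "open V" "h (s, t) \<in> V"
  shows "\<exists>d>0. \<forall>(x, y)\<in>K. \<bar>x - s\<bar> < d \<and> \<bar>y - t\<bar> < d \<longrightarrow> h (x, y) \<in> V"
proof -
  have "(h \<longlongrightarrow> h (s, t)) (at (s, t) within K)"
    using h by (auto simp: continuous_on_def)
  then have "eventually (\<lambda>z. h z \<in> V) (at (s, t) within K)"
    using V topological_tendstoD by blast
  then obtain d where d: "d > 0" "\<And>z. z \<in> K \<Longrightarrow> z \<noteq> (s, t) \<Longrightarrow> dist z (s, t) < d \<Longrightarrow> h z \<in> V"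
    by (auto simp: eventually_at)
  have "h (x, y) \<in> V" if "(x, y) \<in> K" "\<bar>x - s\<bar> < d / 2" "\<bar>y - t\<bar> < d / 2" for x y
  proof (cases "(x, y) = (s, t)")
    case False
    have "dist (x, y) (s, t) \<le> \<bar>x - s\<bar> + \<bar>y - t\<bar>"
      by (simp add: dist_Pair_Pair dist_real_def sqrt_sum_squares_le_sum_abs[of "x - s" "y - t", simplified])
    then show ?thesis using d(2)[OF that(1) False] that by linarith
  qed (use V in simp)
  then show ?thesis using d(1) by (intro exI[of _ "d / 2"]) auto
qed

section \<open>Holonomy of a descent datum along paths\<close>

context pi1_descent
begin

text \<open>\<open>transport p a b m\<close>: some subdivision of \<open>[a, b]\<close> into pieces inside members of the covering has composite \<open>m\<close>.\<close>

inductive transport :: "(real \<Rightarrow> 'a) \<Rightarrow> real \<Rightarrow> real \<Rightarrow> 'm \<Rightarrow> bool" for p where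
  local: "\<lbrakk>V \<in> \<U>; a \<le> b; continuous_on {a..b} p; p ` {a..b} \<subseteq> V\<rbrakk> \<Longrightarrow> transport p a b (loc V (p \<circ> linepath a b))"
| concat: "\<lbrakk>transport p a b m; transport p b c n\<rbrakk> \<Longrightarrow> transport p a c (n \<odot> m)"

lemma transport_le: "transport p a b m \<Longrightarrow> a \<le> b"
  by (induct rule: transport.induct) auto

lemma transport_Hom: "transport p a b m \<Longrightarrow> m \<in> Hom D (glued_Ob (p a)) (glued_Ob (p b))"
proof (induct rule: transport.induct)
  case (local V a b)
  then show ?case using loc_Hom[of V "p \<circ> linepath a b"] path_comp_linepath[of a b p]
    by (simp add: linepath_0' linepath_1')
qed auto

lemma transport_continuous: "transport p a b m \<Longrightarrow> continuous_on {a..b} p"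
proof (induct rule: transport.induct)
  case (concat a b m c n)
  then show ?case
    using ivl_Un[of a b c] transport_le[of p a b m] transport_le[of p b c n]
    by (simp add: continuous_on_closed_Un)
qed

lemma transport_image: "transport p a b m \<Longrightarrow> p ` {a..b} \<subseteq> \<Union>\<U>"
proof (induct rule: transport.induct)
  case (concat a b m c n)
  then show ?case
    using ivl_Un[of a b c] transport_le[of p a b m] transport_le[of p b c n] by (simp add: image_Un)
qed auto

lemma loc_concat:
  fixes a b c :: real
  assumes V: "V \<in> \<U>" and p: "continuous_on {a..c} p" "p ` {a..c} \<subseteq> V" and abc: "a \<le> b" "b \<le> c"
  shows "loc V (p \<circ> linepath a c) = loc V (p \<circ> linepath b c) \<odot> loc V (p \<circ> linepath a b)"
proof -
  have "continuous_on {a..b} p" "continuous_on {b..c} p" "p ` {a..b} \<subseteq> V" "p ` {b..c} \<subseteq> V"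
    using abc by (simp_all add: restrict_subinterval[OF p])
  then show ?thesis
    using loc_homotopic[OF homotopic_paths_join_linepath[OF p(1) abc p(2)]] abc
      loc_join[OF V, of "p \<circ> linepath a b" "p \<circ> linepath b c"] by (simp add: path_comp_linepath linepath_0' linepath_1')
qed

text \<open>The base case of uniqueness. Inside one \<open>W\<close> all subdivisions give the same
  value, whichever covering sets they use: each piece by \<open>loc_indep\<close>, each join by
  \<open>loc_concat\<close>.\<close>

lemma transport_imp_loc:
  "transport p a b m \<Longrightarrow> W \<in> \<U> \<Longrightarrow> p ` {a..b} \<subseteq> W \<Longrightarrow> m = loc W (p \<circ> linepath a b)"
proof (induct rule: transport.induct)
  case (local V a b)
  then show ?case using path_comp_linepath[of a b p] by (intro loc_indep) auto
next
  case (concat a b m c n)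
  note le = transport_le[OF concat(1)] transport_le[OF concat(3)]
  have "continuous_on {a..c} p" using transport_continuous transport.concat[OF concat(1,3)] by blast
  then show ?case
    using concat(2,4,5) le loc_concat[of W a c p b] restrict_subinterval[OF _ concat(6)] concat(6)
    by (simp del: o_apply)
qed

text \<open>The point \<open>b\<close> need not be a break point of the given subdivision; the piece
  that contains it is cut in two. This allows two subdivisions to be compared without forming a
  common refinement.\<close>

lemma transport_split:
  assumes "transport p a c m" "a \<le> b" "b \<le> c"
  shows "\<exists>m1 m2. transport p a b m1 \<and> transport p b c m2 \<and> m = m2 \<odot> m1"
  using assms
proof (induct arbitrary: b rule: transport.induct)
  case (local V a c)
  have "continuous_on {a..b} p" "continuous_on {b..c} p" "p ` {a..b} \<subseteq> V" "p ` {b..c} \<subseteq> V"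
    using local(5,6) by (simp_all add: restrict_subinterval[OF local(3,4)])
  then have "transport p a b (loc V (p \<circ> linepath a b))" "transport p b c (loc V (p \<circ> linepath b c))"
    using local by (auto intro: transport.local)
  then show ?case using loc_concat[of V a c p b] local by blast
next
  case (concat a d m c n)
  show ?case
  proof (cases "b \<le> d")
    case True
    then obtain m1 m2 where m: "transport p a b m1" "transport p b d m2" "m = m2 \<odot> m1"
      using concat(2)[of b] concat(5) by blast
    then have "n \<odot> m = (n \<odot> m2) \<odot> m1"
      using assoc[OF transport_Hom[OF concat(3)] transport_Hom[OF m(2)] transport_Hom[OF m(1)]] by simp
    then show ?thesis using m transport.concat[OF m(2) concat(3)] by blast
  next
    case False
    then obtain n1 n2 where n: "transport p d b n1" "transport p b c n2" "n = n2 \<odot> n1"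
      using concat(4)[of b] concat(6) by force
    then have "n \<odot> m = n2 \<odot> (n1 \<odot> m)"
      using assoc[OF transport_Hom[OF n(2)] transport_Hom[OF n(1)] transport_Hom[OF concat(1)]] by simp
    then show ?thesis using n transport.concat[OF concat(1) n(1)] by blast
  qed
qed

lemma transport_ex:
  assumes "a \<le> b" "continuous_on {a..b} p" "p ` {a..b} \<subseteq> \<Union>\<U>"
  shows "\<exists>m. transport p a b m"
  using assms open_cover
proof (rule interval_cover_induct)
  fix V x y assume "V \<in> \<U>" "a \<le> x" "x \<le> y" "y \<le> b" "p ` {x..y} \<subseteq> V"
  then show "\<exists>m. transport p x y m"
    using assms transport.local[of V x y p] continuous_on_subset[of "{a..b}" p "{x..y}"] by auto
next
  fix x y z assume "\<exists>m. transport p x y m" "\<exists>m. transport p y z m"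
  then show "\<exists>m. transport p x z m" by (meson transport.concat)
qed

text \<open>The induction is on the interval, not on the two derivations: splitting cuts both at the
  same point, and on a short interval both equal the value of \<open>loc\<close> in one covering
  set.\<close>

lemma transport_unique:
  assumes m: "transport p a b m" "transport p a b n"
  shows "m = n"
proof -
  have "\<forall>m n. transport p a b m \<longrightarrow> transport p a b n \<longrightarrow> m = n"
    using transport_le[OF m(1)] transport_continuous[OF m(1)] transport_image[OF m(1)] open_cover
  proof (rule interval_cover_induct)
    fix x y z assume "x \<le> y" "y \<le> z" "\<forall>m n. transport p x y m \<longrightarrow> transport p x y n \<longrightarrow> m = n"
      "\<forall>m n. transport p y z m \<longrightarrow> transport p y z n \<longrightarrow> m = n"
    then show "\<forall>m n. transport p x z m \<longrightarrow> transport p x z n \<longrightarrow> m = n"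
      using transport_split[of p x z _ y] by metis
  next
    fix V x y assume "V \<in> \<U>" "p ` {x..y} \<subseteq> V"
    then show "\<forall>m n. transport p x y m \<longrightarrow> transport p x y n \<longrightarrow> m = n"
      using transport_imp_loc by metis
  qed
  then show ?thesis using m by blast
qed

definition holonomy :: "(real \<Rightarrow> 'a) \<Rightarrow> real \<Rightarrow> real \<Rightarrow> 'm" where
  "holonomy p a b = (THE m. transport p a b m)"

lemma holonomy_eq: "transport p a b m \<Longrightarrow> holonomy p a b = m"
  unfolding holonomy_def using transport_unique by blast

lemma transport_holonomy: "a \<le> b \<Longrightarrow> continuous_on {a..b} p \<Longrightarrow> p ` {a..b} \<subseteq> \<Union>\<U> \<Longrightarrow> transport p a b (holonomy p a b)"
  using transport_ex holonomy_eq by metis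

lemma holonomy_concat:
  assumes "continuous_on {a..c} p" "p ` {a..c} \<subseteq> \<Union>\<U>" "a \<le> b" "b \<le> c"
  shows "holonomy p a c = holonomy p b c \<odot> holonomy p a b"
  using transport_split[OF transport_holonomy[of a c p], of b] holonomy_eq assms by (metis order_trans)

text \<open>Needed to read the holonomy of a joined path off its two halves. Since \<open>q\<close>
  is constrained only on the image interval, the case of the identity reparametrisation also shows
  that holonomy depends only on the values of the path between \<open>a\<close> and
  \<open>b\<close>.\<close>

lemma transport_affine:
  assumes "transport p a b m" "\<alpha> > 0" "\<And>t. t \<in> {a..b} \<Longrightarrow> q (\<alpha> * t + \<beta>) = p t"
  shows "transport q (\<alpha> * a + \<beta>) (\<alpha> * b + \<beta>) m"
  using assms(1,3)
proof (induct rule: transport.induct)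
  case (local V a b)
  let ?a = "\<alpha> * a + \<beta>" and ?b = "\<alpha> * b + \<beta>"
  have inv: "(s - \<beta>) / \<alpha> \<in> {a..b}" "q s = p ((s - \<beta>) / \<alpha>)" if "s \<in> {?a..?b}" for s
  proof -
    show *: "(s - \<beta>) / \<alpha> \<in> {a..b}"
      using that \<open>\<alpha> > 0\<close> by (simp add: field_simps)
    show "q s = p ((s - \<beta>) / \<alpha>)"
      using local(5)[OF *] \<open>\<alpha> > 0\<close> by simp
  qed
  have "continuous_on {?a..?b} (\<lambda>s. p ((s - \<beta>) / \<alpha>))"
    using inv \<open>\<alpha> > 0\<close> by (intro continuous_on_compose2[OF local(3)] continuous_intros) auto
  then have q: "continuous_on {?a..?b} q"
    by (rule continuous_on_eq) (simp add: inv)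
  have qV: "q ` {?a..?b} \<subseteq> V" using inv local(4) by auto
  have le: "?a \<le> ?b" using local(2) \<open>\<alpha> > 0\<close> by simp
  have "homotopic_paths V (p \<circ> linepath a b) (q \<circ> linepath ?a ?b)"
  proof (rule homotopic_paths_eq)
    fix t :: real assume t: "t \<in> {0..1}"
    have "linepath a b t \<in> {a..b}"
      using t local(2) by (metis closed_segment_eq_real_ivl linepath_in_path)
    moreover have "linepath ?a ?b t = \<alpha> * linepath a b t + \<beta>"
      by (simp add: linepath_def algebra_simps)
    ultimately show "(p \<circ> linepath a b) t = (q \<circ> linepath ?a ?b) t"
      using local(5) by simp
  qed (use local path_comp_linepath[of a b p] in auto)
  then show ?case
    using transport.local[OF local(1) le q qV] loc_homotopic by metis
next
  case (concat a b m c n)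
  then show ?case
    using transport_le[OF concat(1)] transport_le[OF concat(3)] by (intro transport.concat[where b = "\<alpha> * b + \<beta>"]) auto
qed

lemma holonomy_affine:
  assumes "a \<le> b" "continuous_on {a..b} p" "p ` {a..b} \<subseteq> \<Union>\<U>" "\<alpha> > 0"
    and "\<And>t. t \<in> {a..b} \<Longrightarrow> q (\<alpha> * t + \<beta>) = p t"
  shows "holonomy q (\<alpha> * a + \<beta>) (\<alpha> * b + \<beta>) = holonomy p a b"
  using holonomy_eq[OF transport_affine[OF transport_holonomy[OF assms(1-3)] assms(4,5)]] .

lemma holonomy_cong:
  assumes "a \<le> b" "continuous_on {a..b} p" "p ` {a..b} \<subseteq> \<Union>\<U>" "\<And>t. t \<in> {a..b} \<Longrightarrow> q t = p t"
  shows "holonomy q a b = holonomy p a b"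
  using holonomy_affine[OF assms(1-3), of 1 q 0] assms(4) by simp

lemma holonomy_local:
  "V \<in> \<U> \<Longrightarrow> a \<le> b \<Longrightarrow> continuous_on {a..b} p \<Longrightarrow> p ` {a..b} \<subseteq> V \<Longrightarrow> holonomy p a b = loc V (p \<circ> linepath a b)"
  by (intro holonomy_eq transport.local)

lemma holonomy_Hom:
  "a \<le> b \<Longrightarrow> continuous_on {a..b} p \<Longrightarrow> p ` {a..b} \<subseteq> \<Union>\<U> \<Longrightarrow> holonomy p a b \<in> Hom D (glued_Ob (p a)) (glued_Ob (p b))"
  using transport_Hom transport_holonomy by blast

lemma holonomy_const:
  assumes "a \<le> b" "x \<in> \<Union>\<U>"
  shows "holonomy (\<lambda>_. x) a b = Idm D (glued_Ob x)"
  using holonomy_local[of "idx x" a b "\<lambda>_. x"] idx[OF assms(2)] assms(1) loc_const[of "idx x" x]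
  by (auto simp: comp_def)

lemma holonomy_join:
  assumes p: "path p" "path_image p \<subseteq> \<Union>\<U>" and q: "path q" "path_image q \<subseteq> \<Union>\<U>" and pq: "p 1 = q 0"
  shows "holonomy (p +++ q) 0 1 = holonomy q 0 1 \<odot> holonomy p 0 1"
proof -
  have "path (p +++ q)" "path_image (p +++ q) \<subseteq> \<Union>\<U>"
    using assms by (auto simp: pathstart_def pathfinish_def path_image_join)
  then have "holonomy (p +++ q) 0 1 = holonomy (p +++ q) (1/2) 1 \<odot> holonomy (p +++ q) 0 (1/2)"
    by (intro holonomy_concat) (auto simp: path_def path_image_def)
  also have "holonomy (p +++ q) 0 (1/2) = holonomy p 0 1"
    using holonomy_affine[of 0 1 p "1/2" "p +++ q" 0] p by (auto simp: path_def path_image_def joinpaths_def)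
  also have "holonomy (p +++ q) (1/2) 1 = holonomy q 0 1"
  proof -
    \<comment> \<open>At \<open>t = 0\<close> the argument is \<open>1/2\<close>, where
      \<open>joinpaths\<close> still takes its first branch; there \<open>pq\<close> identifies the
      two values.\<close>
    have "(p +++ q) (1/2 * t + 1/2) = q t" if "t \<in> {0..1}" for t
      using that pq by (cases "t = 0") (auto simp: joinpaths_def)
    then show ?thesis
      using holonomy_affine[of 0 1 q "1/2" "p +++ q" "1/2"] q by (simp add: path_def path_image_def)
  qed
  finally show ?thesis .
qed

section \<open>Homotopy invariance of holonomy\<close>

definition square :: "(real \<times> real \<Rightarrow> 'a) \<Rightarrow> real \<Rightarrow> real \<Rightarrow> real \<Rightarrow> real \<Rightarrow> bool" where
  "square h a b c d \<longleftrightarrow>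
     holonomy (\<lambda>t. h (b, t)) c d \<odot> holonomy (\<lambda>s. h (s, c)) a b = holonomy (\<lambda>s. h (s, d)) a b \<odot> holonomy (\<lambda>t. h (a, t)) c d"

lemma holonomy_slice_Hom:
  assumes "continuous_on ({a..b} \<times> {c..d}) h" "h ` ({a..b} \<times> {c..d}) \<subseteq> \<Union>\<U>"
  shows "s \<in> {a..b} \<Longrightarrow> c \<le> x \<Longrightarrow> x \<le> y \<Longrightarrow> y \<le> d \<Longrightarrow>
      holonomy (\<lambda>t. h (s, t)) x y \<in> Hom D (glued_Ob (h (s, x))) (glued_Ob (h (s, y)))"
    and "t \<in> {c..d} \<Longrightarrow> a \<le> x \<Longrightarrow> x \<le> y \<Longrightarrow> y \<le> b \<Longrightarrow>
      holonomy (\<lambda>s. h (s, t)) x y \<in> Hom D (glued_Ob (h (x, t))) (glued_Ob (h (y, t)))"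
  using holonomy_Hom[OF _ slice_continuous(1,2)[OF assms]] holonomy_Hom[OF _ slice_continuous(3,4)[OF assms]] by auto

text \<open>The box is convex, so its two boundary routes from \<open>(a, c)\<close> to
  \<open>(b, d)\<close> are homotopic in it. Their images stay in \<open>V\<close>, where
  \<open>loc\<close> is invariant under homotopy and multiplicative.\<close>

lemma square_local:
  assumes V: "V \<in> \<U>" and h: "continuous_on ({a..b} \<times> {c..d}) h" "h ` ({a..b} \<times> {c..d}) \<subseteq> V"
    and le: "a \<le> b" "c \<le> d"
  shows "square h a b c d"
proof -
  note sl = slice_continuous[OF h]
  let ?B = "h \<circ> linepath (a, c) (b, c)" and ?R = "h \<circ> linepath (b, c) (b, d)"
    and ?L = "h \<circ> linepath (a, c) (a, d)" and ?U = "h \<circ> linepath (a, d) (b, d)"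
  have conv: "convex ({a..b} \<times> {c..d})" by (intro convex_Times) auto
  have seg: "path_image (linepath u v) \<subseteq> {a..b} \<times> {c..d}" if "u \<in> {a..b} \<times> {c..d}" "v \<in> {a..b} \<times> {c..d}" for u v
    unfolding path_image_linepath using that conv convex_contains_segment by blast
  have p: "path (h \<circ> linepath u v)" "path_image (h \<circ> linepath u v) \<subseteq> V"
    if "u \<in> {a..b} \<times> {c..d}" "v \<in> {a..b} \<times> {c..d}" for u v
    using path_compose_on[OF h(1) path_linepath seg[OF that]] h(2) seg[OF that]
    by (auto simp: path_image_compose simp del: path_image_linepath)
  have sides: "(\<lambda>t. h (x, t)) \<circ> linepath c d = h \<circ> linepath (x, c) (x, d)"
    "(\<lambda>s. h (s, y)) \<circ> linepath a b = h \<circ> linepath (a, y) (b, y)" for x y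
    by (auto simp: linepath_def algebra_simps fun_eq_iff)
  have corner: "(a, c) \<in> {a..b} \<times> {c..d}" "(b, c) \<in> {a..b} \<times> {c..d}" "(a, d) \<in> {a..b} \<times> {c..d}" "(b, d) \<in> {a..b} \<times> {c..d}"
    using le by auto
  have "homotopic_paths V (h \<circ> (linepath (a, c) (b, c) +++ linepath (b, c) (b, d)))
      (h \<circ> (linepath (a, c) (a, d) +++ linepath (a, d) (b, d)))"
    using corner by (intro homotopic_paths_convex_image[OF conv h] subset_path_image_join seg) auto
  then have "loc V (?B +++ ?R) = loc V (?L +++ ?U)"
    unfolding path_compose_join by (rule loc_homotopic)
  then have "loc V ?R \<odot> loc V ?B = loc V ?U \<odot> loc V ?L"
    using loc_join[OF V p[OF corner(1,2)] p[OF corner(2,4)]] loc_join[OF V p[OF corner(1,3)] p[OF corner(3,4)]]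
    by (simp add: linepath_0' linepath_1')
  moreover have "holonomy (\<lambda>t. h (b, t)) c d = loc V ?R" "holonomy (\<lambda>t. h (a, t)) c d = loc V ?L"
    "holonomy (\<lambda>s. h (s, c)) a b = loc V ?B" "holonomy (\<lambda>s. h (s, d)) a b = loc V ?U"
    unfolding sides[symmetric] using le V by (intro holonomy_local sl; simp)+
  ultimately show ?thesis by (simp add: square_def)
qed

text \<open>Two boxes sharing the side over \<open>y\<close>. Stating \<open>square\<close> as a
  commuting square rather than a trivial boundary loop lets neighbours be pasted without
  inverses.\<close>

lemma square_paste_1:
  assumes h: "continuous_on ({a..b} \<times> {c..d}) h" "h ` ({a..b} \<times> {c..d}) \<subseteq> \<Union>\<U>"
    and le: "a \<le> x" "x \<le> y" "y \<le> z" "z \<le> b" "c \<le> u" "u \<le> v" "v \<le> d"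
    and sq: "square h x y u v" "square h y z u v"
  shows "square h x z u v"
proof -
  note sl = slice_continuous[OF h]
  have "holonomy (\<lambda>t. h (z, t)) u v \<odot> (holonomy (\<lambda>s. h (s, u)) y z \<odot> holonomy (\<lambda>s. h (s, u)) x y)
      = (holonomy (\<lambda>s. h (s, v)) y z \<odot> holonomy (\<lambda>s. h (s, v)) x y) \<odot> holonomy (\<lambda>t. h (x, t)) u v"
    by (rule paste_squares[OF sq[unfolded square_def]]; (rule holonomy_slice_Hom(1)[OF h] | rule holonomy_slice_Hom(2)[OF h]);
        use le in auto)
  moreover have "holonomy (\<lambda>s. h (s, w)) x z = holonomy (\<lambda>s. h (s, w)) y z \<odot> holonomy (\<lambda>s. h (s, w)) x y" if "w \<in> {c..d}" for w
    using le that by (intro holonomy_concat sl) auto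
  ultimately show ?thesis using le by (simp add: square_def)
qed

lemma square_paste_2:
  assumes h: "continuous_on ({a..b} \<times> {c..d}) h" "h ` ({a..b} \<times> {c..d}) \<subseteq> \<Union>\<U>"
    and le: "c \<le> x" "x \<le> y" "y \<le> z" "z \<le> d" "a \<le> b"
    and sq: "square h a b x y" "square h a b y z"
  shows "square h a b x z"
proof -
  note sl = slice_continuous[OF h]
  have "holonomy (\<lambda>s. h (s, z)) a b \<odot> (holonomy (\<lambda>t. h (a, t)) y z \<odot> holonomy (\<lambda>t. h (a, t)) x y)
      = (holonomy (\<lambda>t. h (b, t)) y z \<odot> holonomy (\<lambda>t. h (b, t)) x y) \<odot> holonomy (\<lambda>s. h (s, x)) a b"
    by (rule paste_squares[OF sq[unfolded square_def, symmetric]]; (rule holonomy_slice_Hom(1)[OF h] | rule holonomy_slice_Hom(2)[OF h]);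
        use le in auto)
  moreover have "holonomy (\<lambda>t. h (w, t)) x z = holonomy (\<lambda>t. h (w, t)) y z \<odot> holonomy (\<lambda>t. h (w, t)) x y" if "w \<in> {a..b}" for w
    using le that by (intro holonomy_concat sl) auto
  ultimately show ?thesis using le by (simp add: square_def)
qed

text \<open>Two nested interval inductions do the work of a fine grid: the inner one, in the first
  coordinate, gives commuting squares over every sufficiently thin strip around a fixed height
  \<open>t\<close>; the outer one stacks the strips.\<close>

lemma square_all:
  assumes h: "continuous_on ({a..b} \<times> {c..d}) h" "h ` ({a..b} \<times> {c..d}) \<subseteq> \<Union>\<U>"
    and le: "a \<le> b" "c \<le> d"
  shows "square h a b c d"
  using le(2)
proof (rule interval_induct)
  show "square h a b x z" if "c \<le> x" "x \<le> y" "y \<le> z" "z \<le> d" "square h a b x y" "square h a b y z" for x y z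
    using square_paste_2[OF h] that le by blast
  fix t assume t: "c \<le> t" "t \<le> d"
  \<comment> \<open>The strip width \<open>e\<close> is quantified inside \<open>P\<close>, so
    pasting two boxes side by side can take the smaller of two widths.\<close>
  define P where "P x y \<longleftrightarrow> (\<exists>e>0. \<forall>u v. c \<le> u \<and> u \<le> t \<and> t \<le> v \<and> v \<le> d \<and> v - u < e \<longrightarrow> square h x y u v)" for x y
  have "P a b"
    using le(1)
  proof (rule interval_induct)
    fix x y z assume xyz: "a \<le> x" "x \<le> y" "y \<le> z" "z \<le> b" "P x y" "P y z"
    then obtain e1 e2 where e: "e1 > 0" "e2 > 0"
      "\<And>u v. c \<le> u \<and> u \<le> t \<and> t \<le> v \<and> v \<le> d \<and> v - u < e1 \<Longrightarrow> square h x y u v"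
      "\<And>u v. c \<le> u \<and> u \<le> t \<and> t \<le> v \<and> v \<le> d \<and> v - u < e2 \<Longrightarrow> square h y z u v"
      unfolding P_def by metis
    show "P x z" unfolding P_def
    proof (intro exI[of _ "min e1 e2"] conjI allI impI)
      fix u v assume uv: "c \<le> u \<and> u \<le> t \<and> t \<le> v \<and> v \<le> d \<and> v - u < min e1 e2"
      show "square h x z u v"
        using uv xyz e(3)[of u v] e(4)[of u v] by (intro square_paste_1[OF h, of x y z u v]) auto
    qed (use e in simp)
  next
    fix s assume s: "a \<le> s" "s \<le> b"
    then have st: "(s, t) \<in> {a..b} \<times> {c..d}" using t by simp
    then have "h (s, t) \<in> \<Union>\<U>" using h(2) by blast
    then obtain V where V: "V \<in> \<U>" "h (s, t) \<in> V" by blast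
    obtain e where e: "e > 0"
      "\<And>x y. (x, y) \<in> {a..b} \<times> {c..d} \<Longrightarrow> \<bar>x - s\<bar> < e \<Longrightarrow> \<bar>y - t\<bar> < e \<Longrightarrow> h (x, y) \<in> V"
      using continuous_on_open_nbhd_box[OF h(1) st open_cover[OF V(1)] V(2)] by fast
    have "square h x y u v" if "a \<le> x \<and> x \<le> s \<and> s \<le> y \<and> y \<le> b \<and> y - x < e"
      "c \<le> u \<and> u \<le> t \<and> t \<le> v \<and> v \<le> d \<and> v - u < e" for x y u v
    proof (rule square_local[OF V(1)])
      have sub: "{x..y} \<times> {u..v} \<subseteq> {a..b} \<times> {c..d}" using that by auto
      then show "continuous_on ({x..y} \<times> {u..v}) h" using h(1) continuous_on_subset by blast
      show "h ` ({x..y} \<times> {u..v}) \<subseteq> V"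
      proof clarify
        fix x' u' assume "x' \<in> {x..y}" "u' \<in> {u..v}"
        then show "h (x', u') \<in> V" using that by (intro e(2)) auto
      qed
    qed (use that in auto)
    then show "\<exists>e>0. \<forall>x y. a \<le> x \<and> x \<le> s \<and> s \<le> y \<and> y \<le> b \<and> y - x < e \<longrightarrow> P x y"
      unfolding P_def using e(1) by blast
  qed
  then show "\<exists>e>0. \<forall>u v. c \<le> u \<and> u \<le> t \<and> t \<le> v \<and> v \<le> d \<and> v - u < e \<longrightarrow> square h a b u v"
    unfolding P_def .
qed

text \<open>The homotopy keeps endpoints fixed, so two opposite sides of its square are constant
  paths with identity holonomy; commutativity then equates the other two sides, which are
  \<open>p\<close> and \<open>q\<close>.\<close>

lemma holonomy_homotopic:
  assumes pq: "homotopic_paths (\<Union>\<U>) p q"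
  shows "holonomy p 0 1 = holonomy q 0 1"
proof -
  let ?K = "{0..1::real} \<times> {0..1::real}"
  obtain h where h: "continuous_on ?K h" "h \<in> ?K \<rightarrow> \<Union>\<U>"
    and hp: "\<And>t. t \<in> {0..1} \<Longrightarrow> h (0, t) = p t" and hq: "\<And>t. t \<in> {0..1} \<Longrightarrow> h (1, t) = q t"
    and ends: "\<And>s. s \<in> {0..1} \<Longrightarrow> h (s, 0) = p 0" "\<And>s. s \<in> {0..1} \<Longrightarrow> h (s, 1) = p 1"
    using pq by (auto simp: homotopic_paths pathstart_def pathfinish_def)
  have hU: "h ` ?K \<subseteq> \<Union>\<U>" using h(2) by blast
  note sl = slice_continuous[OF h(1) hU]
  have p: "continuous_on {0..1} p" "p ` {0..1} \<subseteq> \<Union>\<U>" and q: "continuous_on {0..1} q" "q ` {0..1} \<subseteq> \<Union>\<U>"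
    using homotopic_paths_imp_path[OF pq] homotopic_paths_imp_subset[OF pq] by (auto simp: path_def path_image_def)
  then have p01: "p 0 \<in> \<Union>\<U>" "p 1 \<in> \<Union>\<U>" by (meson image_subset_iff atLeastAtMost_iff zero_le_one order_refl)+
  have "holonomy (\<lambda>t. h (0, t)) 0 1 = holonomy p 0 1" "holonomy (\<lambda>t. h (1, t)) 0 1 = holonomy q 0 1"
    using hp hq p q by (auto intro!: holonomy_cong)
  moreover have "holonomy (\<lambda>s. h (s, 0)) 0 1 = holonomy (\<lambda>_. p 0) 0 1" "holonomy (\<lambda>s. h (s, 1)) 0 1 = holonomy (\<lambda>_. p 1) 0 1"
    using ends p01 by (auto intro!: holonomy_cong)
  ultimately have "holonomy q 0 1 \<odot> Idm D (glued_Ob (p 0)) = Idm D (glued_Ob (p 1)) \<odot> holonomy p 0 1"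
    using square_all[OF h(1) hU] p01 by (simp add: square_def holonomy_const)
  moreover have "q 0 = p 0" "q 1 = p 1" using hq[of 0] hq[of 1] ends[of 1] by auto
  ultimately show ?thesis
    using comp_Idm[OF holonomy_Hom[OF _ q]] Idm_comp[OF holonomy_Hom[OF _ p]] by simp
qed

section \<open>The glued functor and its comparison with the descent datum\<close>

definition glue :: "('a, (real \<Rightarrow> 'a) set, 'o, 'm) ftr" where
  "glue = \<lparr>FO = glued_Ob, FM = (\<lambda>x y c. holonomy (SOME p. p \<in> c) 0 1)\<rparr>"

lemma FO_glue [simp]: "FO glue x = glued_Ob x"
  by (simp add: glue_def)

text \<open>Homotopy invariance makes the choice of representative in \<open>glue\<close>
  harmless.\<close>

lemma FM_glue: "path p \<Longrightarrow> path_image p \<subseteq> \<Union>\<U> \<Longrightarrow> FM glue x y (pclass (\<Union>\<U>) p) = holonomy p 0 1"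
  using holonomy_homotopic[OF homotopic_paths_SOME_pclass] by (simp add: glue_def)

lemma glue_functor: "is_functor (Pi1 (\<Union>\<U>)) D glue"
  unfolding is_functor_def
proof (intro conjI allI impI ballI)
  fix a assume a: "a \<in> Ob (Pi1 (\<Union>\<U>))"
  then show "FO glue a \<in> Ob D"
    using f_functor[of "idx a"] idx[of a] unfolding is_functor_def by simp
  show "FM glue a a (Idm (Pi1 (\<Union>\<U>)) a) = Idm D (FO glue a)"
    using a by (simp add: Idm_Pi1 FM_glue holonomy_const)
next
  fix a b c assume "c \<in> Hom (Pi1 (\<Union>\<U>)) a b"
  then obtain p where p: "path_in (\<Union>\<U>) a b p" "c = pclass (\<Union>\<U>) p" by (rule Hom_Pi1E)
  then show "FM glue a b c \<in> Hom D (FO glue a) (FO glue b)"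
    using holonomy_Hom[of 0 1 p] by (auto simp: FM_glue path_def path_image_def pathstart_def pathfinish_def)
next
  fix a b c g k assume "g \<in> Hom (Pi1 (\<Union>\<U>)) a b \<and> k \<in> Hom (Pi1 (\<Union>\<U>)) b c"
  then obtain p q where p: "path_in (\<Union>\<U>) a b p" "g = pclass (\<Union>\<U>) p"
    and q: "path_in (\<Union>\<U>) b c q" "k = pclass (\<Union>\<U>) q" by (meson Hom_Pi1E)
  have "p 1 = q 0" using p q by (simp add: pathstart_def pathfinish_def)
  then have "holonomy (p +++ q) 0 1 = holonomy q 0 1 \<odot> holonomy p 0 1" using p q by (intro holonomy_join) auto
  then show "FM glue a c (Comp (Pi1 (\<Union>\<U>)) k g) = FM glue b c k \<odot> FM glue a b g"
    using path_in_join[OF p(1) q(1)] p q Comp_Pi1[OF p(1) q(1)] by (simp add: FM_glue)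
qed

text \<open>The comparison at \<open>x\<close> is \<open>\<phi>\<close> from the selected covering
  set to \<open>V\<close>. Its naturality undoes the conjugation in \<open>loc\<close>, and its
  compatibility on intersections is the cocycle condition.\<close>

lemma glue_descent_mor:
  "descent_mor Pi1 Pi1_ind D \<U> (canon_f Pi1_ind (\<Union>\<U>) glue) (canon_phi Pi1_ind D (\<Union>\<U>) glue) f \<phi>
     (\<lambda>V x. \<phi> (idx x) V x)"
  unfolding descent_mor_def
proof (intro conjI ballI)
  fix V assume V: "V \<in> \<U>"
  then have VU: "V \<subseteq> \<Union>\<U>" by blast
  have "is_functor (Pi1 V) D (ftr_comp glue (Pi1_ind V (\<Union>\<U>)))"
    using glue_functor is_functor_Pi1_ind[OF VU] by (rule is_functor_comp[rotated])
  then show "nat_trans (Pi1 V) D (canon_f Pi1_ind (\<Union>\<U>) glue V) (f V) (\<lambda>x. \<phi> (idx x) V x)"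
    unfolding nat_trans_def canon_f_def
  proof (intro conjI ballI allI impI)
    show "is_functor (Pi1 V) D (f V)" using V f_functor by blast
    fix x assume "x \<in> Ob (Pi1 V)"
    then show "\<phi> (idx x) V x \<in> Hom D (FO (ftr_comp glue (Pi1_ind V (\<Union> \<U>))) x) (FO (f V) x)"
      using V phi_in_Hom by (simp add: ftr_comp_def)
  next
    fix a b c assume "c \<in> Hom (Pi1 V) a b"
    then obtain p where p: "path_in V a b p" "c = pclass V p" by (rule Hom_Pi1E)
    have ab: "p 0 = a" "p 1 = b" "a \<in> V" "b \<in> V"
      using p path_in_endpoints[OF p(1)] by (auto simp: pathstart_def pathfinish_def)
    have fp: "fpath V p \<in> Hom D (FO (f V) a) (FO (f V) b)" using fpath_Hom[OF V, of p] p ab by simp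
    have "FM (ftr_comp glue (Pi1_ind V (\<Union> \<U>))) a b c = holonomy p 0 1"
      using p VU FM_Pi1_ind[of p V "\<Union>\<U>"] FM_glue[of p] by (auto simp: ftr_comp_def)
    also have "\<dots> = loc V p"
      using holonomy_local[OF V, of 0 1 p] p by (simp add: path_def path_image_def)
    finally have "\<phi> (idx b) V b \<odot> FM (ftr_comp glue (Pi1_ind V (\<Union> \<U>))) a b c
        = \<phi> (idx b) V b \<odot> \<phi> V (idx b) b \<odot> fpath V p \<odot> \<phi> (idx a) V a"
      by (simp add: loc_def ab)
    also have "\<dots> = fpath V p \<odot> \<phi> (idx a) V a"
      using assoc[OF phi_in_Hom[OF V ab(4)] phi_out_Hom[OF V ab(4)] comp_Hom[OF fp phi_in_Hom[OF V ab(3)]]]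
        phi_in_out[OF V ab(4)] Idm_comp[OF comp_Hom[OF fp phi_in_Hom[OF V ab(3)]]] by simp
    finally show "\<phi> (idx b) V b \<odot> FM (ftr_comp glue (Pi1_ind V (\<Union> \<U>))) a b c = FM (f V) a b c \<odot> \<phi> (idx a) V a"
      by (simp add: fpath_def ab p)
  qed
next
  fix V W a assume V: "V \<in> \<U>" "W \<in> \<U>" and a: "a \<in> Ob (Pi1 (V \<inter> W))"
  then have i: "idx a \<in> \<U>" "a \<in> idx a" using idx[of a] by auto
  with V a show "\<phi> V W a \<odot> \<phi> (idx (FO (Pi1_ind (V \<inter> W) V) a)) V (FO (Pi1_ind (V \<inter> W) V) a) =
       \<phi> (idx (FO (Pi1_ind (V \<inter> W) W) a)) W (FO (Pi1_ind (V \<inter> W) W) a) \<odot> canon_phi Pi1_ind D (\<Union> \<U>) glue V W a"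
    using phi_cocycle[OF i(1) V] comp_Idm[OF phi_in_Hom[of W a]] by (simp add: canon_phi_def ftr_comp_def)
qed

end

section \<open>Full faithfulness of restriction to a covering\<close>

context grpd
begin

text \<open>The transition arrows of both canonical data are identities, so the
  \<open>\<theta> V\<close> agree at common points and define \<open>\<eta>\<close> pointwise. A
  path in the union need not stay in one covering set; naturality along it is obtained by pasting
  the naturality squares of short pieces.\<close>

lemma Pi1_descent_mor_lift:
  assumes op: "\<And>V. V \<in> \<U> \<Longrightarrow> open V"
    and F: "is_functor (Pi1 (\<Union>\<U>)) D F" and G: "is_functor (Pi1 (\<Union>\<U>)) D G"
    and \<theta>: "descent_mor Pi1 Pi1_ind D \<U> (canon_f Pi1_ind (\<Union>\<U>) F) (canon_phi Pi1_ind D (\<Union>\<U>) F)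
        (canon_f Pi1_ind (\<Union>\<U>) G) (canon_phi Pi1_ind D (\<Union>\<U>) G) \<theta>"
  shows "\<exists>\<eta>. nat_trans (Pi1 (\<Union>\<U>)) D F G \<eta> \<and> (\<forall>V\<in>\<U>. \<forall>x\<in>V. \<theta> V x = \<eta> x)"
proof -
  let ?U = "\<Union>\<U>"
  have nat: "nat_trans (Pi1 V) D (ftr_comp F (Pi1_ind V ?U)) (ftr_comp G (Pi1_ind V ?U)) (\<theta> V)" if "V \<in> \<U>" for V
    using \<theta> that unfolding descent_mor_def canon_f_def by blast
  then have \<theta>_Hom: "\<theta> V x \<in> Hom D (FO F x) (FO G x)" if "V \<in> \<U>" "x \<in> V" for V x
    using that unfolding nat_trans_def by (simp add: ftr_comp_def)
  have indep: "\<theta> V x = \<theta> W x" if V: "V \<in> \<U>" "W \<in> \<U>" and x: "x \<in> V" "x \<in> W" for V W x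
  proof -
    have "Idm D (FO G x) \<odot> \<theta> V x = \<theta> W x \<odot> Idm D (FO F x)"
      using \<theta>[unfolded descent_mor_def, THEN conjunct2, rule_format, of V W x] that
      by (simp add: canon_phi_def ftr_comp_def)
    then show ?thesis using Idm_comp[OF \<theta>_Hom] comp_Idm[OF \<theta>_Hom] that by metis
  qed
  obtain \<eta> where \<eta>: "\<And>V x. V \<in> \<U> \<Longrightarrow> x \<in> V \<Longrightarrow> \<theta> V x = \<eta> x"
  proof
    fix V x assume "V \<in> \<U>" "x \<in> V"
    then show "\<theta> V x = \<theta> (SOME V. V \<in> \<U> \<and> x \<in> V) x"
      by (metis (mono_tags, lifting) indep someI_ex)
  qed
  have \<eta>_Hom: "\<eta> x \<in> Hom D (FO F x) (FO G x)" if "x \<in> ?U" for x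
    using that \<theta>_Hom \<eta> by force
  have "nat_trans (Pi1 ?U) D F G \<eta>"
    unfolding nat_trans_def
  proof (intro conjI F G ballI allI impI)
    fix x y c assume "c \<in> Hom (Pi1 ?U) x y"
    then obtain p where p: "path_in ?U x y p" "c = pclass ?U p" by (rule Hom_Pi1E)
    have pc: "continuous_on {0..1} p" "p ` {0..1} \<subseteq> ?U" using p by (auto simp: path_def path_image_def)
    let ?c = "\<lambda>a b. pclass ?U (p \<circ> linepath a b)"
    have c_Hom: "?c a b \<in> Hom (Pi1 ?U) (p a) (p b)" "path_in ?U (p a) (p b) (p \<circ> linepath a b)"
      if "0 \<le> a" "a \<le> b" "b \<le> 1" for a b
    proof -
      show "path_in ?U (p a) (p b) (p \<circ> linepath a b)"
        using that restrict_subinterval[OF pc, of a b] path_comp_linepath[of a b p] by simp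
      then show "?c a b \<in> Hom (Pi1 ?U) (p a) (p b)" by blast
    qed
    have FM_Hom: "FM H (p a) (p b) (?c a b) \<in> Hom D (FO H (p a)) (FO H (p b))"
      if "is_functor (Pi1 ?U) D H" "0 \<le> a" "a \<le> b" "b \<le> 1" for H a b
      using that c_Hom(1) unfolding is_functor_def by blast
    have FM_cat: "FM H (p x) (p z) (?c x z) = FM H (p y) (p z) (?c y z) \<odot> FM H (p x) (p y) (?c x y)"
      if H: "is_functor (Pi1 ?U) D H" and le: "0 \<le> x" "x \<le> y" "y \<le> z" "z \<le> 1" for H x y z
    proof -
      have "?c x z = pclass ?U ((p \<circ> linepath x y) +++ (p \<circ> linepath y z))"
        using homotopic_paths_join_linepath[of x z p y ?U] restrict_subinterval[OF pc, of x z] le c_Hom(2)[of x z]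
        by (subst pclass_eq_iff) (auto intro: homotopic_paths_sym)
      also have "\<dots> = Comp (Pi1 ?U) (?c y z) (?c x y)"
        using Comp_Pi1[OF c_Hom(2)[of x y] c_Hom(2)[of y z]] le by simp
      finally have cat: "?c x z = Comp (Pi1 ?U) (?c y z) (?c x y)" .
      have "?c x y \<in> Hom (Pi1 ?U) (p x) (p y)" "?c y z \<in> Hom (Pi1 ?U) (p y) (p z)"
        using c_Hom(1) le by simp_all
      then show ?thesis
        unfolding cat using H unfolding is_functor_def by blast
    qed
    have p_U: "p t \<in> ?U" if "0 \<le> t" "t \<le> 1" for t using pc(2) that by (meson image_subset_iff atLeastAtMost_iff)
    have "\<eta> (p 1) \<odot> FM F (p 0) (p 1) (?c 0 1) = FM G (p 0) (p 1) (?c 0 1) \<odot> \<eta> (p 0)"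
      using zero_le_one pc op
    proof (rule interval_cover_induct)
      fix V a b assume V: "V \<in> \<U>" and ab: "0 \<le> a" "a \<le> b" "b \<le> 1" and pV: "p ` {a..b} \<subseteq> V"
      let ?p = "p \<circ> linepath a b"
      have VU: "V \<subseteq> ?U" using V by blast
      have q: "path_in V (p a) (p b) ?p"
        using ab pV restrict_subinterval[OF pc, of a b] path_comp_linepath[of a b p] by simp
      have "\<theta> V (p b) \<odot> FM (ftr_comp F (Pi1_ind V ?U)) (p a) (p b) (pclass V ?p)
         = FM (ftr_comp G (Pi1_ind V ?U)) (p a) (p b) (pclass V ?p) \<odot> \<theta> V (p a)"
        using nat[OF V] pclass_in_Hom[OF q] unfolding nat_trans_def by blast
      then show "\<eta> (p b) \<odot> FM F (p a) (p b) (?c a b) = FM G (p a) (p b) (?c a b) \<odot> \<eta> (p a)"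
        using q VU path_in_endpoints[OF q] \<eta>[OF V] by (simp add: ftr_comp_def FM_Pi1_ind)
    next
      fix x y z :: real assume le: "0 \<le> x" "x \<le> y" "y \<le> z" "z \<le> 1"
        and e: "\<eta> (p y) \<odot> FM F (p x) (p y) (?c x y) = FM G (p x) (p y) (?c x y) \<odot> \<eta> (p x)"
          "\<eta> (p z) \<odot> FM F (p y) (p z) (?c y z) = FM G (p y) (p z) (?c y z) \<odot> \<eta> (p y)"
      have le': "x \<le> 1" "0 \<le> y" "y \<le> 1" "0 \<le> z" using le by auto
      show "\<eta> (p z) \<odot> FM F (p x) (p z) (?c x z) = FM G (p x) (p z) (?c x z) \<odot> \<eta> (p x)"
        unfolding FM_cat[OF F le] FM_cat[OF G le]
        using le le' by (intro paste_squares[OF e \<eta>_Hom[OF p_U] \<eta>_Hom[OF p_U] \<eta>_Hom[OF p_U]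
            FM_Hom[OF F] FM_Hom[OF F] FM_Hom[OF G] FM_Hom[OF G]])
    qed
    then show "\<eta> y \<odot> FM F x y c = FM G x y c \<odot> \<eta> x"
      using p by (simp add: pathstart_def pathfinish_def)
  qed (use \<eta>_Hom in simp)
  then show ?thesis using \<eta> by blast
qed

lemma Pi1_costack_wrt: "costack_wrt (Pi1 :: 'a::topological_space set \<Rightarrow> _) Pi1_ind D"
  unfolding costack_wrt_def
proof (intro allI impI)
  fix U :: "'a set" and \<U> assume U: "open U \<and> (\<forall>V\<in>\<U>. open V) \<and> \<Union>\<U> = U"
  then have UU: "U = \<Union>\<U>" and op: "\<And>V. V \<in> \<U> \<Longrightarrow> open V" by auto
  show "descent_equiv Pi1 Pi1_ind D U \<U>"
    unfolding descent_equiv_def UU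
  proof (intro conjI allI impI, goal_cases)
    case (1 F G \<theta>)
    then obtain \<eta> where "nat_trans (Pi1 (\<Union>\<U>)) D F G \<eta>" "\<forall>V\<in>\<U>. \<forall>x\<in>V. \<theta> V x = \<eta> x"
      using Pi1_descent_mor_lift[OF op] by blast
    \<comment> \<open>Uniqueness of \<open>\<eta>\<close> is pointwise, since each point of the
      union lies in a covering set.\<close>
    then show ?case by (intro exI[of _ \<eta>]) auto
  next
    case (2 f \<phi>)
    interpret pi1_descent D \<U> f \<phi>
      using 2 op by unfold_locales
    show ?case using glue_functor glue_descent_mor by blast
  qed
qed

end

section \<open>Natural transformations\<close>

lemma
  assumes "is_functor C D F"
  shows functor_Ob: "a \<in> Ob C \<Longrightarrow> FO F a \<in> Ob D"
    and functor_Hom: "g \<in> Hom C a b \<Longrightarrow> FM F a b g \<in> Hom D (FO F a) (FO F b)"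
    and functor_Idm: "a \<in> Ob C \<Longrightarrow> FM F a a (Idm C a) = Idm D (FO F a)"
    and functor_Comp: "g \<in> Hom C a b \<Longrightarrow> k \<in> Hom C b c \<Longrightarrow>
      FM F a c (Comp C k g) = Comp D (FM F b c k) (FM F a b g)"
  using assms unfolding is_functor_def by blast+

lemma
  assumes "nat_trans C D F G \<eta>"
  shows nat_trans_dom: "is_functor C D F"
    and nat_trans_cod: "is_functor C D G"
    and nat_trans_Hom: "a \<in> Ob C \<Longrightarrow> \<eta> a \<in> Hom D (FO F a) (FO G a)"
    and nat_trans_natural: "g \<in> Hom C a b \<Longrightarrow> Comp D (\<eta> b) (FM F a b g) = Comp D (FM G a b g) (\<eta> a)"
  using assms unfolding nat_trans_def by blast+

lemma FO_ftr_comp [simp]: "FO (ftr_comp G F) a = FO G (FO F a)"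
  and FM_ftr_comp [simp]: "FM (ftr_comp G F) a b g = FM G (FO F a) (FO F b) (FM F a b g)"
  by (simp_all add: ftr_comp_def)

lemma groupoid_Hom_Ob: "groupoid C \<Longrightarrow> g \<in> Hom C a b \<Longrightarrow> a \<in> Ob C \<and> b \<in> Ob C"
  using grpd.Hom_Ob grpd.intro by metis

text \<open>Functors are records of total functions, and the laws of an \<open>off_functor\<close>
  hold only on actual objects and arrows. Composites of restrictions therefore agree in this sense
  rather than as records.\<close>

definition ftr_eq :: "('o1, 'm1) cat \<Rightarrow> ('o1, 'm1, 'o2, 'm2) ftr \<Rightarrow> ('o1, 'm1, 'o2, 'm2) ftr \<Rightarrow> bool" where
  "ftr_eq C F G \<longleftrightarrow> (\<forall>a\<in>Ob C. FO F a = FO G a) \<and> (\<forall>a b g. g \<in> Hom C a b \<longrightarrow> FM F a b g = FM G a b g)"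

lemma ftr_eq_sym: "ftr_eq C F G \<Longrightarrow> ftr_eq C G F"
  unfolding ftr_eq_def by simp

lemma ftr_eq_refl: "ftr_eq C F F"
  unfolding ftr_eq_def by simp

lemma is_functor_cong:
  assumes C: "groupoid C" and "is_functor C D F" "ftr_eq C F F'"
  shows "is_functor C D F'"
proof -
  interpret grpd C by (rule grpd.intro[OF C])
  show ?thesis
    unfolding is_functor_def
  proof (intro conjI ballI allI impI)
    fix a assume a: "a \<in> Ob C"
    then show "FO F' a \<in> Ob D" using assms functor_Ob unfolding ftr_eq_def by metis
    show "FM F' a a (Idm C a) = Idm D (FO F' a)"
      using assms functor_Idm a Idm_Hom unfolding ftr_eq_def by metis
  next
    fix a b f assume f: "f \<in> Hom C a b"
    show "FM F' a b f \<in> Hom D (FO F' a) (FO F' b)"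
      using functor_Hom[OF assms(2) f] assms(3) f Hom_Ob[OF f] unfolding ftr_eq_def by metis
  next
    fix a b c f g assume "f \<in> Hom C a b \<and> g \<in> Hom C b c"
    then have f: "f \<in> Hom C a b" and g: "g \<in> Hom C b c" by auto
    show "FM F' a c (Comp C g f) = Comp D (FM F' b c g) (FM F' a b f)"
      using functor_Comp[OF assms(2) f g] assms(3) f g comp_Hom[OF g f] unfolding ftr_eq_def by metis
  qed
qed

lemma nat_trans_cong:
  assumes C: "groupoid C" and \<eta>: "nat_trans C D F G \<eta>" and eq: "ftr_eq C F F'" "ftr_eq C G G'"
    and \<eta>': "\<And>a. a \<in> Ob C \<Longrightarrow> \<eta>' a = \<eta> a"
  shows "nat_trans C D F' G' \<eta>'"
  unfolding nat_trans_def
proof (intro conjI ballI allI impI)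
  show "is_functor C D F'" "is_functor C D G'"
    using is_functor_cong[OF C] \<eta> eq unfolding nat_trans_def by blast+
  show "\<eta>' a \<in> Hom D (FO F' a) (FO G' a)" if "a \<in> Ob C" for a
    using nat_trans_Hom[OF \<eta> that] eq that \<eta>' unfolding ftr_eq_def by simp
  show "Comp D (\<eta>' b) (FM F' a b f) = Comp D (FM G' a b f) (\<eta>' a)" if "f \<in> Hom C a b" for a b f
    using nat_trans_natural[OF \<eta> that] eq that \<eta>' groupoid_Hom_Ob[OF C that] unfolding ftr_eq_def by simp
qed

lemma nat_trans_whisker_right:
  assumes "is_functor B C H" "nat_trans C D F G \<eta>"
  shows "nat_trans B D (ftr_comp F H) (ftr_comp G H) (\<lambda>x. \<eta> (FO H x))"
  unfolding nat_trans_def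
  using is_functor_comp[OF assms(1) nat_trans_dom[OF assms(2)]] is_functor_comp[OF assms(1) nat_trans_cod[OF assms(2)]]
    nat_trans_Hom[OF assms(2) functor_Ob[OF assms(1)]] nat_trans_natural[OF assms(2) functor_Hom[OF assms(1)]]
  by simp

lemma nat_trans_whisker_left:
  assumes B: "groupoid B" and \<eta>: "nat_trans B C F G \<eta>" and H: "is_functor C D H"
  shows "nat_trans B D (ftr_comp H F) (ftr_comp H G) (\<lambda>x. FM H (FO F x) (FO G x) (\<eta> x))"
  unfolding nat_trans_def
proof (intro conjI ballI allI impI)
  show "is_functor B D (ftr_comp H F)" "is_functor B D (ftr_comp H G)"
    using is_functor_comp H nat_trans_dom[OF \<eta>] nat_trans_cod[OF \<eta>] by blast+
  show "FM H (FO F a) (FO G a) (\<eta> a) \<in> Hom D (FO (ftr_comp H F) a) (FO (ftr_comp H G) a)" if "a \<in> Ob B" for a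
    using functor_Hom[OF H nat_trans_Hom[OF \<eta> that]] by simp
  fix a b f assume f: "f \<in> Hom B a b"
  then have a: "a \<in> Ob B" and b: "b \<in> Ob B" using groupoid_Hom_Ob[OF B] by blast+
  show "Comp D (FM H (FO F b) (FO G b) (\<eta> b)) (FM (ftr_comp H F) a b f)
      = Comp D (FM (ftr_comp H G) a b f) (FM H (FO F a) (FO G a) (\<eta> a))"
    using functor_Comp[OF H functor_Hom[OF nat_trans_dom[OF \<eta>] f] nat_trans_Hom[OF \<eta> b]]
      functor_Comp[OF H nat_trans_Hom[OF \<eta> a] functor_Hom[OF nat_trans_cod[OF \<eta>] f]] nat_trans_natural[OF \<eta> f]
    by simp
qed

lemma (in grpd) nat_trans_comp:
  assumes C: "groupoid C" and \<eta>: "nat_trans C D F G \<eta>" and \<theta>: "nat_trans C D G H \<theta>"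
  shows "nat_trans C D F H (\<lambda>x. \<theta> x \<odot> \<eta> x)"
  unfolding nat_trans_def
proof (intro conjI ballI allI impI nat_trans_dom[OF \<eta>] nat_trans_cod[OF \<theta>])
  show "\<theta> a \<odot> \<eta> a \<in> Hom D (FO F a) (FO H a)" if "a \<in> Ob C" for a
    using nat_trans_Hom[OF \<eta> that] nat_trans_Hom[OF \<theta> that] by blast
  fix a b f assume f: "f \<in> Hom C a b"
  then have a: "a \<in> Ob C" and b: "b \<in> Ob C" using groupoid_Hom_Ob[OF C] by blast+
  show "(\<theta> b \<odot> \<eta> b) \<odot> FM F a b f = FM H a b f \<odot> \<theta> a \<odot> \<eta> a"
    by (rule paste_squares[OF nat_trans_natural[OF \<eta> f, symmetric] nat_trans_natural[OF \<theta> f, symmetric], symmetric])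
      (use functor_Hom[OF nat_trans_dom[OF \<eta>] f] functor_Hom[OF nat_trans_cod[OF \<eta>] f]
          functor_Hom[OF nat_trans_cod[OF \<theta>] f] nat_trans_Hom[OF \<eta>] nat_trans_Hom[OF \<theta>] a b in auto)
qed

lemma (in grpd) nat_trans_inv:
  assumes C: "groupoid C" and \<eta>: "nat_trans C D F G \<eta>"
  shows "nat_trans C D G F (\<lambda>x. ginv (FO F x) (FO G x) (\<eta> x))"
  unfolding nat_trans_def
proof (intro conjI ballI allI impI nat_trans_dom[OF \<eta>] nat_trans_cod[OF \<eta>])
  show "ginv (FO F a) (FO G a) (\<eta> a) \<in> Hom D (FO G a) (FO F a)" if "a \<in> Ob C" for a
    using nat_trans_Hom[OF \<eta> that] by blast
  fix a b f assume f: "f \<in> Hom C a b"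
  then have a: "a \<in> Ob C" and b: "b \<in> Ob C" using groupoid_Hom_Ob[OF C] by blast+
  let ?ia = "ginv (FO F a) (FO G a) (\<eta> a)" and ?ib = "ginv (FO F b) (FO G b) (\<eta> b)"
  let ?F = "FM F a b f" and ?G = "FM G a b f"
  note \<eta>a = nat_trans_Hom[OF \<eta> a] and \<eta>b = nat_trans_Hom[OF \<eta> b]
  note Fh = functor_Hom[OF nat_trans_dom[OF \<eta>] f] and Gh = functor_Hom[OF nat_trans_cod[OF \<eta>] f]
  note ia = ginv_Hom[OF \<eta>a] and ib = ginv_Hom[OF \<eta>b]
  show "?ib \<odot> ?G = ?F \<odot> ?ia"
  proof (rule right_cancel[OF \<eta>a comp_Hom[OF ib Gh] comp_Hom[OF Fh ia]])
    have "(?ib \<odot> ?G) \<odot> \<eta> a = ?ib \<odot> \<eta> b \<odot> ?F"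
      using assoc[OF ib Gh \<eta>a] nat_trans_natural[OF \<eta> f] by simp
    also have "\<dots> = ?F" using assoc[OF ib \<eta>b Fh] ginv_comp[OF \<eta>b] Idm_comp[OF Fh] by simp
    also have "\<dots> = (?F \<odot> ?ia) \<odot> \<eta> a" using assoc[OF Fh ia \<eta>a] ginv_comp[OF \<eta>a] comp_Idm[OF Fh] by simp
    finally show "(?ib \<odot> ?G) \<odot> \<eta> a = (?F \<odot> ?ia) \<odot> \<eta> a" .
  qed
qed

section \<open>Costacks and bases of open sets\<close>

text \<open>The covering axiom is required for every open set. In particular it provides basic sets
  inside intersections of basic sets, which themselves may fail to be basic.\<close>

locale off_basis =
  fixes Q :: "'a::topological_space set \<Rightarrow> ('qo, 'qm) cat"
    and QI :: "'a set \<Rightarrow> 'a set \<Rightarrow> ('qo, 'qm, 'qo, 'qm) ftr"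
    and \<B> :: "'a set set"
  assumes off: "off_functor Q QI"
    and basis_open: "W \<in> \<B> \<Longrightarrow> open W"
    and basis_cover: "open U \<Longrightarrow> \<Union>{W \<in> \<B>. W \<subseteq> U} = U"
begin

lemma Q_groupoid: "open U \<Longrightarrow> groupoid (Q U)"
  using off[unfolded off_functor_def, THEN conjunct1] by simp

lemma QI_functor: "open V \<Longrightarrow> open U \<Longrightarrow> V \<subseteq> U \<Longrightarrow> is_functor (Q V) (Q U) (QI V U)"
  using off[unfolded off_functor_def, THEN conjunct2, THEN conjunct1] by simp

lemma QI_Ob: "open V \<Longrightarrow> open U \<Longrightarrow> V \<subseteq> U \<Longrightarrow> a \<in> Ob (Q V) \<Longrightarrow> FO (QI V U) a \<in> Ob (Q U)"
  using functor_Ob[OF QI_functor] .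

lemma QI_refl: "open U \<Longrightarrow> a \<in> Ob (Q U) \<Longrightarrow> FO (QI U U) a = a"
  "open U \<Longrightarrow> g \<in> Hom (Q U) a b \<Longrightarrow> FM (QI U U) a b g = g"
  using off[unfolded off_functor_def, THEN conjunct2, THEN conjunct2, THEN conjunct1] by simp_all

lemma QI_trans:
  assumes "open W" "open V" "open U" "W \<subseteq> V" "V \<subseteq> U"
  shows "a \<in> Ob (Q W) \<Longrightarrow> FO (QI V U) (FO (QI W V) a) = FO (QI W U) a"
    and "g \<in> Hom (Q W) a b \<Longrightarrow>
      FM (QI V U) (FO (QI W V) a) (FO (QI W V) b) (FM (QI W V) a b g) = FM (QI W U) a b g"
  using off[unfolded off_functor_def, THEN conjunct2, THEN conjunct2, THEN conjunct2, rule_format, of W V U] assms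
  by (simp_all add: ftr_comp_def)

lemma ftr_eq_QI_trans:
  assumes "open W" "open V" "open U" "W \<subseteq> V" "V \<subseteq> U"
  shows "ftr_eq (Q W) (ftr_comp (ftr_comp F (QI V U)) (QI W V)) (ftr_comp F (QI W U))"
  unfolding ftr_eq_def using QI_trans[OF assms] groupoid_Hom_Ob[OF Q_groupoid[OF assms(1)]] by simp

text \<open>\<open>U1\<close> and \<open>U2\<close> may differ because a transition map on an
  intersection compares functors restricted from two different open sets.\<close>

lemma nat_trans_restrict:
  assumes W: "open W" and V: "open V" "W \<subseteq> V" and U1: "open U1" "V \<subseteq> U1" and U2: "open U2" "V \<subseteq> U2"
    and \<eta>: "nat_trans (Q V) D (ftr_comp F (QI V U1)) (ftr_comp G (QI V U2)) \<eta>"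
  shows "nat_trans (Q W) D (ftr_comp F (QI W U1)) (ftr_comp G (QI W U2)) (\<lambda>q. \<eta> (FO (QI W V) q))"
  by (rule nat_trans_cong[OF Q_groupoid[OF W] nat_trans_whisker_right[OF QI_functor[OF W V] \<eta>]
        ftr_eq_QI_trans[OF W V(1) U1(1) V(2) U1(2)] ftr_eq_QI_trans[OF W V(1) U2(1) V(2) U2(2)]]) simp

lemma descent_equiv_basis:
  assumes "costack_wrt Q QI D" "open U"
  shows "descent_equiv Q QI D U {W \<in> \<B>. W \<subseteq> U}"
proof -
  have "open U \<and> (\<forall>V\<in>{W \<in> \<B>. W \<subseteq> U}. open V) \<and> \<Union>{W \<in> \<B>. W \<subseteq> U} = U"
    using assms(2) basis_open basis_cover[OF assms(2)] by simp
  with assms(1)[unfolded costack_wrt_def, rule_format] show ?thesis .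
qed

lemma descent_equiv_full:
  assumes "descent_equiv Q QI D U \<U>" "is_functor (Q U) D F" "is_functor (Q U) D G"
    "descent_mor Q QI D \<U> (canon_f QI U F) (canon_phi QI D U F) (canon_f QI U G) (canon_phi QI D U G) \<theta>"
  obtains \<eta> where "nat_trans (Q U) D F G \<eta>" "\<And>W q. W \<in> \<U> \<Longrightarrow> q \<in> Ob (Q W) \<Longrightarrow> \<theta> W q = \<eta> (FO (QI W U) q)"
    "\<And>\<eta>' a. nat_trans (Q U) D F G \<eta>' \<Longrightarrow> \<forall>W\<in>\<U>. \<forall>q\<in>Ob (Q W). \<theta> W q = \<eta>' (FO (QI W U) q) \<Longrightarrow>
      a \<in> Ob (Q U) \<Longrightarrow> \<eta>' a = \<eta> a"
  using assms(1)[unfolded descent_equiv_def, THEN conjunct1, rule_format, OF conjI[OF assms(2) conjI[OF assms(3,4)]]]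
  by blast

text \<open>Both canonical data have identity transition arrows, so the square of a descent morphism
  collapses to agreement on intersections. The identities are placed at the object reached through
  \<open>V\<close>; functoriality of \<open>QI\<close> matches it with the one reached through
  \<open>W\<close>.\<close>

lemma descent_mor_canon_iff:
  assumes D: "groupoid D" and U: "open U" and \<U>: "\<And>W. W \<in> \<U> \<Longrightarrow> open W" "\<And>W. W \<in> \<U> \<Longrightarrow> W \<subseteq> U"
    and F: "is_functor (Q U) D F" and G: "is_functor (Q U) D G"
  shows "descent_mor Q QI D \<U> (canon_f QI U F) (canon_phi QI D U F) (canon_f QI U G) (canon_phi QI D U G) \<theta> \<longleftrightarrow>
    (\<forall>W\<in>\<U>. nat_trans (Q W) D (ftr_comp F (QI W U)) (ftr_comp G (QI W U)) (\<theta> W)) \<and>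
    (\<forall>V\<in>\<U>. \<forall>W\<in>\<U>. \<forall>q\<in>Ob (Q (V \<inter> W)). \<theta> V (FO (QI (V \<inter> W) V) q) = \<theta> W (FO (QI (V \<inter> W) W) q))"
proof -
  interpret grpd D by (rule grpd.intro[OF D])
  have key: "Idm D (FO G (FO (QI V U) (FO (QI (V \<inter> W) V) q))) \<odot> \<theta> V (FO (QI (V \<inter> W) V) q)
      = \<theta> W (FO (QI (V \<inter> W) W) q) \<odot> Idm D (FO F (FO (QI V U) (FO (QI (V \<inter> W) V) q)))
    \<longleftrightarrow> \<theta> V (FO (QI (V \<inter> W) V) q) = \<theta> W (FO (QI (V \<inter> W) W) q)"
    if \<theta>: "\<And>W. W \<in> \<U> \<Longrightarrow> nat_trans (Q W) D (ftr_comp F (QI W U)) (ftr_comp G (QI W U)) (\<theta> W)"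
      and VW: "V \<in> \<U>" "W \<in> \<U>" and q: "q \<in> Ob (Q (V \<inter> W))" for V W q
  proof -
    have o: "open (V \<inter> W)" "open V" "open W" "V \<inter> W \<subseteq> V" "V \<inter> W \<subseteq> W" "V \<subseteq> U" "W \<subseteq> U" using \<U> VW by auto
    let ?v = "FO (QI (V \<inter> W) V) q" and ?w = "FO (QI (V \<inter> W) W) q"
    have q': "?v \<in> Ob (Q V)" "?w \<in> Ob (Q W)" using QI_Ob o q by blast+
    have "FO (QI W U) ?w = FO (QI V U) ?v" using QI_trans(1) o U q by simp
    then have "\<theta> V ?v \<in> Hom D (FO F (FO (QI V U) ?v)) (FO G (FO (QI V U) ?v))"
      "\<theta> W ?w \<in> Hom D (FO F (FO (QI V U) ?v)) (FO G (FO (QI V U) ?v))"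
      using nat_trans_Hom[OF \<theta>[OF VW(1)] q'(1)] nat_trans_Hom[OF \<theta>[OF VW(2)] q'(2)] by simp_all
    then show ?thesis using Idm_comp comp_Idm by simp
  qed
  show ?thesis
    unfolding descent_mor_def canon_f_def canon_phi_def FO_ftr_comp
    by (intro conj_cong ball_cong refl key) auto
qed

text \<open>Uniqueness in full faithfulness, for the covering by all basic sets in \<open>U\<close>:
  both transformations extend the family \<open>\<theta>\<close> of restrictions of
  \<open>\<eta>\<close>.\<close>

lemma nat_trans_eqI:
  assumes D: "groupoid D" "costack_wrt Q QI D" and U: "open U"
    and \<eta>: "nat_trans (Q U) D F G \<eta>" and \<eta>': "nat_trans (Q U) D F G \<eta>'"
    and eq: "\<And>W q. W \<in> \<B> \<Longrightarrow> W \<subseteq> U \<Longrightarrow> q \<in> Ob (Q W) \<Longrightarrow> \<eta> (FO (QI W U) q) = \<eta>' (FO (QI W U) q)"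
    and a: "a \<in> Ob (Q U)"
  shows "\<eta> a = \<eta>' a"
proof -
  let ?S = "{W \<in> \<B>. W \<subseteq> U}"
  define \<theta> where "\<theta> W q = \<eta> (FO (QI W U) q)" for W q
  have "descent_mor Q QI D ?S (canon_f QI U F) (canon_phi QI D U F) (canon_f QI U G) (canon_phi QI D U G) \<theta>"
    unfolding \<theta>_def using QI_functor U basis_open
    by (subst descent_mor_canon_iff[OF D(1) U _ _ nat_trans_dom[OF \<eta>] nat_trans_cod[OF \<eta>]])
      (auto intro!: nat_trans_whisker_right[OF _ \<eta>] arg_cong[of _ _ \<eta>] simp: QI_trans(1) open_Int)
  then obtain \<zeta> where "\<And>\<eta>' a. nat_trans (Q U) D F G \<eta>' \<Longrightarrow>
      \<forall>W\<in>?S. \<forall>q\<in>Ob (Q W). \<theta> W q = \<eta>' (FO (QI W U) q) \<Longrightarrow> a \<in> Ob (Q U) \<Longrightarrow> \<eta>' a = \<zeta> a"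
    by (rule descent_equiv_full[OF descent_equiv_basis[OF D(2) U] nat_trans_dom[OF \<eta>] nat_trans_cod[OF \<eta>]]) rule
  from this[OF \<eta> _ a] this[OF \<eta>' _ a] show ?thesis using eq unfolding \<theta>_def by simp
qed

text \<open>Descent demands agreement over \<open>V \<inter> W\<close>, whereas
  \<open>compat\<close> speaks of inclusions of basic sets. Over the intersection the two candidates
  are compared by \<open>nat_trans_eqI\<close> on basic \<open>Z\<close> inside it, where
  \<open>compat\<close> turns both into \<open>\<theta> Z\<close>.\<close>

lemma nat_trans_glue:
  assumes D: "groupoid D" "costack_wrt Q QI D" and U: "open U"
    and F: "is_functor (Q U) D F" and G: "is_functor (Q U) D G"
    and \<theta>: "\<And>W. W \<in> \<B> \<Longrightarrow> W \<subseteq> U \<Longrightarrow> nat_trans (Q W) D (ftr_comp F (QI W U)) (ftr_comp G (QI W U)) (\<theta> W)"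
    and compat: "\<And>V W q. V \<in> \<B> \<Longrightarrow> W \<in> \<B> \<Longrightarrow> V \<subseteq> W \<Longrightarrow> W \<subseteq> U \<Longrightarrow> q \<in> Ob (Q V) \<Longrightarrow> \<theta> W (FO (QI V W) q) = \<theta> V q"
  shows "\<exists>\<eta>. nat_trans (Q U) D F G \<eta> \<and> (\<forall>W\<in>\<B>. W \<subseteq> U \<longrightarrow> (\<forall>q\<in>Ob (Q W). \<eta> (FO (QI W U) q) = \<theta> W q))"
proof -
  let ?S = "{W \<in> \<B>. W \<subseteq> U}"
  have "\<theta> V (FO (QI (V \<inter> W) V) q) = \<theta> W (FO (QI (V \<inter> W) W) q)"
    if VW: "V \<in> ?S" "W \<in> ?S" and q: "q \<in> Ob (Q (V \<inter> W))" for V W q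
  proof -
    have o: "open (V \<inter> W)" "open V" "open W" "V \<inter> W \<subseteq> V" "V \<inter> W \<subseteq> W" "V \<subseteq> U" "W \<subseteq> U"
      using VW basis_open by auto
    show ?thesis
    proof (rule nat_trans_eqI[OF D o(1) _ _ _ q])
      show "nat_trans (Q (V \<inter> W)) D (ftr_comp F (QI (V \<inter> W) U)) (ftr_comp G (QI (V \<inter> W) U)) (\<lambda>q. \<theta> V (FO (QI (V \<inter> W) V) q))"
        using VW by (intro nat_trans_restrict[OF o(1,2,4) U o(6) U o(6)] \<theta>) auto
      show "nat_trans (Q (V \<inter> W)) D (ftr_comp F (QI (V \<inter> W) U)) (ftr_comp G (QI (V \<inter> W) U)) (\<lambda>q. \<theta> W (FO (QI (V \<inter> W) W) q))"
        using VW by (intro nat_trans_restrict[OF o(1,3,5) U o(7) U o(7)] \<theta>) auto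
      fix Z q assume Z: "Z \<in> \<B>" "Z \<subseteq> V \<inter> W" "q \<in> Ob (Q Z)"
      then have "Z \<subseteq> V" "Z \<subseteq> W" "open Z" using basis_open by auto
      then show "\<theta> V (FO (QI (V \<inter> W) V) (FO (QI Z (V \<inter> W)) q)) = \<theta> W (FO (QI (V \<inter> W) W) (FO (QI Z (V \<inter> W)) q))"
        using QI_trans(1) o Z compat[of Z V q] compat[of Z W q] VW by simp
    qed
  qed
  then have "descent_mor Q QI D ?S (canon_f QI U F) (canon_phi QI D U F) (canon_f QI U G) (canon_phi QI D U G) \<theta>"
    using \<theta> basis_open by (subst descent_mor_canon_iff[OF D(1) U _ _ F G]) auto
  then obtain \<eta> where "nat_trans (Q U) D F G \<eta>" "\<And>W q. W \<in> ?S \<Longrightarrow> q \<in> Ob (Q W) \<Longrightarrow> \<theta> W q = \<eta> (FO (QI W U) q)"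
    by (rule descent_equiv_full[OF descent_equiv_basis[OF D(2) U] F G]) rule
  then show ?thesis by (intro exI[of _ \<eta>]) simp
qed

text \<open>Data for inclusions of basic sets are turned into a descent datum. Over each basic
  \<open>Z\<close> inside \<open>V \<inter> W\<close> the transition must be
  \<open>\<alpha> Z W\<close> after the inverse of \<open>\<alpha> Z V\<close>; these arrows glue to
  a transformation on the intersection, and essential surjectivity then supplies
  \<open>F\<close>.\<close>

lemma functor_glue:
  assumes D: "groupoid D" "costack_wrt Q QI D" and U: "open U"
    and f: "\<And>W. W \<in> \<B> \<Longrightarrow> W \<subseteq> U \<Longrightarrow> is_functor (Q W) D (f W)"
    and \<alpha>: "\<And>V W. V \<in> \<B> \<Longrightarrow> W \<in> \<B> \<Longrightarrow> V \<subseteq> W \<Longrightarrow> W \<subseteq> U \<Longrightarrow> nat_trans (Q V) D (f V) (ftr_comp (f W) (QI V W)) (\<alpha> V W)"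
    and \<alpha>_comp: "\<And>Z V W q. Z \<in> \<B> \<Longrightarrow> V \<in> \<B> \<Longrightarrow> W \<in> \<B> \<Longrightarrow> Z \<subseteq> V \<Longrightarrow> V \<subseteq> W \<Longrightarrow> W \<subseteq> U \<Longrightarrow> q \<in> Ob (Q Z) \<Longrightarrow>
        \<alpha> Z W q = Comp D (\<alpha> V W (FO (QI Z V) q)) (\<alpha> Z V q)"
  shows "\<exists>F \<theta>. is_functor (Q U) D F \<and>
      (\<forall>W\<in>\<B>. W \<subseteq> U \<longrightarrow> nat_trans (Q W) D (ftr_comp F (QI W U)) (f W) (\<theta> W)) \<and>
      (\<forall>V\<in>\<B>. \<forall>W\<in>\<B>. V \<subseteq> W \<longrightarrow> W \<subseteq> U \<longrightarrow> (\<forall>q\<in>Ob (Q V). Comp D (\<alpha> V W q) (\<theta> V q) = \<theta> W (FO (QI V W) q)))"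
proof -
  interpret grpd D by (rule grpd.intro[OF D(1)])
  let ?S = "{W \<in> \<B>. W \<subseteq> U}"
  have \<alpha>_Hom: "\<alpha> V W q \<in> Hom D (FO (f V) q) (FO (f W) (FO (QI V W) q))"
    if "V \<in> \<B>" "W \<in> \<B>" "V \<subseteq> W" "W \<subseteq> U" "q \<in> Ob (Q V)" for V W q
    using nat_trans_Hom[OF \<alpha>[OF that(1-4)] that(5)] by simp
  \<comment> \<open>The second clause characterises the transition without inverses; by
    \<open>nat_trans_eqI\<close> it leaves at most one transformation, which is what the cocycle
    argument uses.\<close>
  define P where "P V W \<phi> \<longleftrightarrow>
      nat_trans (Q (V \<inter> W)) D (ftr_comp (f V) (QI (V \<inter> W) V)) (ftr_comp (f W) (QI (V \<inter> W) W)) \<phi> \<and>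
      (\<forall>Z\<in>\<B>. Z \<subseteq> V \<inter> W \<longrightarrow> (\<forall>q\<in>Ob (Q Z). \<phi> (FO (QI Z (V \<inter> W)) q) \<odot> \<alpha> Z V q = \<alpha> Z W q))"
    for V W \<phi>
  have ex: "\<exists>\<phi>. P V W \<phi>" if VW: "V \<in> ?S" "W \<in> ?S" for V W
  proof -
    let ?X = "V \<inter> W"
    have o: "open ?X" "open V" "open W" "?X \<subseteq> V" "?X \<subseteq> W" "V \<subseteq> U" "W \<subseteq> U" "V \<in> \<B>" "W \<in> \<B>"
      using VW basis_open by auto
    define \<theta> where "\<theta> Z q = \<alpha> Z W q \<odot> ginv (FO (f Z) q) (FO (f V) (FO (QI Z V) q)) (\<alpha> Z V q)" for Z q
    have "\<exists>\<phi>. nat_trans (Q ?X) D (ftr_comp (f V) (QI ?X V)) (ftr_comp (f W) (QI ?X W)) \<phi> \<and>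
      (\<forall>Z\<in>\<B>. Z \<subseteq> ?X \<longrightarrow> (\<forall>q\<in>Ob (Q Z). \<phi> (FO (QI Z ?X) q) = \<theta> Z q))"
    proof (rule nat_trans_glue[OF D o(1)])
      show "is_functor (Q ?X) D (ftr_comp (f V) (QI ?X V))" "is_functor (Q ?X) D (ftr_comp (f W) (QI ?X W))"
        using is_functor_comp[OF QI_functor[OF o(1,2,4)] f[OF o(8,6)]] is_functor_comp[OF QI_functor[OF o(1,3,5)] f[OF o(9,7)]] .
    next
      fix Z assume Z: "Z \<in> \<B>" "Z \<subseteq> ?X"
      then have oZ: "open Z" "Z \<subseteq> V" "Z \<subseteq> W" using basis_open by auto
      note QZ = Q_groupoid[OF oZ(1)]
      show "nat_trans (Q Z) D (ftr_comp (ftr_comp (f V) (QI ?X V)) (QI Z ?X)) (ftr_comp (ftr_comp (f W) (QI ?X W)) (QI Z ?X)) (\<theta> Z)"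
        by (rule nat_trans_cong[OF QZ nat_trans_comp[OF QZ nat_trans_inv[OF QZ \<alpha>[OF Z(1) o(8) oZ(2) o(6)]]
                \<alpha>[OF Z(1) o(9) oZ(3) o(7)]] ftr_eq_QI_trans[THEN ftr_eq_sym] ftr_eq_QI_trans[THEN ftr_eq_sym]])
          (use oZ Z o in \<open>auto simp: \<theta>_def\<close>)
    next
      fix Z Z' q assume Z: "Z \<in> \<B>" "Z' \<in> \<B>" "Z \<subseteq> Z'" "Z' \<subseteq> ?X" and q: "q \<in> Ob (Q Z)"
      then have oZ: "open Z" "open Z'" "Z' \<subseteq> V" "Z' \<subseteq> W" "Z' \<subseteq> U" using basis_open o(6) by auto
      have q': "FO (QI Z Z') q \<in> Ob (Q Z')" using QI_Ob[OF oZ(1,2) Z(3) q] .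
      have e: "\<alpha> Z V q = \<alpha> Z' V (FO (QI Z Z') q) \<odot> \<alpha> Z Z' q" "\<alpha> Z W q = \<alpha> Z' W (FO (QI Z Z') q) \<odot> \<alpha> Z Z' q"
        using \<alpha>_comp[OF Z(1,2) o(8) Z(3) oZ(3) o(6) q] \<alpha>_comp[OF Z(1,2) o(9) Z(3) oZ(4) o(7) q] by auto
      have t: "FO (QI Z' V) (FO (QI Z Z') q) = FO (QI Z V) q"
        using QI_trans(1)[OF oZ(1,2) o(2) Z(3) oZ(3) q] .
      show "\<theta> Z' (FO (QI Z Z') q) = \<theta> Z q"
        unfolding \<theta>_def e t
        by (rule comp_ginv_cancel[OF \<alpha>_Hom[OF Z(2) o(8) oZ(3) o(6) q', unfolded t] \<alpha>_Hom[OF Z(2) o(9) oZ(4) o(7) q']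
              \<alpha>_Hom[OF Z(1,2,3) oZ(5) q], symmetric])
    qed
    then obtain \<phi> where \<phi>: "nat_trans (Q ?X) D (ftr_comp (f V) (QI ?X V)) (ftr_comp (f W) (QI ?X W)) \<phi>"
      "\<And>Z q. Z \<in> \<B> \<Longrightarrow> Z \<subseteq> ?X \<Longrightarrow> q \<in> Ob (Q Z) \<Longrightarrow> \<phi> (FO (QI Z ?X) q) = \<theta> Z q" by blast
    have "\<phi> (FO (QI Z ?X) q) \<odot> \<alpha> Z V q = \<alpha> Z W q" if "Z \<in> \<B>" "Z \<subseteq> ?X" "q \<in> Ob (Q Z)" for Z q
      unfolding \<phi>(2)[OF that] \<theta>_def by (rule comp_ginv_eq[OF \<alpha>_Hom \<alpha>_Hom]) (use that o in auto)
    with \<phi>(1) show ?thesis unfolding P_def by blast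
  qed
  define \<phi> where "\<phi> V W = (SOME \<phi>. P V W \<phi>)" for V W
  have "P V W (\<phi> V W)" if "V \<in> ?S" "W \<in> ?S" for V W
    unfolding \<phi>_def by (rule someI_ex[OF ex[OF that]])
  then have \<phi>: "\<And>V W. V \<in> ?S \<Longrightarrow> W \<in> ?S \<Longrightarrow>
        nat_trans (Q (V \<inter> W)) D (ftr_comp (f V) (QI (V \<inter> W) V)) (ftr_comp (f W) (QI (V \<inter> W) W)) (\<phi> V W)"
    and \<phi>_\<alpha>: "\<And>V W Z q. V \<in> ?S \<Longrightarrow> W \<in> ?S \<Longrightarrow> Z \<in> \<B> \<Longrightarrow> Z \<subseteq> V \<inter> W \<Longrightarrow> q \<in> Ob (Q Z) \<Longrightarrow>
        \<phi> V W (FO (QI Z (V \<inter> W)) q) \<odot> \<alpha> Z V q = \<alpha> Z W q"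
    unfolding P_def by simp_all
  have "descent_datum Q QI D ?S f \<phi>"
    unfolding descent_datum_def
  proof (intro conjI ballI)
    show "is_functor (Q W) D (f W)" if "W \<in> ?S" for W using f that by blast
    show "nat_trans (Q (V \<inter> W)) D (ftr_comp (f V) (QI (V \<inter> W) V)) (ftr_comp (f W) (QI (V \<inter> W) W)) (\<phi> V W)"
      if "V \<in> ?S" "W \<in> ?S" for V W using \<phi> that by blast
    fix V W X a assume S: "V \<in> ?S" "W \<in> ?S" "X \<in> ?S" and a: "a \<in> Ob (Q (V \<inter> W \<inter> X))"
    let ?Y = "V \<inter> W \<inter> X"
    have o: "open V" "open W" "open X" "open ?Y" "open (V \<inter> W)" "open (W \<inter> X)" "open (V \<inter> X)"
      "?Y \<subseteq> V" "?Y \<subseteq> W" "?Y \<subseteq> X" "?Y \<subseteq> V \<inter> W" "?Y \<subseteq> W \<inter> X" "?Y \<subseteq> V \<inter> X"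
      "V \<inter> W \<subseteq> V" "V \<inter> W \<subseteq> W" "W \<inter> X \<subseteq> W" "W \<inter> X \<subseteq> X" "V \<inter> X \<subseteq> V" "V \<inter> X \<subseteq> X"
      using S basis_open by (auto intro: open_Int)
    note QY = Q_groupoid[OF o(4)]
    \<comment> \<open>On a basic \<open>Z\<close> in the triple intersection both sides, precomposed
      with \<open>\<alpha> Z V q\<close>, become \<open>\<alpha> Z X q\<close>; that arrow is then
      cancelled.\<close>
    show "\<phi> W X (FO (QI ?Y (W \<inter> X)) a) \<odot> \<phi> V W (FO (QI ?Y (V \<inter> W)) a) = \<phi> V X (FO (QI ?Y (V \<inter> X)) a)"
    proof (rule nat_trans_eqI[OF D o(4) nat_trans_comp[OF QY nat_trans_restrict[OF o(4,5,11,1,14,2,15) \<phi>[OF S(1,2)]]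
            nat_trans_restrict[OF o(4,6,12,2,16,3,17) \<phi>[OF S(2,3)]]] nat_trans_restrict[OF o(4,7,13,1,18,3,19) \<phi>[OF S(1,3)]] _ a])
      fix Z q assume Z: "Z \<in> \<B>" "Z \<subseteq> ?Y" and q: "q \<in> Ob (Q Z)"
      then have oZ: "open Z" "Z \<subseteq> V \<inter> W" "Z \<subseteq> W \<inter> X" "Z \<subseteq> V \<inter> X" "Z \<subseteq> V" "Z \<subseteq> W" "Z \<subseteq> X" using basis_open by auto
      have t: "FO (QI ?Y (W \<inter> X)) (FO (QI Z ?Y) q) = FO (QI Z (W \<inter> X)) q"
        "FO (QI ?Y (V \<inter> W)) (FO (QI Z ?Y) q) = FO (QI Z (V \<inter> W)) q"
        "FO (QI ?Y (V \<inter> X)) (FO (QI Z ?Y) q) = FO (QI Z (V \<inter> X)) q"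
        using QI_trans(1)[OF oZ(1) o(4) _ Z(2) _ q] o by simp_all
      have \<phi>_Hom: "\<phi> A B (FO (QI Z (A \<inter> B)) q) \<in> Hom D (FO (f A) (FO (QI Z A) q)) (FO (f B) (FO (QI Z B) q))"
        if "A \<in> ?S" "B \<in> ?S" "Z \<subseteq> A \<inter> B" for A B
      proof -
        have oAB: "open A" "open B" "open (A \<inter> B)" using that basis_open by (auto intro: open_Int)
        show ?thesis
          using nat_trans_Hom[OF \<phi>[OF that(1,2)] QI_Ob[OF oZ(1) oAB(3) that(3) q]]
            QI_trans(1)[OF oZ(1) oAB(3) oAB(1) that(3) Int_lower1 q] QI_trans(1)[OF oZ(1) oAB(3) oAB(2) that(3) Int_lower2 q]
          by simp
      qed
      have a: "\<alpha> Z A q \<in> Hom D (FO (f Z) q) (FO (f A) (FO (QI Z A) q))" if "A \<in> ?S" "Z \<subseteq> A" for A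
        using \<alpha>_Hom[OF Z(1) _ that(2) _ q] that(1) by simp
      note h = \<phi>_Hom[OF S(2,3) oZ(3)] \<phi>_Hom[OF S(1,2) oZ(2)] \<phi>_Hom[OF S(1,3) oZ(4)]
      have "(\<phi> W X (FO (QI Z (W \<inter> X)) q) \<odot> \<phi> V W (FO (QI Z (V \<inter> W)) q)) \<odot> \<alpha> Z V q
          = \<phi> V X (FO (QI Z (V \<inter> X)) q) \<odot> \<alpha> Z V q"
        using assoc[OF h(1,2) a[OF S(1) oZ(5)]] \<phi>_\<alpha>[OF S(1,2) Z(1) oZ(2) q] \<phi>_\<alpha>[OF S(2,3) Z(1) oZ(3) q]
          \<phi>_\<alpha>[OF S(1,3) Z(1) oZ(4) q] by simp
      then show "\<phi> W X (FO (QI ?Y (W \<inter> X)) (FO (QI Z ?Y) q)) \<odot> \<phi> V W (FO (QI ?Y (V \<inter> W)) (FO (QI Z ?Y) q))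
          = \<phi> V X (FO (QI ?Y (V \<inter> X)) (FO (QI Z ?Y) q))"
        unfolding t by (rule right_cancel[OF a[OF S(1) oZ(5)] comp_Hom[OF h(1,2)] h(3)])
    qed
  qed
  then obtain F \<theta> where F: "is_functor (Q U) D F"
    and \<theta>: "descent_mor Q QI D ?S (canon_f QI U F) (canon_phi QI D U F) f \<phi> \<theta>"
    using descent_equiv_basis[OF D(2) U, unfolded descent_equiv_def, THEN conjunct2, rule_format] by blast
  have \<theta>_nat: "nat_trans (Q W) D (ftr_comp F (QI W U)) (f W) (\<theta> W)" if "W \<in> \<B>" "W \<subseteq> U" for W
    using \<theta>[unfolded descent_mor_def, THEN conjunct1] that by (simp add: canon_f_def)
  have "\<alpha> V W q \<odot> \<theta> V q = \<theta> W (FO (QI V W) q)"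
    if VW: "V \<in> \<B>" "W \<in> \<B>" "V \<subseteq> W" "W \<subseteq> U" and q: "q \<in> Ob (Q V)" for V W q
  proof -
    have o: "open V" "open W" "V \<inter> W = V" "V \<subseteq> U" using VW basis_open by auto
    have S: "V \<in> ?S" "W \<in> ?S" using VW by auto
    note r = QI_refl(1)[OF o(1) q]
    have \<alpha>VV: "\<alpha> V V q \<in> Hom D (FO (f V) q) (FO (f V) q)"
      using \<alpha>_Hom[OF VW(1,1) order_refl o(4) q] r by simp
    \<comment> \<open>\<open>\<alpha>_comp\<close> for \<open>V\<close>, \<open>V\<close>,
      \<open>V\<close> makes \<open>\<alpha> V V q\<close> idempotent, hence an identity. Since
      \<open>V \<inter> W = V\<close>, the characterisation of the transition with
      \<open>Z = V\<close> then reads \<open>\<phi> V W q = \<alpha> V W q\<close>.\<close>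
    have "\<alpha> V V q \<odot> \<alpha> V V q = \<alpha> V V q \<odot> Idm D (FO (f V) q)"
      using \<alpha>_comp[OF VW(1,1,1) order_refl order_refl o(4) q] r comp_Idm[OF \<alpha>VV] by simp
    then have id: "\<alpha> V V q = Idm D (FO (f V) q)"
      using left_cancel[OF \<alpha>VV \<alpha>VV Idm_Hom[OF Hom_Ob(1)[OF \<alpha>VV]]] by simp
    have "\<phi> V W q \<in> Hom D (FO (f V) q) (FO (f W) (FO (QI V W) q))"
      using nat_trans_Hom[OF \<phi>[OF S], of q] q r o(3) by simp
    then have "\<phi> V W q = \<alpha> V W q"
      using \<phi>_\<alpha>[OF S VW(1) _ q] o(3) r id comp_Idm by simp
    moreover have "\<phi> V W q \<odot> \<theta> V q = \<theta> W (FO (QI V W) q) \<odot> Idm D (FO F (FO (QI V U) q))"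
      using \<theta>[unfolded descent_mor_def, THEN conjunct2, rule_format, OF S, of q] q o(3) r
      by (simp add: canon_phi_def)
    moreover have "\<theta> W (FO (QI V W) q) \<in> Hom D (FO F (FO (QI V U) q)) (FO (f W) (FO (QI V W) q))"
      using nat_trans_Hom[OF \<theta>_nat[OF VW(2,4)] QI_Ob[OF o(1,2) VW(3) q]] QI_trans(1)[OF o(1,2) U VW(3,4) q] by simp
    ultimately show ?thesis using comp_Idm by simp
  qed
  with F \<theta>_nat show ?thesis by blast
qed

end

section \<open>Morphisms into the fundamental groupoid\<close>

interpretation Pi1: grpd "Pi1 U" for U
  by (rule grpd.intro[OF groupoid_Pi1])

text \<open>The arrow part of \<open>Pi1_ind\<close> depends neither on the endpoints nor on the
  smaller open set; dropping these arguments makes the functor laws usable as equations between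
  classes.\<close>

definition push :: "'a::topological_space set \<Rightarrow> (real \<Rightarrow> 'a) set \<Rightarrow> (real \<Rightarrow> 'a) set" where
  "push U c = pclass U (SOME p. p \<in> c)"

lemma FM_Pi1_ind_push [simp]: "FM (Pi1_ind V U) x y c = push U c"
  by (simp add: Pi1_ind_def push_def)

lemma push_Hom: "V \<subseteq> U \<Longrightarrow> c \<in> Hom (Pi1 V) x y \<Longrightarrow> push U c \<in> Hom (Pi1 U) x y"
  using functor_Hom[OF is_functor_Pi1_ind, of V U c x y] by simp

lemma push_Comp:
  "V \<subseteq> U \<Longrightarrow> c \<in> Hom (Pi1 V) x y \<Longrightarrow> d \<in> Hom (Pi1 V) y z \<Longrightarrow>
    push U (Comp (Pi1 V) d c) = Comp (Pi1 U) (push U d) (push U c)"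
  using functor_Comp[OF is_functor_Pi1_ind, of V U c x y d z] by simp

lemma push_Idm: "V \<subseteq> U \<Longrightarrow> x \<in> V \<Longrightarrow> push U (Idm (Pi1 V) x) = Idm (Pi1 U) x"
  using functor_Idm[OF is_functor_Pi1_ind, of V U x] by simp

lemma push_push: "W \<subseteq> V \<Longrightarrow> V \<subseteq> U \<Longrightarrow> c \<in> Hom (Pi1 W) x y \<Longrightarrow> push U (push V c) = push U c"
proof -
  assume s: "W \<subseteq> V" "V \<subseteq> U" and "c \<in> Hom (Pi1 W) x y"
  then obtain p where p: "path_in W x y p" "c = pclass W p" by (elim Hom_Pi1E)
  have "path_image p \<subseteq> V" "W \<subseteq> U" using s p by auto
  then show "push U (push V c) = push U c"
    using p s FM_Pi1_ind[of p W V] FM_Pi1_ind[of p V U] FM_Pi1_ind[of p W U] by simp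
qed

lemma push_self: "c \<in> Hom (Pi1 U) x y \<Longrightarrow> push U c = c"
proof -
  assume "c \<in> Hom (Pi1 U) x y"
  then obtain p where "path_in U x y p" "c = pclass U p" by (elim Hom_Pi1E)
  then show "push U c = c" using FM_Pi1_ind[of p U U] by simp
qed

definition const_ftr :: "'a::topological_space set \<Rightarrow> 'a \<Rightarrow> ('o, 'm, 'a, (real \<Rightarrow> 'a) set) ftr" where
  "const_ftr U x = \<lparr>FO = (\<lambda>_. x), FM = (\<lambda>_ _ _. Idm (Pi1 U) x)\<rparr>"

lemma const_ftr_simps [simp]: "FO (const_ftr U x) a = x" "FM (const_ftr U x) a b g = Idm (Pi1 U) x"
  by (simp_all add: const_ftr_def)

lemma is_functor_const:
  assumes "x \<in> U"
  shows "is_functor C (Pi1 U) (const_ftr U x)"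
proof -
  have "Idm (Pi1 U) x \<in> Hom (Pi1 U) x x" using assms by (intro Pi1.Idm_Hom) simp
  from Pi1.comp_Idm[OF this] this show ?thesis
    using assms unfolding is_functor_def by simp
qed

text \<open>The coefficient groupoids have the type of \<open>Pi1 U\<close> because descent for
  \<open>Q\<close> is applied with values in the fundamental groupoids themselves.\<close>

locale costack_over_Pi1 = off_basis Q QI \<B>
  for Q :: "'a::topological_space set \<Rightarrow> ('qo, 'qm) cat"
    and QI :: "'a set \<Rightarrow> 'a set \<Rightarrow> ('qo, 'qm, 'qo, 'qm) ftr" and \<B> :: "'a set set" +
  assumes costack: "groupoid (D :: ('a, (real \<Rightarrow> 'a) set) cat) \<Longrightarrow> costack_wrt Q QI D"
    and basis_sc: "W \<in> \<B> \<Longrightarrow> simply_connected W"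
    and basis_ne: "W \<in> \<B> \<Longrightarrow> W \<noteq> {}"
begin

lemmas Pi1_costack = groupoid_Pi1 costack[OF groupoid_Pi1]

section \<open>Construction of a morphism from a costack to the fundamental groupoid\<close>

definition base :: "'a set \<Rightarrow> 'a" where "base W = (SOME x. x \<in> W)"

lemma base: "W \<in> \<B> \<Longrightarrow> base W \<in> W"
  unfolding base_def using basis_ne by (simp add: some_in_eq)

text \<open>The chosen base points are not compatible with inclusions. \<open>arrow\<close> records
  the only class of paths in \<open>W\<close> that connects them, and this uniqueness yields the
  composition law below.\<close>

definition arrow :: "'a set \<Rightarrow> 'a set \<Rightarrow> (real \<Rightarrow> 'a) set" where
  "arrow V W = (SOME c. c \<in> Hom (Pi1 W) (base V) (base W))"

lemma arrow: "V \<in> \<B> \<Longrightarrow> W \<in> \<B> \<Longrightarrow> V \<subseteq> W \<Longrightarrow> arrow V W \<in> Hom (Pi1 W) (base V) (base W)"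
  unfolding arrow_def
  using Pi1_simply_connected_ex[of W "base V" "base W"] basis_sc base[of V] base[of W] by (auto simp: some_in_eq)

lemma arrow_comp:
  assumes "Z \<in> \<B>" "V \<in> \<B>" "W \<in> \<B>" "Z \<subseteq> V" "V \<subseteq> W"
  shows "arrow Z W = Comp (Pi1 W) (arrow V W) (push W (arrow Z V))"
  using assms arrow push_Hom[OF assms(5) arrow[OF assms(1,2,4)]]
  by (intro Pi1_simply_connected_unique[OF basis_sc[OF assms(3)]] Pi1.comp_Hom) auto

text \<open>A functor glued from the constant functors at the base points of the basic sets in
  \<open>U\<close>, with the pushed \<open>arrow V W\<close> as transition arrows;
  \<open>\<theta>\<close> is the comparison with these constants.\<close>

definition point_approx :: "'a set \<Rightarrow> ('qo, 'qm, 'a, (real \<Rightarrow> 'a) set) ftr \<Rightarrow> ('a set \<Rightarrow> 'qo \<Rightarrow> (real \<Rightarrow> 'a) set) \<Rightarrow> bool" where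
  "point_approx U F \<theta> \<longleftrightarrow> is_functor (Q U) (Pi1 U) F \<and>
      (\<forall>W\<in>\<B>. W \<subseteq> U \<longrightarrow> nat_trans (Q W) (Pi1 U) (ftr_comp F (QI W U)) (const_ftr U (base W)) (\<theta> W)) \<and>
      (\<forall>V\<in>\<B>. \<forall>W\<in>\<B>. V \<subseteq> W \<longrightarrow> W \<subseteq> U \<longrightarrow> (\<forall>q\<in>Ob (Q V).
        Comp (Pi1 U) (push U (arrow V W)) (\<theta> V q) = \<theta> W (FO (QI V W) q)))"

lemma point_approx_ex: "open U \<Longrightarrow> \<exists>F \<theta>. point_approx U F \<theta>"
  unfolding point_approx_def
proof (rule functor_glue[OF Pi1_costack])
  fix W assume W: "W \<in> \<B>" "W \<subseteq> U"
  then have "base W \<in> U" using base by blast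
  then show "is_functor (Q W) (Pi1 U) (const_ftr U (base W))" by (rule is_functor_const)
next
  fix V W assume VW: "V \<in> \<B>" "W \<in> \<B>" "V \<subseteq> W" "W \<subseteq> U"
  then have b: "base V \<in> U" "base W \<in> U" using base by blast+
  note a = push_Hom[OF VW(4) arrow[OF VW(1-3)]]
  show "nat_trans (Q V) (Pi1 U) (const_ftr U (base V)) (ftr_comp (const_ftr U (base W)) (QI V W)) (\<lambda>_. push U (arrow V W))"
    unfolding nat_trans_def
    using is_functor_const[OF b(1)] is_functor_comp[OF QI_functor is_functor_const[OF b(2)]] VW basis_open
      a Pi1.comp_Idm[OF a] Pi1.Idm_comp[OF a] by simp
next
  fix Z V W q assume Z: "Z \<in> \<B>" "V \<in> \<B>" "W \<in> \<B>" "Z \<subseteq> V" "V \<subseteq> W" "W \<subseteq> U"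
  show "push U (arrow Z W) = Comp (Pi1 U) (push U (arrow V W)) (push U (arrow Z V))"
    unfolding arrow_comp[OF Z(1-5)]
    using push_Comp[OF Z(6) push_Hom[OF Z(5) arrow[OF Z(1,2,4)]] arrow[OF Z(2,3,5)]]
      push_push[OF Z(5,6) arrow[OF Z(1,2,4)]] by simp
qed

text \<open>Functor and comparison arrows are chosen as a pair, because the 2-cells
  \<open>\<psi>\<close> are later determined through the arrows \<open>\<Theta>\<close>.\<close>

definition comparison :: "'a set \<Rightarrow> ('qo, 'qm, 'a, (real \<Rightarrow> 'a) set) ftr \<times> ('a set \<Rightarrow> 'qo \<Rightarrow> (real \<Rightarrow> 'a) set)" where
  "comparison U = (SOME z. point_approx U (fst z) (snd z))"

abbreviation "\<Psi> U \<equiv> fst (comparison U)"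
abbreviation "\<Theta> U \<equiv> snd (comparison U)"

lemma point_approx: "open U \<Longrightarrow> point_approx U (\<Psi> U) (\<Theta> U)"
  unfolding comparison_def by (rule someI_ex) (use point_approx_ex in force)

lemma \<Psi>_functor: "open U \<Longrightarrow> is_functor (Q U) (Pi1 U) (\<Psi> U)"
  using point_approx unfolding point_approx_def by blast

lemma \<Theta>_nat: "open U \<Longrightarrow> W \<in> \<B> \<Longrightarrow> W \<subseteq> U \<Longrightarrow>
    nat_trans (Q W) (Pi1 U) (ftr_comp (\<Psi> U) (QI W U)) (const_ftr U (base W)) (\<Theta> U W)"
  using point_approx unfolding point_approx_def by blast

lemma \<Theta>_Hom: "open U \<Longrightarrow> W \<in> \<B> \<Longrightarrow> W \<subseteq> U \<Longrightarrow> q \<in> Ob (Q W) \<Longrightarrow>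
    \<Theta> U W q \<in> Hom (Pi1 U) (FO (\<Psi> U) (FO (QI W U) q)) (base W)"
  using nat_trans_Hom[OF \<Theta>_nat] by simp

lemma \<Theta>_arrow: "open U \<Longrightarrow> V \<in> \<B> \<Longrightarrow> W \<in> \<B> \<Longrightarrow> V \<subseteq> W \<Longrightarrow> W \<subseteq> U \<Longrightarrow> q \<in> Ob (Q V) \<Longrightarrow>
    \<Theta> U W (FO (QI V W) q) = Comp (Pi1 U) (push U (arrow V W)) (\<Theta> U V q)"
  using point_approx[of U] unfolding point_approx_def by simp

text \<open>The second clause says that the 2-cell respects the comparisons with the base points. As
  \<open>\<Theta>\<close> is invertible, it fixes the 2-cell on basic sets and hence
  everywhere.\<close>

definition transition :: "'a set \<Rightarrow> 'a set \<Rightarrow> ('qo \<Rightarrow> (real \<Rightarrow> 'a) set) \<Rightarrow> bool" where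
  "transition V U \<eta> \<longleftrightarrow> nat_trans (Q V) (Pi1 U) (ftr_comp (Pi1_ind V U) (\<Psi> V)) (ftr_comp (\<Psi> U) (QI V U)) \<eta> \<and>
      (\<forall>W\<in>\<B>. W \<subseteq> V \<longrightarrow> (\<forall>q\<in>Ob (Q W). Comp (Pi1 U) (\<Theta> U W q) (\<eta> (FO (QI W V) q)) = push U (\<Theta> V W q)))"

lemma transition_ex:
  assumes V: "open V" and U: "open U" and VU: "V \<subseteq> U"
  shows "\<exists>\<eta>. transition V U \<eta>"
proof -
  \<comment> \<open>The second clause of \<open>transition\<close>, solved for the 2-cell on basic
    sets.\<close>
  define \<theta> where "\<theta> W q = Comp (Pi1 U) (Pi1.ginv U (FO (\<Psi> U) (FO (QI W U) q)) (base W) (\<Theta> U W q)) (push U (\<Theta> V W q))" for W q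
  have pH: "push U (\<Theta> V W q) \<in> Hom (Pi1 U) (FO (\<Psi> V) (FO (QI W V) q)) (base W)"
    and \<theta>_Hom: "\<theta> W q \<in> Hom (Pi1 U) (FO (\<Psi> V) (FO (QI W V) q)) (FO (\<Psi> U) (FO (QI W U) q))"
    and \<theta>_eq: "Comp (Pi1 U) (\<Theta> U W q) (\<theta> W q) = push U (\<Theta> V W q)"
    if W: "W \<in> \<B>" "W \<subseteq> V" and q: "q \<in> Ob (Q W)" for W q
  proof -
    have WU: "W \<subseteq> U" using W VU by blast
    note h = \<Theta>_Hom[OF U W(1) WU q]
    show p: "push U (\<Theta> V W q) \<in> Hom (Pi1 U) (FO (\<Psi> V) (FO (QI W V) q)) (base W)"
      by (rule push_Hom[OF VU \<Theta>_Hom[OF V W q]])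
    show "\<theta> W q \<in> Hom (Pi1 U) (FO (\<Psi> V) (FO (QI W V) q)) (FO (\<Psi> U) (FO (QI W U) q))"
      unfolding \<theta>_def by (rule Pi1.comp_Hom[OF Pi1.ginv_Hom[OF h] p])
    show "Comp (Pi1 U) (\<Theta> U W q) (\<theta> W q) = push U (\<Theta> V W q)"
      unfolding \<theta>_def using Pi1.assoc[OF h Pi1.ginv_Hom[OF h] p] Pi1.comp_ginv[OF h] Pi1.Idm_comp[OF p] by simp
  qed
  have "\<exists>\<eta>. nat_trans (Q V) (Pi1 U) (ftr_comp (Pi1_ind V U) (\<Psi> V)) (ftr_comp (\<Psi> U) (QI V U)) \<eta> \<and>
      (\<forall>W\<in>\<B>. W \<subseteq> V \<longrightarrow> (\<forall>q\<in>Ob (Q W). \<eta> (FO (QI W V) q) = \<theta> W q))"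
  proof (rule nat_trans_glue[OF Pi1_costack V])
    show "is_functor (Q V) (Pi1 U) (ftr_comp (Pi1_ind V U) (\<Psi> V))"
      by (rule is_functor_comp[OF \<Psi>_functor[OF V] is_functor_Pi1_ind[OF VU]])
    show "is_functor (Q V) (Pi1 U) (ftr_comp (\<Psi> U) (QI V U))"
      by (rule is_functor_comp[OF QI_functor[OF V U VU] \<Psi>_functor[OF U]])
  next
    fix W assume W: "W \<in> \<B>" "W \<subseteq> V"
    then have o: "open W" "W \<subseteq> U" using basis_open VU by auto
    note QW = Q_groupoid[OF o(1)]
    have bV: "base W \<in> V" using base[OF W(1)] W by blast
    show "nat_trans (Q W) (Pi1 U) (ftr_comp (ftr_comp (Pi1_ind V U) (\<Psi> V)) (QI W V)) (ftr_comp (ftr_comp (\<Psi> U) (QI V U)) (QI W V)) (\<theta> W)"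
    proof (rule nat_trans_cong[OF QW Pi1.nat_trans_comp[OF QW _ Pi1.nat_trans_inv[OF QW \<Theta>_nat[OF U W(1) o(2)]]]
            _ ftr_eq_QI_trans[OF o(1) V U W(2) VU, THEN ftr_eq_sym]])
      show "nat_trans (Q W) (Pi1 U) (ftr_comp (Pi1_ind V U) (ftr_comp (\<Psi> V) (QI W V))) (const_ftr U (base W))
          (\<lambda>q. push U (\<Theta> V W q))"
        by (rule nat_trans_cong[OF QW nat_trans_whisker_left[OF QW \<Theta>_nat[OF V W] is_functor_Pi1_ind[OF VU]] ftr_eq_refl])
          (simp_all add: ftr_eq_def push_Idm[OF VU bV])
    qed (simp_all add: ftr_eq_def \<theta>_def)
  next
    fix W W' q assume W: "W \<in> \<B>" "W' \<in> \<B>" "W \<subseteq> W'" "W' \<subseteq> V" and q: "q \<in> Ob (Q W)"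
    have o: "open W" "open W'" "W \<subseteq> V" "W \<subseteq> U" "W' \<subseteq> U" using basis_open W VU by auto
    let ?q = "FO (QI W W') q"
    have q': "?q \<in> Ob (Q W')" using QI_Ob[OF o(1,2) W(3) q] .
    have t: "FO (QI W' V) ?q = FO (QI W V) q" "FO (QI W' U) ?q = FO (QI W U) q"
      using QI_trans(1)[OF o(1,2) V W(3,4) q] QI_trans(1)[OF o(1,2) U W(3) o(5) q] by auto
    have ar: "push V (arrow W W') \<in> Hom (Pi1 V) (base W) (base W')" "push U (arrow W W') \<in> Hom (Pi1 U) (base W) (base W')"
      using push_Hom[OF W(4) arrow[OF W(1-3)]] push_Hom[OF o(5) arrow[OF W(1-3)]] by auto
    show "\<theta> W' ?q = \<theta> W q"
    proof (rule Pi1.left_cancel[OF \<Theta>_Hom[OF U W(2) o(5) q'] \<theta>_Hom[OF W(2,4) q']])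
      show "\<theta> W q \<in> Hom (Pi1 U) (FO (\<Psi> V) (FO (QI W' V) ?q)) (FO (\<Psi> U) (FO (QI W' U) ?q))"
        unfolding t by (rule \<theta>_Hom[OF W(1) o(3) q])
      have "Comp (Pi1 U) (\<Theta> U W' ?q) (\<theta> W' ?q) = push U (Comp (Pi1 V) (push V (arrow W W')) (\<Theta> V W q))"
        using \<theta>_eq[OF W(2,4) q'] \<Theta>_arrow[OF V W q] by simp
      also have "\<dots> = Comp (Pi1 U) (push U (arrow W W')) (push U (\<Theta> V W q))"
        using push_Comp[OF VU \<Theta>_Hom[OF V W(1) o(3) q] ar(1)] push_push[OF W(4) VU arrow[OF W(1-3)]] by simp
      also have "\<dots> = Comp (Pi1 U) (\<Theta> U W' ?q) (\<theta> W q)"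
        unfolding \<Theta>_arrow[OF U W(1-3) o(5) q] \<theta>_eq[OF W(1) o(3) q, symmetric]
        by (rule Pi1.assoc[OF ar(2) \<Theta>_Hom[OF U W(1) o(4) q] \<theta>_Hom[OF W(1) o(3) q], symmetric])
      finally show "Comp (Pi1 U) (\<Theta> U W' ?q) (\<theta> W' ?q) = Comp (Pi1 U) (\<Theta> U W' ?q) (\<theta> W q)" .
    qed
  qed
  then obtain \<eta> where "nat_trans (Q V) (Pi1 U) (ftr_comp (Pi1_ind V U) (\<Psi> V)) (ftr_comp (\<Psi> U) (QI V U)) \<eta>"
      "\<And>W q. W\<in>\<B> \<Longrightarrow> W \<subseteq> V \<Longrightarrow> q\<in>Ob (Q W) \<Longrightarrow> \<eta> (FO (QI W V) q) = \<theta> W q" by blast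
  then show ?thesis unfolding transition_def using \<theta>_eq by (intro exI[of _ \<eta>]) simp
qed

definition \<psi> :: "'a set \<Rightarrow> 'a set \<Rightarrow> 'qo \<Rightarrow> (real \<Rightarrow> 'a) set" where
  "\<psi> V U = (SOME \<eta>. transition V U \<eta>)"

lemma
  assumes "open V" "open U" "V \<subseteq> U"
  shows \<psi>_nat: "nat_trans (Q V) (Pi1 U) (ftr_comp (Pi1_ind V U) (\<Psi> V)) (ftr_comp (\<Psi> U) (QI V U)) (\<psi> V U)"
    and \<psi>_\<Theta>: "W \<in> \<B> \<Longrightarrow> W \<subseteq> V \<Longrightarrow> q \<in> Ob (Q W) \<Longrightarrow> Comp (Pi1 U) (\<Theta> U W q) (\<psi> V U (FO (QI W V) q)) = push U (\<Theta> V W q)"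
proof -
  have "transition V U (\<psi> V U)"
    unfolding \<psi>_def by (rule someI_ex[OF transition_ex[OF assms]])
  then show "nat_trans (Q V) (Pi1 U) (ftr_comp (Pi1_ind V U) (\<Psi> V)) (ftr_comp (\<Psi> U) (QI V U)) (\<psi> V U)"
    and "W \<in> \<B> \<Longrightarrow> W \<subseteq> V \<Longrightarrow> q \<in> Ob (Q W) \<Longrightarrow> Comp (Pi1 U) (\<Theta> U W q) (\<psi> V U (FO (QI W V) q)) = push U (\<Theta> V W q)"
    unfolding transition_def by simp_all
qed

lemma \<psi>_Hom: "open V \<Longrightarrow> open U \<Longrightarrow> V \<subseteq> U \<Longrightarrow> q \<in> Ob (Q V) \<Longrightarrow>
    \<psi> V U q \<in> Hom (Pi1 U) (FO (\<Psi> V) q) (FO (\<Psi> U) (FO (QI V U) q))"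
  using nat_trans_Hom[OF \<psi>_nat] by simp

text \<open>On a basic \<open>W\<close> both sides followed by \<open>\<Theta> U W q\<close> give
  the pushed \<open>\<Theta> Z W q\<close>. Cancelling there and testing on basic sets gives exact
  coherence, although \<open>\<psi>\<close> was chosen separately for each inclusion.\<close>

lemma \<psi>_trans:
  assumes Z: "open Z" and V: "open V" and U: "open U" and ZV: "Z \<subseteq> V" and VU: "V \<subseteq> U" and x: "x \<in> Ob (Q Z)"
  shows "\<psi> Z U x = Comp (Pi1 U) (\<psi> V U (FO (QI Z V) x)) (push U (\<psi> Z V x))"
proof (rule nat_trans_eqI[OF Pi1_costack Z \<psi>_nat[OF Z U] _ _ x])
  show ZU: "Z \<subseteq> U" using ZV VU by blast
  note QZ = Q_groupoid[OF Z]
  have 1: "nat_trans (Q Z) (Pi1 U) (ftr_comp (Pi1_ind Z U) (\<Psi> Z)) (ftr_comp (Pi1_ind V U) (ftr_comp (\<Psi> V) (QI Z V))) (\<lambda>x. push U (\<psi> Z V x))"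
  proof (rule nat_trans_cong[OF QZ nat_trans_whisker_left[OF QZ \<psi>_nat[OF Z V ZV] is_functor_Pi1_ind[OF VU]] _ ftr_eq_refl])
    show "ftr_eq (Q Z) (ftr_comp (Pi1_ind V U) (ftr_comp (Pi1_ind Z V) (\<Psi> Z))) (ftr_comp (Pi1_ind Z U) (\<Psi> Z))"
      unfolding ftr_eq_def using push_push[OF ZV VU functor_Hom[OF \<Psi>_functor[OF Z]]] by simp
  qed simp
  have 2: "nat_trans (Q Z) (Pi1 U) (ftr_comp (Pi1_ind V U) (ftr_comp (\<Psi> V) (QI Z V))) (ftr_comp (\<Psi> U) (QI Z U)) (\<lambda>x. \<psi> V U (FO (QI Z V) x))"
    by (rule nat_trans_cong[OF QZ nat_trans_whisker_right[OF QI_functor[OF Z V ZV] \<psi>_nat[OF V U VU]] _ ftr_eq_QI_trans[OF Z V U ZV VU]])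
      (simp_all add: ftr_eq_def)
  show "nat_trans (Q Z) (Pi1 U) (ftr_comp (Pi1_ind Z U) (\<Psi> Z)) (ftr_comp (\<Psi> U) (QI Z U))
      (\<lambda>x. Comp (Pi1 U) (\<psi> V U (FO (QI Z V) x)) (push U (\<psi> Z V x)))"
    by (rule Pi1.nat_trans_comp[OF QZ 1 2])
  fix W q assume W: "W \<in> \<B>" "W \<subseteq> Z" and q: "q \<in> Ob (Q W)"
  have o: "open W" "W \<subseteq> V" "W \<subseteq> U" using basis_open W ZV VU by auto
  let ?x = "FO (QI W Z) q"
  have x: "?x \<in> Ob (Q Z)" "FO (QI W V) q \<in> Ob (Q V)" "FO (QI Z V) ?x = FO (QI W V) q" "FO (QI Z U) ?x = FO (QI W U) q" "FO (QI V U) (FO (QI W V) q) = FO (QI W U) q"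
    using QI_Ob[OF o(1) Z W(2) q] QI_Ob[OF o(1) V o(2) q] QI_trans(1)[OF o(1) Z V W(2) ZV q]
      QI_trans(1)[OF o(1) Z U W(2) ZU q] QI_trans(1)[OF o(1) V U o(2) VU q] by auto
  have \<psi>1: "\<psi> Z V ?x \<in> Hom (Pi1 V) (FO (\<Psi> Z) ?x) (FO (\<Psi> V) (FO (QI W V) q))"
    using \<psi>_Hom[OF Z V ZV x(1)] x by simp
  have \<psi>2: "\<psi> V U (FO (QI W V) q) \<in> Hom (Pi1 U) (FO (\<Psi> V) (FO (QI W V) q)) (FO (\<Psi> U) (FO (QI W U) q))"
    using \<psi>_Hom[OF V U VU x(2)] x by simp
  note p1 = push_Hom[OF VU \<psi>1]
  note \<Theta>U = \<Theta>_Hom[OF U W(1) o(3) q]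
  show "\<psi> Z U ?x = Comp (Pi1 U) (\<psi> V U (FO (QI Z V) ?x)) (push U (\<psi> Z V ?x))"
    unfolding x(3)
  proof (rule Pi1.left_cancel[OF \<Theta>U _ Pi1.comp_Hom[OF \<psi>2 p1]])
    show "\<psi> Z U ?x \<in> Hom (Pi1 U) (FO (\<Psi> Z) ?x) (FO (\<Psi> U) (FO (QI W U) q))"
      using \<psi>_Hom[OF Z U ZU x(1)] x by simp
    have "Comp (Pi1 U) (\<Theta> U W q) (\<psi> Z U ?x) = push U (push V (\<Theta> Z W q))"
      using \<psi>_\<Theta>[OF Z U ZU W q] push_push[OF ZV VU \<Theta>_Hom[OF Z W q]] by simp
    also have "\<dots> = Comp (Pi1 U) (push U (\<Theta> V W q)) (push U (\<psi> Z V ?x))"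
      using \<psi>_\<Theta>[OF Z V ZV W q] push_Comp[OF VU \<psi>1 \<Theta>_Hom[OF V W(1) o(2) q]] by simp
    also have "\<dots> = Comp (Pi1 U) (\<Theta> U W q) (Comp (Pi1 U) (\<psi> V U (FO (QI W V) q)) (push U (\<psi> Z V ?x)))"
      unfolding \<psi>_\<Theta>[OF V U VU W(1) o(2) q, symmetric] by (rule Pi1.assoc[OF \<Theta>U \<psi>2 p1])
    finally show "Comp (Pi1 U) (\<Theta> U W q) (\<psi> Z U ?x) = Comp (Pi1 U) (\<Theta> U W q) (Comp (Pi1 U) (\<psi> V U (FO (QI W V) q)) (push U (\<psi> Z V ?x)))" .
  qed
qed

text \<open>By \<open>\<psi>_trans\<close> for three equal sets this arrow is idempotent in a
  groupoid.\<close>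

lemma \<psi>_refl:
  assumes "open U" "x \<in> Ob (Q U)"
  shows "\<psi> U U x = Idm (Pi1 U) (FO (\<Psi> U) x)"
proof -
  note h = \<psi>_Hom[OF assms(1,1) order_refl assms(2), unfolded QI_refl(1)[OF assms]]
  show ?thesis
    using \<psi>_trans[OF assms(1,1,1) order_refl order_refl assms(2)] push_self[OF h] QI_refl(1)[OF assms] Pi1.comp_Idm[OF h]
    by (intro Pi1.left_cancel[OF h h Pi1.Idm_Hom[OF Pi1.Hom_Ob(1)[OF h]]]) simp
qed

lemma comparison_pseudo_nat: "pseudo_nat Q QI Pi1 Pi1_ind \<Psi> \<psi>"
  unfolding pseudo_nat_def
proof (intro conjI allI impI ballI)
  show "is_functor (Q U) (Pi1 U) (\<Psi> U)" if "open U" for U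
    using \<Psi>_functor that .
  show "nat_trans (Q V) (Pi1 U) (ftr_comp (Pi1_ind V U) (\<Psi> V)) (ftr_comp (\<Psi> U) (QI V U)) (\<psi> V U)"
    if "open V \<and> open U \<and> V \<subseteq> U" for V U
    using \<psi>_nat that by simp
  show "\<psi> U U x = Idm (Pi1 U) (FO (\<Psi> U) x)" if "open U" "x \<in> Ob (Q U)" for U x
    using \<psi>_refl that .
  fix W V U x assume "open W \<and> open V \<and> open U \<and> W \<subseteq> V \<and> V \<subseteq> U" "x \<in> Ob (Q W)"
  then show "\<psi> W U x = Comp (Pi1 U) (\<psi> V U (FO (QI W V) x))
      (FM (Pi1_ind V U) (FO (Pi1_ind W V) (FO (\<Psi> W) x)) (FO (\<Psi> V) (FO (QI W V) x)) (\<psi> W V x))"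
    unfolding FM_Pi1_ind_push using \<psi>_trans[of W V U x] by blast
qed

section \<open>Existence and uniqueness of 2-cells between such morphisms\<close>

lemma
  assumes "pseudo_nat Q QI Pi1 Pi1_ind A a"
  shows pseudo_nat_functor: "open U \<Longrightarrow> is_functor (Q U) (Pi1 U) (A U)"
    and pseudo_nat_nat: "open V \<Longrightarrow> open U \<Longrightarrow> V \<subseteq> U \<Longrightarrow>
      nat_trans (Q V) (Pi1 U) (ftr_comp (Pi1_ind V U) (A V)) (ftr_comp (A U) (QI V U)) (a V U)"
    and pseudo_nat_trans: "open W \<Longrightarrow> open V \<Longrightarrow> open U \<Longrightarrow> W \<subseteq> V \<Longrightarrow> V \<subseteq> U \<Longrightarrow> x \<in> Ob (Q W) \<Longrightarrow>
      a W U x = Comp (Pi1 U) (a V U (FO (QI W V) x)) (push U (a W V x))"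
  using assms unfolding pseudo_nat_def by simp_all

lemma pseudo_nat_Hom:
  "pseudo_nat Q QI Pi1 Pi1_ind A a \<Longrightarrow> open V \<Longrightarrow> open U \<Longrightarrow> V \<subseteq> U \<Longrightarrow> x \<in> Ob (Q V) \<Longrightarrow>
    a V U x \<in> Hom (Pi1 U) (FO (A V) x) (FO (A U) (FO (QI V U) x))"
  using nat_trans_Hom[OF pseudo_nat_nat] by simp

lemma
  assumes "modif Q QI Pi1 Pi1_ind A a B b m"
  shows modif_nat: "open U \<Longrightarrow> nat_trans (Q U) (Pi1 U) (A U) (B U) (m U)"
    and modif_square: "open V \<Longrightarrow> open U \<Longrightarrow> V \<subseteq> U \<Longrightarrow> x \<in> Ob (Q V) \<Longrightarrow>
      Comp (Pi1 U) (m U (FO (QI V U) x)) (a V U x) = Comp (Pi1 U) (b V U x) (push U (m V x))"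
  using assms unfolding modif_def by simp_all

text \<open>On a basic \<open>W\<close> there is only one candidate arrow. The modification square
  for \<open>W \<subseteq> U\<close> carries this to \<open>U\<close>, since \<open>a W U q\<close>
  can be cancelled, and equality on basic sets suffices.\<close>

lemma modif_unique:
  assumes A: "pseudo_nat Q QI Pi1 Pi1_ind A a"
    and m: "modif Q QI Pi1 Pi1_ind A a B b m" and m': "modif Q QI Pi1 Pi1_ind A a B b m'"
  shows "modif_eq Q m m'"
  unfolding modif_eq_def
proof (intro allI impI ballI)
  fix U x assume U: "open U" and x: "x \<in> Ob (Q U)"
  show "m U x = m' U x"
  proof (rule nat_trans_eqI[OF Pi1_costack U modif_nat[OF m U] modif_nat[OF m' U] _ x])
    fix W q assume W: "W \<in> \<B>" "W \<subseteq> U" and q: "q \<in> Ob (Q W)"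
    note o = basis_open[OF W(1)]
    have eq: "m W q = m' W q"
      by (rule Pi1_simply_connected_unique[OF basis_sc[OF W(1)] nat_trans_Hom[OF modif_nat[OF m o] q]
            nat_trans_Hom[OF modif_nat[OF m' o] q]])
    have q': "FO (QI W U) q \<in> Ob (Q U)" using QI_Ob[OF o U W(2) q] .
    show "m U (FO (QI W U) q) = m' U (FO (QI W U) q)"
      by (rule Pi1.right_cancel[OF pseudo_nat_Hom[OF A o U W(2) q] nat_trans_Hom[OF modif_nat[OF m U] q']
            nat_trans_Hom[OF modif_nat[OF m' U] q']])
        (simp add: modif_square[OF m o U W(2) q] modif_square[OF m' o U W(2) q] eq)
  qed
qed

text \<open>On basic sets \<open>u\<close> is the only possible choice, so its naturality and its
  squares for inclusions hold by uniqueness of arrows. It is then carried to every open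
  \<open>U\<close> and glued there; squares between arbitrary open sets remain to be
  checked.\<close>

lemma modif_ex:
  assumes A: "pseudo_nat Q QI Pi1 Pi1_ind A a" and B: "pseudo_nat Q QI Pi1 Pi1_ind B b"
  shows "\<exists>n. modif Q QI Pi1 Pi1_ind A a B b n"
proof -
  note A_fun = pseudo_nat_functor[OF A] and B_fun = pseudo_nat_functor[OF B]
  note a_Hom = pseudo_nat_Hom[OF A] and b_Hom = pseudo_nat_Hom[OF B]
  define u where "u W q = (SOME c. c \<in> Hom (Pi1 W) (FO (A W) q) (FO (B W) q))" for W q
  have u: "u W q \<in> Hom (Pi1 W) (FO (A W) q) (FO (B W) q)" if W: "W \<in> \<B>" and q: "q \<in> Ob (Q W)" for W q
    unfolding u_def
    using Pi1_simply_connected_ex[OF basis_sc[OF W], of "FO (A W) q" "FO (B W) q"]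
      functor_Ob[OF A_fun[OF basis_open[OF W]] q] functor_Ob[OF B_fun[OF basis_open[OF W]] q]
    by (simp add: some_in_eq)
  have u_nat: "nat_trans (Q W) (Pi1 W) (A W) (B W) (u W)" if W: "W \<in> \<B>" for W
    unfolding nat_trans_def
  proof (intro conjI ballI allI impI A_fun B_fun basis_open[OF W] u[OF W])
    note o = basis_open[OF W]
    fix x y g assume g: "g \<in> Hom (Q W) x y"
    then have x: "x \<in> Ob (Q W)" and y: "y \<in> Ob (Q W)" using groupoid_Hom_Ob[OF Q_groupoid[OF o]] by blast+
    show "Comp (Pi1 W) (u W y) (FM (A W) x y g) = Comp (Pi1 W) (FM (B W) x y g) (u W x)"
      by (rule Pi1_simply_connected_unique[OF basis_sc[OF W] Pi1.comp_Hom[OF u[OF W y] functor_Hom[OF A_fun[OF o] g]]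
            Pi1.comp_Hom[OF functor_Hom[OF B_fun[OF o] g] u[OF W x]]])
  qed
  \<comment> \<open>The value forced by the modification square for \<open>W \<subseteq> U\<close>,
    solved for its left-hand arrow.\<close>
  define \<theta> where "\<theta> U W q = Comp (Pi1 U) (Comp (Pi1 U) (b W U q) (push U (u W q)))
      (Pi1.ginv U (FO (A W) q) (FO (A U) (FO (QI W U) q)) (a W U q))" for U W q
  have \<theta>_eq: "Comp (Pi1 U) (\<theta> U W q) (a W U q) = Comp (Pi1 U) (b W U q) (push U (u W q))"
    and \<theta>_Hom: "\<theta> U W q \<in> Hom (Pi1 U) (FO (A U) (FO (QI W U) q)) (FO (B U) (FO (QI W U) q))"
    if U: "open U" and W: "W \<in> \<B>" "W \<subseteq> U" and q: "q \<in> Ob (Q W)" for U W q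
  proof -
    note o = basis_open[OF W(1)]
    note h = a_Hom[OF o U W(2) q] and k = Pi1.comp_Hom[OF b_Hom[OF o U W(2) q] push_Hom[OF W(2) u[OF W(1) q]]]
    show "Comp (Pi1 U) (\<theta> U W q) (a W U q) = Comp (Pi1 U) (b W U q) (push U (u W q))"
      unfolding \<theta>_def by (rule Pi1.comp_ginv_eq[OF h k])
    show "\<theta> U W q \<in> Hom (Pi1 U) (FO (A U) (FO (QI W U) q)) (FO (B U) (FO (QI W U) q))"
      unfolding \<theta>_def by (rule Pi1.comp_Hom[OF k Pi1.ginv_Hom[OF h]])
  qed
  have ex: "\<exists>\<eta>. nat_trans (Q U) (Pi1 U) (A U) (B U) \<eta> \<and>
      (\<forall>W\<in>\<B>. W \<subseteq> U \<longrightarrow> (\<forall>q\<in>Ob (Q W). \<eta> (FO (QI W U) q) = \<theta> U W q))" if U: "open U" for U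
  proof (rule nat_trans_glue[OF Pi1_costack U A_fun[OF U] B_fun[OF U]])
    fix W assume W: "W \<in> \<B>" "W \<subseteq> U"
    note o = basis_open[OF W(1)]
    note QW = Q_groupoid[OF o]
    show "nat_trans (Q W) (Pi1 U) (ftr_comp (A U) (QI W U)) (ftr_comp (B U) (QI W U)) (\<theta> U W)"
      by (rule nat_trans_cong[OF QW Pi1.nat_trans_comp[OF QW Pi1.nat_trans_inv[OF QW pseudo_nat_nat[OF A o U W(2)]]
              Pi1.nat_trans_comp[OF QW nat_trans_whisker_left[OF QW u_nat[OF W(1)] is_functor_Pi1_ind[OF W(2)]]
                pseudo_nat_nat[OF B o U W(2)]]] ftr_eq_refl ftr_eq_refl])
        (simp add: \<theta>_def)
  next
    fix V W q assume V: "V \<in> \<B>" and W: "W \<in> \<B>" and VW: "V \<subseteq> W" and WU: "W \<subseteq> U" and q: "q \<in> Ob (Q V)"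
    note oV = basis_open[OF V] and oW = basis_open[OF W]
    have VU: "V \<subseteq> U" using VW WU by blast
    let ?q = "FO (QI V W) q"
    have q': "?q \<in> Ob (Q W)" using QI_Ob[OF oV oW VW q] .
    have t: "FO (QI W U) ?q = FO (QI V U) q" using QI_trans(1)[OF oV oW U VW WU q] .
    note aVW = a_Hom[OF oV oW VW q] and bVW = b_Hom[OF oV oW VW q]
    note aWU = a_Hom[OF oW U WU q'] and bWU = b_Hom[OF oW U WU q']
    note uV = u[OF V q] and uW = u[OF W q']
    note pa = push_Hom[OF WU aVW] and pb = push_Hom[OF WU bVW] and pu = push_Hom[OF WU uW]
    have sq: "Comp (Pi1 W) (u W ?q) (a V W q) = Comp (Pi1 W) (b V W q) (push W (u V q))"
      by (rule Pi1_simply_connected_unique[OF basis_sc[OF W] Pi1.comp_Hom[OF uW aVW]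
            Pi1.comp_Hom[OF bVW push_Hom[OF VW uV]]])
    have sq': "Comp (Pi1 U) (push U (u W ?q)) (push U (a V W q)) = Comp (Pi1 U) (push U (b V W q)) (push U (u V q))"
      using sq push_Comp[OF WU aVW uW] push_Comp[OF WU push_Hom[OF VW uV] bVW] push_push[OF VW WU uV] by simp
    have "Comp (Pi1 U) (\<theta> U W ?q) (Comp (Pi1 U) (a W U ?q) (push U (a V W q)))
        = Comp (Pi1 U) (Comp (Pi1 U) (b W U ?q) (push U (b V W q))) (push U (u V q))"
      by (rule Pi1.paste_squares[OF sq' \<theta>_eq[OF U W WU q'] push_Hom[OF VU uV] pu \<theta>_Hom[OF U W WU q'] pa aWU pb bWU])
    then have "Comp (Pi1 U) (\<theta> U W ?q) (a V U q) = Comp (Pi1 U) (\<theta> U V q) (a V U q)"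
      using pseudo_nat_trans[OF A oV oW U VW WU q] pseudo_nat_trans[OF B oV oW U VW WU q] \<theta>_eq[OF U V VU q] by simp
    then show "\<theta> U W ?q = \<theta> U V q"
      by (rule Pi1.right_cancel[OF a_Hom[OF oV U VU q] \<theta>_Hom[OF U W WU q', unfolded t] \<theta>_Hom[OF U V VU q]])
  qed
  define n where "n U = (SOME \<eta>. nat_trans (Q U) (Pi1 U) (A U) (B U) \<eta> \<and>
      (\<forall>W\<in>\<B>. W \<subseteq> U \<longrightarrow> (\<forall>q\<in>Ob (Q W). \<eta> (FO (QI W U) q) = \<theta> U W q)))" for U
  have n: "nat_trans (Q U) (Pi1 U) (A U) (B U) (n U) \<and>
      (\<forall>W\<in>\<B>. W \<subseteq> U \<longrightarrow> (\<forall>q\<in>Ob (Q W). n U (FO (QI W U) q) = \<theta> U W q))" if "open U" for U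
    unfolding n_def by (rule someI_ex[OF ex[OF that]])
  then have n_nat: "open U \<Longrightarrow> nat_trans (Q U) (Pi1 U) (A U) (B U) (n U)"
    and n_\<theta>: "open U \<Longrightarrow> W \<in> \<B> \<Longrightarrow> W \<subseteq> U \<Longrightarrow> q \<in> Ob (Q W) \<Longrightarrow> n U (FO (QI W U) q) = \<theta> U W q" for U W q
    by simp_all
  \<comment> \<open>The construction gives the squares from basic sets only. For arbitrary
    \<open>V \<subseteq> U\<close> the square is tested on basic \<open>W \<subseteq> V\<close>,
    where precomposing with the pushed \<open>a W V q\<close> reduces it to the squares from
    \<open>W\<close> to \<open>V\<close> and from \<open>W\<close> to \<open>U\<close>.\<close>
  have "Comp (Pi1 U) (n U (FO (QI V U) x)) (a V U x) = Comp (Pi1 U) (b V U x) (push U (n V x))"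
    if V: "open V" and U: "open U" and VU: "V \<subseteq> U" and x: "x \<in> Ob (Q V)" for V U x
  proof (rule nat_trans_eqI[OF Pi1_costack V _ _ _ x])
    note QV = Q_groupoid[OF V]
    show "nat_trans (Q V) (Pi1 U) (ftr_comp (Pi1_ind V U) (A V)) (ftr_comp (B U) (QI V U))
        (\<lambda>x. Comp (Pi1 U) (n U (FO (QI V U) x)) (a V U x))"
      by (rule Pi1.nat_trans_comp[OF QV pseudo_nat_nat[OF A V U VU] nat_trans_whisker_right[OF QI_functor[OF V U VU] n_nat[OF U]]])
    show "nat_trans (Q V) (Pi1 U) (ftr_comp (Pi1_ind V U) (A V)) (ftr_comp (B U) (QI V U))
        (\<lambda>x. Comp (Pi1 U) (b V U x) (push U (n V x)))"
      using Pi1.nat_trans_comp[OF QV nat_trans_whisker_left[OF QV n_nat[OF V] is_functor_Pi1_ind[OF VU]] pseudo_nat_nat[OF B V U VU]]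
      by simp
    fix W q assume W: "W \<in> \<B>" "W \<subseteq> V" and q: "q \<in> Ob (Q W)"
    note o = basis_open[OF W(1)]
    have WU: "W \<subseteq> U" using W VU by blast
    let ?x = "FO (QI W V) q"
    have x: "?x \<in> Ob (Q V)" using QI_Ob[OF o V W(2) q] .
    have t: "FO (QI V U) ?x = FO (QI W U) q" using QI_trans(1)[OF o V U W(2) VU q] .
    note aWV = a_Hom[OF o V W(2) q] and bWV = b_Hom[OF o V W(2) q]
    note aVU = a_Hom[OF V U VU x, unfolded t] and bVU = b_Hom[OF V U VU x, unfolded t]
    note uW = u[OF W(1) q] and nV = nat_trans_Hom[OF n_nat[OF V] x]
    note pa = push_Hom[OF VU aWV] and pb = push_Hom[OF VU bWV] and pn = push_Hom[OF VU nV] and pu = push_Hom[OF WU uW]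
    have nU: "n U (FO (QI W U) q) \<in> Hom (Pi1 U) (FO (A U) (FO (QI W U) q)) (FO (B U) (FO (QI W U) q))"
      using nat_trans_Hom[OF n_nat[OF U] QI_Ob[OF o U WU q]] .
    have sqV: "Comp (Pi1 V) (n V ?x) (a W V q) = Comp (Pi1 V) (b W V q) (push V (u W q))"
      using n_\<theta>[OF V W q] \<theta>_eq[OF V W q] by simp
    have sqU: "Comp (Pi1 U) (n U (FO (QI W U) q)) (a W U q) = Comp (Pi1 U) (b W U q) (push U (u W q))"
      using n_\<theta>[OF U W(1) WU q] \<theta>_eq[OF U W(1) WU q] by simp
    have sqV': "Comp (Pi1 U) (push U (n V ?x)) (push U (a W V q)) = Comp (Pi1 U) (push U (b W V q)) (push U (u W q))"
      using sqV push_Comp[OF VU aWV nV] push_Comp[OF VU push_Hom[OF W(2) uW] bWV] push_push[OF W(2) VU uW] by simp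
    have "Comp (Pi1 U) (Comp (Pi1 U) (n U (FO (QI W U) q)) (a V U ?x)) (push U (a W V q))
        = Comp (Pi1 U) (n U (FO (QI W U) q)) (a W U q)"
      unfolding pseudo_nat_trans[OF A o V U W(2) VU q] by (rule Pi1.assoc[OF nU aVU pa])
    also have "\<dots> = Comp (Pi1 U) (b V U ?x) (Comp (Pi1 U) (push U (b W V q)) (push U (u W q)))"
      unfolding sqU pseudo_nat_trans[OF B o V U W(2) VU q] by (rule Pi1.assoc[OF bVU pb pu])
    also have "\<dots> = Comp (Pi1 U) (Comp (Pi1 U) (b V U ?x) (push U (n V ?x))) (push U (a W V q))"
      unfolding sqV'[symmetric] by (rule Pi1.assoc[OF bVU pn pa, symmetric])
    finally show "Comp (Pi1 U) (n U (FO (QI V U) ?x)) (a V U ?x) = Comp (Pi1 U) (b V U ?x) (push U (n V ?x))"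
      unfolding t by (rule Pi1.right_cancel[OF pa Pi1.comp_Hom[OF nU aVU] Pi1.comp_Hom[OF bVU pn]])
  qed
  then have "modif Q QI Pi1 Pi1_ind A a B b n"
    unfolding modif_def using n_nat by simp
  then show ?thesis by blast
qed

end

section \<open>The terminal groupoid and the universal property\<close>

lemma groupoid_one: "groupoid one_grpd"
  by (simp add: groupoid_def one_grpd_def)

lemma is_functor_one: "groupoid C \<Longrightarrow> is_functor C one_grpd F"
  by (simp add: is_functor_def one_grpd_def)

lemma nat_trans_one: "groupoid C \<Longrightarrow> nat_trans C one_grpd F G \<eta>"
  by (simp add: nat_trans_def is_functor_one) (simp add: one_grpd_def)

text \<open>All equations between arrows of \<open>one_grpd\<close> hold because they have type
  \<open>unit\<close>. Hence every triangle over \<open>P\<close> can be filled by a 2-cell.\<close>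

lemma modif_one:
  "(\<And>U. open U \<Longrightarrow> groupoid (Q U)) \<Longrightarrow> modif Q QI P_const P_ind A a B b m"
  by (simp add: modif_def P_const_def nat_trans_one)

theorem theorem3p3:
  fixes Q :: "'a::topological_space set \<Rightarrow> ('qo, 'qm) cat"
    and QI :: "'a set \<Rightarrow> 'a set \<Rightarrow> ('qo, 'qm, 'qo, 'qm) ftr"
  assumes good: "good_space TYPE('a)"
  shows
    \<comment> \<open>P is a functor and U \<mapsto> Pi_1(U) is a costack (w.r.t. groupoids D of any type)
        with a morphism epsilon to P\<close>
    "off_functor (P_const :: 'a set \<Rightarrow> (unit, unit) cat) P_ind \<and>
     off_functor (Pi1 :: 'a set \<Rightarrow> _) Pi1_ind \<and>
     (\<forall>D :: ('do, 'dm) cat. groupoid D \<longrightarrow> costack_wrt (Pi1 :: 'a set \<Rightarrow> _) Pi1_ind D) \<and>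
     pseudo_nat Pi1 Pi1_ind P_const P_ind
        (eps_F :: 'a set \<Rightarrow> ('a, (real \<Rightarrow> 'a) set, unit, unit) ftr) eps_c \<and>
     \<comment> \<open>universal property among costacks Q (associated costack)\<close>
     (off_functor Q QI \<and>
      (\<forall>D :: ('a, (real \<Rightarrow> 'a) set) cat. groupoid D \<longrightarrow> costack_wrt Q QI D) \<longrightarrow>
        \<comment> \<open>every morphism Q \<rightarrow> P factors through epsilon up to a 2-cell\<close>
        (\<forall>\<Phi> \<phi>. pseudo_nat Q QI P_const P_ind \<Phi> \<phi> \<longrightarrow>
           (\<exists>\<Psi> \<psi> m. pseudo_nat Q QI Pi1 Pi1_ind \<Psi> \<psi> \<and>
              modif Q QI P_const P_ind
                (pn_comp_F eps_F \<Psi>) (pn_comp_c P_const Pi1_ind QI eps_F eps_c \<Psi> \<psi>) \<Phi> \<phi> m)) \<and>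
        \<comment> \<open>essentially uniquely: whiskering with epsilon is bijective on 2-cells\<close>
        (\<forall>\<Psi> \<psi> \<Psi>' \<psi>' n'. pseudo_nat Q QI Pi1 Pi1_ind \<Psi> \<psi> \<and> pseudo_nat Q QI Pi1 Pi1_ind \<Psi>' \<psi>' \<and>
           modif Q QI P_const P_ind
             (pn_comp_F eps_F \<Psi>) (pn_comp_c P_const Pi1_ind QI eps_F eps_c \<Psi> \<psi>)
             (pn_comp_F eps_F \<Psi>') (pn_comp_c P_const Pi1_ind QI eps_F eps_c \<Psi>' \<psi>') n' \<longrightarrow>
           (\<exists>n. modif Q QI Pi1 Pi1_ind \<Psi> \<psi> \<Psi>' \<psi>' n \<and> modif_eq Q (whisker eps_F \<Psi> \<Psi>' n) n' \<and>
                (\<forall>n2. modif Q QI Pi1 Pi1_ind \<Psi> \<psi> \<Psi>' \<psi>' n2 \<and> modif_eq Q (whisker eps_F \<Psi> \<Psi>' n2) n'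
                      \<longrightarrow> modif_eq Q n2 n))) \<and>
        \<comment> \<open>consequently Pi_1 is 2-terminal: Hom(Q, Pi_1) is equivalent to 1\<close>
        (\<exists>\<Psi> \<psi>. pseudo_nat Q QI Pi1 Pi1_ind \<Psi> \<psi>) \<and>
        (\<forall>\<Psi> \<psi> \<Psi>' \<psi>'. pseudo_nat Q QI Pi1 Pi1_ind \<Psi> \<psi> \<and> pseudo_nat Q QI Pi1 Pi1_ind \<Psi>' \<psi>' \<longrightarrow>
           (\<exists>n. modif Q QI Pi1 Pi1_ind \<Psi> \<psi> \<Psi>' \<psi>' n \<and>
                (\<forall>n2. modif Q QI Pi1 Pi1_ind \<Psi> \<psi> \<Psi>' \<psi>' n2 \<longrightarrow> modif_eq Q n2 n))))"
proof (intro conjI)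
  show "off_functor (P_const :: 'a set \<Rightarrow> (unit, unit) cat) P_ind"
    by (simp add: off_functor_def P_const_def groupoid_one is_functor_one)
  show "off_functor (Pi1 :: 'a set \<Rightarrow> _) Pi1_ind"
    by (rule off_functor_Pi1)
  show "\<forall>D :: ('do, 'dm) cat. groupoid D \<longrightarrow> costack_wrt (Pi1 :: 'a set \<Rightarrow> _) Pi1_ind D"
    using grpd.Pi1_costack_wrt[OF grpd.intro] by blast
  show "pseudo_nat Pi1 Pi1_ind P_const P_ind
      (eps_F :: 'a set \<Rightarrow> ('a, (real \<Rightarrow> 'a) set, unit, unit) ftr) eps_c"
    by (simp add: pseudo_nat_def P_const_def is_functor_one nat_trans_one groupoid_Pi1)
next
  \<comment> \<open>The empty set is vacuously simply connected; it is excluded so that every basic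
    set has a base point.\<close>
  define \<B> :: "'a set set" where "\<B> = {W. open W \<and> W \<noteq> {} \<and> simply_connected W}"
  have cover: "\<Union>{W \<in> \<B>. W \<subseteq> U} = U" if U: "open U" for U
  proof
    from good[unfolded good_space_def, rule_format, OF U]
    obtain \<U> where \<U>: "\<forall>V\<in>\<U>. open V" "\<Union>\<U> = U" "\<forall>V\<in>\<U>. simply_connected V"
      by (elim exE conjE)
    show "U \<subseteq> \<Union>{W \<in> \<B>. W \<subseteq> U}"
    proof
      fix x assume "x \<in> U"
      then obtain V where "V \<in> \<U>" "x \<in> V" using \<U>(2) by blast
      then show "x \<in> \<Union>{W \<in> \<B>. W \<subseteq> U}" using \<U> by (auto simp: \<B>_def)
    qed
  qed blast
  have "(\<exists>\<Psi> \<psi>. pseudo_nat Q QI Pi1 Pi1_ind \<Psi> \<psi>) \<and>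
      (\<forall>\<Psi> \<psi> \<Psi>' \<psi>'. pseudo_nat Q QI Pi1 Pi1_ind \<Psi> \<psi> \<and> pseudo_nat Q QI Pi1 Pi1_ind \<Psi>' \<psi>' \<longrightarrow>
        (\<exists>n. modif Q QI Pi1 Pi1_ind \<Psi> \<psi> \<Psi>' \<psi>' n \<and>
          (\<forall>n2. modif Q QI Pi1 Pi1_ind \<Psi> \<psi> \<Psi>' \<psi>' n2 \<longrightarrow> modif_eq Q n2 n)))"
    if Q: "off_functor Q QI" "\<forall>D :: ('a, (real \<Rightarrow> 'a) set) cat. groupoid D \<longrightarrow> costack_wrt Q QI D"
  proof -
    interpret costack_over_Pi1 Q QI \<B>
      using Q cover by unfold_locales (auto simp: \<B>_def)
    show ?thesis
      using comparison_pseudo_nat modif_ex modif_unique by meson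
  qed
  \<comment> \<open>With existence and equality of all 2-cells into \<open>P\<close>, both clauses
    about factorisation through the morphism to \<open>P\<close> reduce to the 2-terminality just
    obtained.\<close>
  moreover have "modif Q QI P_const P_ind A a B b m" if "off_functor Q QI" for A a B b m
    using that by (intro modif_one) (simp add: off_functor_def)
  moreover have "modif_eq Q m m'" for m m' :: "'a set \<Rightarrow> 'qo \<Rightarrow> unit"
    by (simp add: modif_eq_def)
  ultimately show "off_functor Q QI \<and> (\<forall>D :: ('a, (real \<Rightarrow> 'a) set) cat. groupoid D \<longrightarrow> costack_wrt Q QI D) \<longrightarrow>
        (\<forall>\<Phi> \<phi>. pseudo_nat Q QI P_const P_ind \<Phi> \<phi> \<longrightarrow>
           (\<exists>\<Psi> \<psi> m. pseudo_nat Q QI Pi1 Pi1_ind \<Psi> \<psi> \<and>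
              modif Q QI P_const P_ind
                (pn_comp_F eps_F \<Psi>) (pn_comp_c P_const Pi1_ind QI eps_F eps_c \<Psi> \<psi>) \<Phi> \<phi> m)) \<and>
        (\<forall>\<Psi> \<psi> \<Psi>' \<psi>' n'. pseudo_nat Q QI Pi1 Pi1_ind \<Psi> \<psi> \<and> pseudo_nat Q QI Pi1 Pi1_ind \<Psi>' \<psi>' \<and>
           modif Q QI P_const P_ind
             (pn_comp_F eps_F \<Psi>) (pn_comp_c P_const Pi1_ind QI eps_F eps_c \<Psi> \<psi>)
             (pn_comp_F eps_F \<Psi>') (pn_comp_c P_const Pi1_ind QI eps_F eps_c \<Psi>' \<psi>') n' \<longrightarrow>
           (\<exists>n. modif Q QI Pi1 Pi1_ind \<Psi> \<psi> \<Psi>' \<psi>' n \<and> modif_eq Q (whisker eps_F \<Psi> \<Psi>' n) n' \<and>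
                (\<forall>n2. modif Q QI Pi1 Pi1_ind \<Psi> \<psi> \<Psi>' \<psi>' n2 \<and> modif_eq Q (whisker eps_F \<Psi> \<Psi>' n2) n'
                      \<longrightarrow> modif_eq Q n2 n))) \<and>
        (\<exists>\<Psi> \<psi>. pseudo_nat Q QI Pi1 Pi1_ind \<Psi> \<psi>) \<and>
        (\<forall>\<Psi> \<psi> \<Psi>' \<psi>'. pseudo_nat Q QI Pi1 Pi1_ind \<Psi> \<psi> \<and> pseudo_nat Q QI Pi1 Pi1_ind \<Psi>' \<psi>' \<longrightarrow>
           (\<exists>n. modif Q QI Pi1 Pi1_ind \<Psi> \<psi> \<Psi>' \<psi>' n \<and>
                (\<forall>n2. modif Q QI Pi1 Pi1_ind \<Psi> \<psi> \<Psi>' \<psi>' n2 \<longrightarrow> modif_eq Q n2 n)))"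
    by simp
qed

end
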